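(* For real $k$ with $|k| < 4$ and complex $s$ with $\operatorname{Re}(s) > -1$, $s$ not an odd integer, \begin{align*} W_{2}(k;s) =\frac{1}{2 \pi} \frac{\tan(\frac{\pi s}{2})}{s+1} |k|^{1+s}\, {}_3 F_{2} \left(\tfrac{1}{2},\tfrac{1}{2} ,\tfrac{1}{2};1 +\tfrac{s}{2}, \tfrac{3}{2} + \tfrac{s}{2} ; \tfrac{k^2}{16} \right) + \frac{\Gamma(s+1)^2}{\Gamma(\frac{s}{2}+1)^4}\, {}_3 F_{2} \left(\tfrac{-s}{2} ,\tfrac{-s}{2},\tfrac{-s}{2}; \tfrac{1-s}{2},\tfrac{1}{2}; \tfrac{k^2}{16} \right). \end{align*}
   Context: For real $k$ and complex $s$ with $\operatorname{Re}(s)>-1$, $$W_2(k;s) = \frac{1}{(2 \pi i)^2} \int_{\mathbb{T}^2} \left|k + (x_1 + x_1^{-1})(x_2 + x_2^{-1}) \right|^s \frac{dx_1}{x_1} \frac{dx_2}{x_2},$$ $\mathbb{T}^2$ the unit torus in $\mathbb{C}^2$. ${}_3F_2$ is the generalized hypergeometric function $\sum_{n\ge0}\frac{(a_1)_n(a_2)_n(a_3)_n}{(b_1)_n(b_2)_n}\frac{z^n}{n!}$. *)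

theory Defs
  imports "HOL-Analysis.Analysis"
begin

text \<open>The integral of the two-form \<open>F x1 x2 dx1 dx2\<close> over the unit torus, as a Lebesgue
  integral in the parametrisation \<open>xj = cis tj\<close>, so that \<open>dxj = \<i> cis tj dtj\<close>.\<close>

definition torus_integral :: "(complex \<Rightarrow> complex \<Rightarrow> complex) \<Rightarrow> complex" where
  "torus_integral F =
     (LINT t : {0..2*pi} \<times> {0..2*pi} | lborel.
        F (cis (fst t)) (cis (snd t)) * (\<i> * cis (fst t)) * (\<i> * cis (snd t)))"

text \<open>The power is \<open>exp (s * ln r)\<close> with the real logarithm for \<open>r > 0\<close>. The convention
  \<open>0 powr s = 0\<close> only matters on the zero set of the base, which is a null set.\<close>

definition W2 :: "real \<Rightarrow> complex \<Rightarrow> complex" where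
  "W2 k s = 1 / (2 * of_real pi * \<i>)\<^sup>2 *
     torus_integral (\<lambda>x1 x2.
       of_real (cmod (of_real k + (x1 + inverse x1) * (x2 + inverse x2))) powr s / x1 / x2)"

definition hypergeom_3F2 ::
    "complex \<Rightarrow> complex \<Rightarrow> complex \<Rightarrow> complex \<Rightarrow> complex \<Rightarrow> complex \<Rightarrow> complex" where
  "hypergeom_3F2 a1 a2 a3 b1 b2 z =
     (\<Sum>n. (pochhammer a1 n * pochhammer a2 n * pochhammer a3 n) /
           (pochhammer b1 n * pochhammer b2 n) * (z ^ n / fact n))"

end

theory Submission
  imports Defs "HOL-Complex_Analysis.Complex_Analysis" "HOL-Real_Asymp.Real_Asymp"
begin

text \<open>
  Let \<open>-1 < s < 0\<close> be real, \<open>k \<noteq> 0\<close> and \<open>x = 4 / \<bar>k\<bar> > 1\<close>. In the parametrisation by angles,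
  \<open>W2 k s = \<bar>k\<bar> powr s * G x\<close>, where \<open>G\<close> arises from
  \<open>(\<bar>1 + x\<bar> powr s + \<bar>1 - x\<bar> powr s) / 2\<close> by averaging twice over \<open>x \<mapsto> x * \<bar>cos t\<bar>\<close>.
  A function given by \<open>\<Sum> b n * x ^ (2 * n)\<close> for \<open>x < 1\<close> and by \<open>\<Sum> a n * x powr (s - 2 * n)\<close> for
  \<open>x > 1\<close> is averaged term by term: the coefficients are multiplied by moments of the cosine, and for
  \<open>x > 1\<close> there appears an additional series in the odd powers \<open>x powr (-1 - 2 * j)\<close> whose coefficients
  are the values at \<open>w = 1 + 2 * j\<close> of the meromorphically continued Mellin transform
  \<open>\<Sum> b n / (2 * n + w) - \<Sum> a n / (s - 2 * n + w)\<close>. In the strip \<open>0 < w < -s\<close> this transform is a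
  product of Gamma factors, since averaging multiplies it by the moment of order \<open>-w\<close>. After the first
  average the odd series vanishes; after the second one it is the hypergeometric series with the factor
  \<open>tan (pi * s / 2)\<close>. All nonnegative series and integrals are manipulated by monotone convergence,
  which is what the restriction to \<open>-1 < s < 0\<close> is for; the general case follows by analytic
  continuation in \<open>s\<close>.
\<close>

section \<open>The arcsine law\<close>

text \<open>The obstacle is that the mean of \<open>c powr (s - 2 * n)\<close> under the whole
  arcsine law diverges at \<open>c = 0\<close> when \<open>n > 0\<close>. For \<open>x > 1\<close>
  only the range \<open>c > 1 / x\<close> meets these powers, and the integral over it is written as
  the Gamma continuation of the full moment minus the formally integrated power series at 0. This
  cutoff contributes powers \<open>(1 / x) ^ (1 + 2 * j)\<close> whose exponents do not depend on
  \<open>n\<close>, which is why all corrections collect into a single odd series. The Mellin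
  transform of the kernel contains the factor \<open>cos (pi * w / 2)\<close>. It vanishes at odd
  \<open>w\<close> and so removes the odd series from the first average. The moment of order
  \<open>-w\<close> has its poles in \<open>w > 0\<close> exactly at odd \<open>w\<close>; in the
  second average they cancel these zeros and leave finite nonzero values. Besides giving a nonempty
  strip, \<open>s < 0\<close> makes the even binomial coefficients nonnegative and keeps the
  continued moments of order \<open>s - 2 * n\<close> positive.\<close>

definition arcsine_coeff :: "nat \<Rightarrow> real" where
  "arcsine_coeff j = pochhammer (1/2) j / fact j"

text \<open>For \<open>p > -1\<close> this is the mean of \<open>\<bar>cos t\<bar> powr p\<close>; the Gamma quotient continues it to
  the negative orders that occur below.\<close>

definition cos_moment :: "real \<Rightarrow> real" where
  "cos_moment p = Gamma ((p + 1) / 2) / (sqrt pi * Gamma (p / 2 + 1))"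

lemma arcsine_coeff_0 [simp]: "arcsine_coeff 0 = 1"
  by (simp add: arcsine_coeff_def)

lemma arcsine_coeff_Suc: "arcsine_coeff (Suc j) * (2 * real j + 2) = arcsine_coeff j * (2 * real j + 1)"
  by (simp add: arcsine_coeff_def pochhammer_rec' field_simps del: of_nat_Suc)
     (simp add: field_simps)

lemma arcsine_coeff_pos: "arcsine_coeff j > 0"
  by (simp add: arcsine_coeff_def pochhammer_pos)

lemma arcsine_coeff_le_1: "arcsine_coeff j \<le> 1"
proof (induction j)
  case (Suc j)
  have "arcsine_coeff (Suc j) * (2 * real j + 2) \<le> 1 * (2 * real j + 2)"
    unfolding arcsine_coeff_Suc using Suc arcsine_coeff_pos[of j]
    by (intro mult_mono) auto
  then show ?case by (simp only: mult_le_cancel_right)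
qed auto

lemma sums_inverse_sqrt:
  assumes "\<bar>u\<bar> < 1"
  shows "(\<lambda>j. arcsine_coeff j * u ^ j) sums (1 / sqrt (1 - u))"
proof -
  have "((-1/2) gchoose j) * (-u) ^ j = arcsine_coeff j * u ^ j" for j
  proof -
    have "(-1) ^ j * (-u) ^ j = u ^ j" by (simp flip: power_mult_distrib)
    then show ?thesis
      by (simp add: arcsine_coeff_def gbinomial_pochhammer mult_ac)
  qed
  then have "(\<lambda>j. arcsine_coeff j * u ^ j) sums ((1 + (-u)) powr (-1/2))"
    using gen_binomial_real[of "-u" "-1/2"] assms by simp
  also have "(1 + (-u)) powr (-1/2) = 1 / sqrt (1 - u)"
    using assms powr_minus[of "1-u" "1/2"] by (simp add: powr_half_sqrt inverse_eq_divide)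
  finally show ?thesis .
qed

text \<open>Multiplying the series of \<open>1 / sqrt (1 - u)\<close> by \<open>1 - u\<close>
  subtracts the shifted series, and the ratio of consecutive coefficients turns the difference into
  a single coefficient over \<open>2 * j - 1\<close>. At \<open>j = 0\<close> the two signs cancel
  and give 1.\<close>

lemma sums_sqrt:
  assumes "\<bar>u\<bar> < 1"
  shows "(\<lambda>j. - (arcsine_coeff j / (2 * real j - 1)) * u ^ j) sums sqrt (1 - u)"
proof -
  note S = sums_inverse_sqrt[OF assms]
  have 1: "(\<lambda>j. case j of 0 \<Rightarrow> 0 | Suc i \<Rightarrow> u * (arcsine_coeff i * u ^ i)) sums (u * (1 / sqrt (1 - u)) + 0)"
    using sums_Suc[of "\<lambda>j. case j of 0 \<Rightarrow> 0 | Suc i \<Rightarrow> u * (arcsine_coeff i * u ^ i)"] sums_mult[OF S, of u]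
    by simp
  have "(\<lambda>j. arcsine_coeff j * u ^ j - (case j of 0 \<Rightarrow> 0 | Suc i \<Rightarrow> u * (arcsine_coeff i * u ^ i)))
      sums (1 / sqrt (1 - u) - (u * (1 / sqrt (1 - u)) + 0))"
    by (rule sums_diff[OF S 1])
  also have "1 / sqrt (1 - u) - (u * (1 / sqrt (1 - u)) + 0) = sqrt (1 - u)"
  proof -
    have "1 - u > 0" using assms by auto
    then show ?thesis by (simp add: field_simps)
  qed
  also have "(\<lambda>j. arcsine_coeff j * u ^ j - (case j of 0 \<Rightarrow> 0 | Suc i \<Rightarrow> u * (arcsine_coeff i * u ^ i)))
     = (\<lambda>j. - (arcsine_coeff j / (2 * real j - 1)) * u ^ j)"
  proof
    fix j show "arcsine_coeff j * u ^ j - (case j of 0 \<Rightarrow> 0 | Suc i \<Rightarrow> u * (arcsine_coeff i * u ^ i))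
      = - (arcsine_coeff j / (2 * real j - 1)) * u ^ j"
    proof (cases j)
      case (Suc i)
      have "arcsine_coeff i = arcsine_coeff (Suc i) * (2 * real i + 2) / (2 * real i + 1)"
        using arcsine_coeff_Suc[of i] by (simp add: field_simps)
      then have "arcsine_coeff (Suc i) - arcsine_coeff i = - (arcsine_coeff (Suc i) / (2 * real j - 1))"
        using Suc by (simp add: field_simps)
      then have "(arcsine_coeff (Suc i) - arcsine_coeff i) * (u * u ^ i)
          = - (arcsine_coeff (Suc i) / (2 * real j - 1)) * (u * u ^ i)" by simp
      then show ?thesis using Suc by (simp add: algebra_simps)
    qed auto
  qed
  finally show ?thesis .
qed

text \<open>Lowering \<open>p\<close> by 2 lowers both Gamma arguments by 1, so the functional
  equation applies twice; a non-integral \<open>p\<close> keeps both arguments off the poles.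
  Integration by parts gives truncated moments the same recursion with a boundary term.\<close>

lemma cos_moment_rec:
  assumes "p \<notin> \<int>"
  shows "(p - 1) * cos_moment (p - 2) = p * cos_moment p"
proof -
  have 1: "(p - 1) / 2 \<notin> \<int>\<^sub>\<le>\<^sub>0"
  proof
    assume "(p - 1) / 2 \<in> \<int>\<^sub>\<le>\<^sub>0"
    then have "2 * ((p - 1) / 2) + 1 \<in> \<int>" by (intro Ints_add Ints_mult) auto
    also have "2 * ((p - 1) / 2) + 1 = p" by (simp add: diff_divide_distrib)
    finally show False using assms by simp
  qed
  have 2: "p / 2 \<notin> \<int>\<^sub>\<le>\<^sub>0"
  proof
    assume "p / 2 \<in> \<int>\<^sub>\<le>\<^sub>0"
    then have "2 * (p / 2) \<in> \<int>" by (intro Ints_mult) auto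
    with assms show False by simp
  qed
  have "p \<noteq> 0" using assms by auto
  have "Gamma ((p - 1) / 2 + 1) = (p - 1) / 2 * Gamma ((p - 1) / 2)"
    by (rule Gamma_plus1[OF 1])
  then have a: "Gamma ((p + 1) / 2) = (p - 1) / 2 * Gamma ((p - 1) / 2)"
    by (simp add: field_simps)
  have b: "Gamma (p / 2 + 1) = p / 2 * Gamma (p / 2)" by (rule Gamma_plus1[OF 2])
  have e: "(p - 2 + 1) / 2 = (p - 1) / 2" "(p - 2) / 2 + 1 = p / 2" by (simp_all add: field_simps)
  show ?thesis
    unfolding cos_moment_def a b e using \<open>p \<noteq> 0\<close>
    by (cases "Gamma (p / 2) = 0") (auto simp: divide_simps)
qed

lemma cos_moment_pos: "p > -1 \<Longrightarrow> cos_moment p > 0"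
  unfolding cos_moment_def by (intro divide_pos_pos mult_pos_pos Gamma_real_pos) auto

text \<open>The substitution \<open>u = c\<^sup>2\<close> gives half of a Beta integral with
  parameters \<open>(p + 1) / 2\<close> and \<open>1 / 2\<close>; the factor \<open>1/2\<close> in
  \<open>?f\<close> absorbs the 2 of \<open>du = 2 c dc\<close>.\<close>

lemma nn_integral_arcsine_moment:
  assumes "p > -1"
  shows "(\<integral>\<^sup>+c. ennreal (indicator {0<..<1} c * (c powr p / sqrt (1 - c\<^sup>2))) \<partial>lborel)
    = ennreal (pi / 2 * cos_moment p)"
proof -
  let ?f = "\<lambda>u::real. (1/2) * (u powr ((p+1)/2 - 1) * (1 - u) powr (1/2 - 1))"
  have "(\<integral>\<^sup>+u. ennreal (?f u * indicator {0\<^sup>2..1\<^sup>2} u) \<partial>lborel)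
      = (\<integral>\<^sup>+c. ennreal (?f (c\<^sup>2) * (2 * c) * indicator {0..1} c) \<partial>lborel)"
    by (rule nn_integral_substitution)
       (auto intro!: derivative_eq_intros continuous_intros simp: set_borel_measurable_def)
  also have "\<dots> = (\<integral>\<^sup>+c. ennreal (indicator {0<..<1} c * (c powr p / sqrt (1 - c\<^sup>2))) \<partial>lborel)"
  proof (rule nn_integral_cong_AE)
    have "AE c in lborel. c \<noteq> (0::real) \<and> c \<noteq> 1"
      using AE_lborel_singleton[of "0::real"] AE_lborel_singleton[of "1::real"] by eventually_elim auto
    then show "AE c in lborel. ennreal (?f (c\<^sup>2) * (2 * c) * indicator {0..1} c) =
        ennreal (indicator {0<..<1} c * (c powr p / sqrt (1 - c\<^sup>2)))"
    proof eventually_elim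
      case (elim c)
      show ?case
      proof (cases "0 < c \<and> c < 1")
        case True
        then have "c\<^sup>2 < 1" by (simp add: abs_square_less_1)
        have "(c\<^sup>2) powr ((p+1)/2 - 1) = c powr (p - 1)"
        proof -
          have "(c\<^sup>2) powr ((p+1)/2 - 1) = (c powr 2) powr ((p+1)/2 - 1)" using True by simp
          also have "\<dots> = c powr (2 * ((p+1)/2 - 1))" by (rule powr_powr)
          also have "2 * ((p+1)/2 - 1) = p - 1" by (simp add: add_divide_distrib)
          finally show ?thesis .
        qed
        moreover have "c powr (p - 1) * c = c powr p" using True by (simp add: powr_diff)
        moreover have "(1 - c\<^sup>2) powr (1/2 - 1) = 1 / sqrt (1 - c\<^sup>2)"
          using \<open>c\<^sup>2 < 1\<close> powr_minus[of "1-c\<^sup>2" "1/2"] by (simp add: powr_half_sqrt inverse_eq_divide)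
        ultimately show ?thesis using True by (simp add: mult_ac)
      qed (use elim in \<open>auto simp: indicator_def\<close>)
    qed
  qed
  finally have "(\<integral>\<^sup>+c. ennreal (indicator {0<..<1} c * (c powr p / sqrt (1 - c\<^sup>2))) \<partial>lborel)
     = (\<integral>\<^sup>+u. ennreal (?f u * indicator {0..1} u) \<partial>lborel)" by simp
  also have "\<dots> = (\<integral>\<^sup>+u. ennreal (?f u) * indicator {0..1} u \<partial>lborel)"
    by (intro nn_integral_cong) (auto simp: indicator_def)
  also have "\<dots> = ennreal (1/2 * Beta ((p+1)/2) (1/2))"
    by (intro nn_integral_has_integral_lebesgue' has_integral_mult_right has_integral_Beta_real)
       (use assms in auto)
  also have "1/2 * Beta ((p+1)/2) (1/2) = pi / 2 * cos_moment p"
  proof -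
    have "Gamma ((p+1)/2 + 1/2) = Gamma (p/2+1)" by (simp add: field_simps)
    moreover have "pi / 2 * (x / (sqrt pi * y)) = 1 / 2 * (x * sqrt pi / y)" for x y
    proof -
      have "q * q / 2 * (x / (q * y)) = 1 / 2 * (x * q / y)" if "q \<noteq> 0" for q using that by simp
      from this[of "sqrt pi"] show ?thesis by simp
    qed
    ultimately show ?thesis
      unfolding Beta_def cos_moment_def by (simp add: Gamma_one_half_real)
  qed
  finally show ?thesis .
qed

section \<open>Incomplete moments and their continuation to negative orders\<close>

lemma nn_integral_powr_from_0:
  assumes "q > -1" "d \<ge> 0"
  shows "(\<integral>\<^sup>+c. ennreal (c powr q) * indicator {0..d} c \<partial>lborel) = ennreal (d powr (q + 1) / (q + 1))"
  by (intro nn_integral_has_integral_lebesgue' has_integral_powr_from_0) (use assms in auto)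

text \<open>The series of \<open>c powr p / sqrt (1 - c\<^sup>2)\<close> integrated termwise from 0
  to \<open>d\<close>. For \<open>p < -1\<close> some of these integrals diverge, but the formula
  keeps its meaning as the value at \<open>d\<close> of a formal antiderivative.\<close>

definition arcsine_tail_term :: "real \<Rightarrow> real \<Rightarrow> nat \<Rightarrow> real" where
  "arcsine_tail_term p d j = arcsine_coeff j * d powr (p + 1 + 2 * real j) / (p + 1 + 2 * real j)"

lemma powr_add_even: "0 < d \<Longrightarrow> d powr (q + 2 * real j) = d powr q * (d\<^sup>2) ^ j"
  using powr_realpow[of d "2 * j"] by (simp add: powr_add power_mult)

lemma summable_arcsine_tail_term:
  assumes "0 < d" "d < 1"
  shows "summable (arcsine_tail_term p d)"
proof (rule summable_comparison_test_ev)
  show "summable (\<lambda>j. d powr (p + 1) * (d\<^sup>2) ^ j)"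
    using assms by (intro summable_mult summable_geometric) (simp add: abs_square_less_1)
  have "\<forall>\<^sub>F j in sequentially. real j \<ge> \<bar>p\<bar> + 2"
    using eventually_ge_at_top[of "nat \<lceil>\<bar>p\<bar> + 2\<rceil>"] by eventually_elim linarith
  then show "\<forall>\<^sub>F j in sequentially. norm (arcsine_tail_term p d j) \<le> d powr (p + 1) * (d\<^sup>2) ^ j"
  proof eventually_elim
    case (elim j)
    have "p + 1 + 2 * real j \<ge> 1" using elim by linarith
    then have "norm (arcsine_tail_term p d j)
        = arcsine_coeff j * (d powr (p + 1) * (d\<^sup>2) ^ j) / (p + 1 + 2 * real j)"
      using arcsine_coeff_pos[of j] assms
      by (simp add: arcsine_tail_term_def powr_add_even abs_mult)
    also have "\<dots> \<le> 1 * (d powr (p + 1) * (d\<^sup>2) ^ j) / 1"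
      using \<open>p + 1 + 2 * real j \<ge> 1\<close> arcsine_coeff_pos[of j] arcsine_coeff_le_1[of j] assms
      by (intro frac_le mult_mono mult_nonneg_nonneg) auto
    finally show ?case by simp
  qed
qed

text \<open>All terms of the binomial expansion are nonnegative, so sum and integral may be
  exchanged by monotone convergence; \<open>p > -1\<close> makes each single integral converge at
  0.\<close>

lemma nn_integral_arcsine_head:
  assumes "p > -1" "0 < d" "d < 1"
  shows "(\<integral>\<^sup>+c. ennreal (indicator {0<..d} c * (c powr p / sqrt (1 - c\<^sup>2))) \<partial>lborel)
    = ennreal (\<Sum>j. arcsine_tail_term p d j)"
proof -
  have "ennreal (indicator {0<..d} c * (c powr p / sqrt (1 - c\<^sup>2)))
      = (\<Sum>j. ennreal (arcsine_coeff j * (c powr (p + 2 * real j)) * indicator {0<..d} c))" for c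
  proof (cases "c \<in> {0<..d}")
    case True
    then have "c\<^sup>2 < 1" using assms by (simp add: abs_square_less_1)
    then have "(\<lambda>j. c powr p * (arcsine_coeff j * (c\<^sup>2) ^ j)) sums (c powr p * (1 / sqrt (1 - c\<^sup>2)))"
      by (intro sums_mult sums_inverse_sqrt) simp
    also have "(\<lambda>j. c powr p * (arcsine_coeff j * (c\<^sup>2) ^ j))
        = (\<lambda>j. arcsine_coeff j * (c powr (p + 2 * real j)) * indicator {0<..d} c)"
      using True by (intro ext) (simp add: powr_add_even)
    finally have *: "(\<lambda>j. arcsine_coeff j * (c powr (p + 2 * real j)) * indicator {0<..d} c)
        sums (c powr p * (1 / sqrt (1 - c\<^sup>2)))" .
    have "(\<Sum>j. ennreal (arcsine_coeff j * (c powr (p + 2 * real j)) * indicator {0<..d} c))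
        = ennreal (\<Sum>j. arcsine_coeff j * (c powr (p + 2 * real j)) * indicator {0<..d} c)"
      by (rule suminf_ennreal2[OF _ sums_summable[OF *]])
         (use arcsine_coeff_pos in \<open>simp add: less_imp_le\<close>)
    then show ?thesis using True by (simp add: sums_unique[OF *, symmetric])
  qed auto
  then have "(\<integral>\<^sup>+c. ennreal (indicator {0<..d} c * (c powr p / sqrt (1 - c\<^sup>2))) \<partial>lborel)
    = (\<Sum>j. \<integral>\<^sup>+c. ennreal (arcsine_coeff j * (c powr (p + 2 * real j)) * indicator {0<..d} c) \<partial>lborel)"
    by (simp add: nn_integral_suminf)
  also have "\<dots> = (\<Sum>j. ennreal (arcsine_tail_term p d j))"
  proof (rule suminf_cong)
    fix j
    have "(\<integral>\<^sup>+c. ennreal (arcsine_coeff j * (c powr (p + 2 * real j)) * indicator {0<..d} c) \<partial>lborel)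
       = (\<integral>\<^sup>+c. ennreal (arcsine_coeff j) * (ennreal (c powr (p + 2 * real j)) * indicator {0..d} c) \<partial>lborel)"
      using arcsine_coeff_pos[of j]
      by (intro nn_integral_cong) (auto simp: indicator_def ennreal_mult)
    also have "\<dots> = ennreal (arcsine_coeff j) * ennreal (d powr (p + 2 * real j + 1) / (p + 2 * real j + 1))"
      using assms by (subst nn_integral_cmult) (auto simp: nn_integral_powr_from_0)
    also have "\<dots> = ennreal (arcsine_tail_term p d j)"
      using assms arcsine_coeff_pos[of j]
      by (subst ennreal_mult[symmetric]) (auto simp: arcsine_tail_term_def add_ac)
    finally show "(\<integral>\<^sup>+c. ennreal (arcsine_coeff j * (c powr (p + 2 * real j)) * indicator {0<..d} c) \<partial>lborel)
       = ennreal (arcsine_tail_term p d j)" .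
  qed
  also have "(\<Sum>j. ennreal (arcsine_tail_term p d j)) = ennreal (\<Sum>j. arcsine_tail_term p d j)"
    using assms arcsine_coeff_pos
    by (intro suminf_ennreal2 summable_arcsine_tail_term)
       (auto simp: arcsine_tail_term_def intro!: divide_nonneg_nonneg mult_nonneg_nonneg less_imp_le)
  finally show ?thesis .
qed

text \<open>Full moment minus the part below \<open>d\<close>. For \<open>p < -1\<close> neither is
  an actual integral, and this is the Hadamard finite-part expression; the recursion in
  \<open>p\<close> shows that it still equals the convergent integral over
  \<open>[d, 1]\<close>.\<close>

definition arcsine_tail :: "real \<Rightarrow> real \<Rightarrow> real" where
  "arcsine_tail p d = pi / 2 * cos_moment p - (\<Sum>j. arcsine_tail_term p d j)"

lemma has_integral_arcsine_tail_base:
  assumes "p > -1" "0 < d" "d < 1"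
  shows "((\<lambda>c. c powr p / sqrt (1 - c\<^sup>2)) has_integral arcsine_tail p d) {d..1}"
proof -
  let ?f = "\<lambda>c::real. c powr p / sqrt (1 - c\<^sup>2)"
  let ?S = "\<Sum>j. arcsine_tail_term p d j"
  let ?X = "\<integral>\<^sup>+c. ennreal (indicator {d<..<1} c * ?f c) \<partial>lborel"
  have S0: "?S \<ge> 0"
    using assms arcsine_coeff_pos
    by (intro suminf_nonneg summable_arcsine_tail_term)
       (auto simp: arcsine_tail_term_def intro!: divide_nonneg_nonneg mult_nonneg_nonneg less_imp_le)
  have "(\<integral>\<^sup>+c. ennreal (indicator {0<..<1} c * ?f c) \<partial>lborel)
     = (\<integral>\<^sup>+c. ennreal (indicator {0<..d} c * ?f c) + ennreal (indicator {d<..<1} c * ?f c) \<partial>lborel)"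
    using assms by (intro nn_integral_cong) (auto simp: indicator_def)
  also have "\<dots> = ennreal ?S + ?X"
    by (subst nn_integral_add, simp, simp, subst nn_integral_arcsine_head[OF assms], rule refl)
  finally have eq: "ennreal (pi / 2 * cos_moment p) = ennreal ?S + ?X"
    using nn_integral_arcsine_moment[OF assms(1)] by simp
  \<comment> \<open>The total moment is finite, so the part above \<open>d\<close> is finite as well
    and the subtraction can be done in the reals.\<close>
  obtain r where r: "r \<ge> 0" "?X = ennreal r"
    by (cases ?X) (use eq in auto)
  have "pi / 2 * cos_moment p = ?S + r"
    using eq S0 r cos_moment_pos[OF assms(1)]
    by (simp flip: ennreal_plus)
  then have rr: "r = arcsine_tail p d" unfolding arcsine_tail_def by linarith
  have "((\<lambda>c. indicator {d<..<1} c * ?f c) has_integral r) UNIV"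
  proof (rule nn_integral_has_integral)
    show "0 \<le> indicator {d<..<1} c * ?f c" for c
    proof (cases "c \<in> {d<..<1}")
      case True
      then have "c\<^sup>2 \<le> 1" using assms by (simp add: abs_square_le_1)
      then show ?thesis by simp
    qed simp
  qed (use r in simp_all)
  then have "((\<lambda>c. if c \<in> {d..1} then ?f c else 0) has_integral r) UNIV"
    by (rule has_integral_spike_finite[of "{d,1}", rotated 2]) auto
  then show ?thesis by (simp only: has_integral_restrict_UNIV rr)
qed

text \<open>The full moments satisfy this recursion without a boundary term. The boundary term
  arises from the two series: their combination is \<open>d powr (p - 1)\<close> times the expansion
  of \<open>sqrt (1 - d\<^sup>2)\<close>.\<close>

lemma arcsine_tail_rec:
  assumes "p \<notin> \<int>" "0 < d" "d < 1"
  shows "(p - 1) * arcsine_tail (p - 2) d = p * arcsine_tail p d - d powr (p - 1) * sqrt (1 - d\<^sup>2)"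
proof -
  have d2: "\<bar>d\<^sup>2\<bar> < 1" using assms by (simp add: abs_square_less_1)
  have ne: "p - 1 + real_of_int j \<noteq> 0" for j
  proof
    assume "p - 1 + of_int j = 0"
    then have "p = of_int (1 - j)" by simp
    with assms(1) show False by simp
  qed
  let ?A = "\<lambda>j. (p - 1) * arcsine_tail_term (p - 2) d j"
  let ?B = "\<lambda>j. p * arcsine_tail_term p d j"
  have sA: "?A sums ((p - 1) * (\<Sum>j. arcsine_tail_term (p - 2) d j))"
    and sB: "?B sums (p * (\<Sum>j. arcsine_tail_term p d j))"
    using assms by (intro sums_mult summable_sums summable_arcsine_tail_term; simp)+
  \<comment> \<open>Shifted by one index, since the power of \<open>d\<close> in term
    \<open>i\<close> for order \<open>p\<close> is the power in term \<open>i + 1\<close> for order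
    \<open>p - 2\<close>.\<close>
  have sB': "(\<lambda>j. case j of 0 \<Rightarrow> 0 | Suc i \<Rightarrow> ?B i) sums (p * (\<Sum>j. arcsine_tail_term p d j))"
    using sums_Suc[of "\<lambda>j. case j of 0 \<Rightarrow> 0 | Suc i \<Rightarrow> ?B i", OF _] sB by simp
  have eq: "?A j - (case j of 0 \<Rightarrow> 0 | Suc i \<Rightarrow> ?B i)
      = d powr (p - 1) * (- (arcsine_coeff j / (2 * real j - 1)) * (d\<^sup>2) ^ j)" for j
  proof (cases j)
    case 0
    then show ?thesis using ne[of 0] by (simp add: arcsine_tail_term_def)
  next
    case (Suc i)
    have e1: "arcsine_coeff i = arcsine_coeff j * (2 * real j) / (2 * real j - 1)"
      using arcsine_coeff_Suc[of i] Suc by (simp add: field_simps)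
    have e2: "d powr (p + 1 + 2 * real i) = d powr (p - 1) * (d\<^sup>2) ^ j"
      using powr_add_even[OF assms(2), of "p - 1" j] Suc by (simp add: algebra_simps)
    have e3: "d powr (p - 2 + 1 + 2 * real j) = d powr (p - 1) * (d\<^sup>2) ^ j"
      using powr_add_even[OF assms(2), of "p - 1" j] by (simp add: algebra_simps)
    have q: "p + 1 + 2 * real i = p - 1 + 2 * real j" "p - 2 + 1 + 2 * real j = p - 1 + 2 * real j"
      using Suc by auto
    define Q where "Q = p - 1 + 2 * real j"
    have "Q \<noteq> 0" using ne[of "2 * int j"] by (simp add: Q_def)
    have J: "2 * real j - 1 \<noteq> 0" using Suc by simp
    \<comment> \<open>With \<open>p = Q - K\<close> the coefficient identity becomes rational in
      \<open>Q\<close> and \<open>K\<close>: the numerator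
      \<open>(Q - K - 1) * K - (Q - K) * (K + 1)\<close> collapses to \<open>- Q\<close>.\<close>
    define K where "K = 2 * real j - 1"
    have j2: "2 * real j = K + 1" and p: "p = Q - K" by (simp_all add: K_def Q_def)
    have "?A j - ?B i = d powr (p - 1) * (d\<^sup>2) ^ j * arcsine_coeff j *
        ((p - 1) / Q - p * (2 * real j) / (2 * real j - 1) / Q)"
    proof -
      have "?A j = (p - 1) * (arcsine_coeff j * (d powr (p - 1) * (d\<^sup>2) ^ j) / Q)"
        unfolding arcsine_tail_term_def e3 by (simp add: Q_def)
      moreover have "?B i = p * (arcsine_coeff j * (2 * real j) / (2 * real j - 1) * (d powr (p - 1) * (d\<^sup>2) ^ j) / Q)"
        unfolding arcsine_tail_term_def e2 unfolding e1 q Q_def ..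
      ultimately show ?thesis by (simp only: right_diff_distrib) (simp add: mult_ac)
    qed
    also have "(p - 1) / Q - p * (2 * real j) / (2 * real j - 1) / Q = - 1 / (2 * real j - 1)"
      using \<open>Q \<noteq> 0\<close> J unfolding j2 p by (simp add: field_simps)
    finally show ?thesis using Suc by simp
  qed
  have "(\<lambda>j. d powr (p - 1) * (- (arcsine_coeff j / (2 * real j - 1)) * (d\<^sup>2) ^ j)) sums
      ((p - 1) * (\<Sum>j. arcsine_tail_term (p - 2) d j) - p * (\<Sum>j. arcsine_tail_term p d j))"
    using sums_diff[OF sA sB'] unfolding eq .
  moreover have "(\<lambda>j. d powr (p - 1) * (- (arcsine_coeff j / (2 * real j - 1)) * (d\<^sup>2) ^ j)) sums
      (d powr (p - 1) * sqrt (1 - d\<^sup>2))"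
    by (intro sums_mult sums_sqrt d2)
  ultimately have "(p - 1) * (\<Sum>j. arcsine_tail_term (p - 2) d j) - p * (\<Sum>j. arcsine_tail_term p d j)
     = d powr (p - 1) * sqrt (1 - d\<^sup>2)"
    by (rule sums_unique2)
  moreover have "(p - 1) * cos_moment (p - 2) = p * cos_moment p"
    by (rule cos_moment_rec[OF assms(1)])
  ultimately show ?thesis unfolding arcsine_tail_def by (simp add: algebra_simps)
qed

text \<open>The function \<open>c powr (p - 1) * sqrt (1 - c\<^sup>2)\<close> is an antiderivative
  of the combination of orders \<open>p - 2\<close> and \<open>p\<close> below. It vanishes at 1, so
  only the boundary value at \<open>d\<close> remains, as in \<open>arcsine_tail_rec\<close>;
  dividing by \<open>p - 1\<close> descends from \<open>p\<close> to \<open>p - 2\<close>.\<close>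

lemma has_integral_arcsine_tail_step:
  assumes "p \<notin> \<int>" "0 < d" "d < 1"
    and I: "((\<lambda>c. c powr p / sqrt (1 - c\<^sup>2)) has_integral arcsine_tail p d) {d..1}"
  shows "((\<lambda>c. c powr (p - 2) / sqrt (1 - c\<^sup>2)) has_integral arcsine_tail (p - 2) d) {d..1}"
proof -
  have "p \<noteq> 1" using assms by auto
  have "((\<lambda>c. (p - 1) * (c powr (p - 2) / sqrt (1 - c\<^sup>2)) - p * (c powr p / sqrt (1 - c\<^sup>2))) has_integral
     (1 powr (p - 1) * sqrt (1 - 1\<^sup>2) - d powr (p - 1) * sqrt (1 - d\<^sup>2))) {d..1}"
  proof (rule fundamental_theorem_of_calculus_interior)
    show "continuous_on {d..1} (\<lambda>c. c powr (p - 1) * sqrt (1 - c\<^sup>2))"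
      using assms by (intro continuous_intros) auto
    fix c assume c: "c \<in> {d<..<1}"
    then have c0: "c > 0" and c1: "c\<^sup>2 < 1" using assms by (auto simp: abs_square_less_1)
    define r where "r = sqrt (1 - c\<^sup>2)"
    have r: "r > 0" "r * r = 1 - c\<^sup>2" using c1 by (auto simp: r_def)
    have e: "c powr p = c powr (p - 2) * c\<^sup>2" "c powr (p - 1) = c powr (p - 2) * c"
    proof -
      have "c powr p = c powr (p - 2 + 2)" "c powr (p - 1) = c powr (p - 2 + 1)" by simp_all
      then show "c powr p = c powr (p - 2) * c\<^sup>2" "c powr (p - 1) = c powr (p - 2) * c"
        unfolding powr_add using c0 by simp_all
    qed
    have "((\<lambda>c. c powr (p - 1) * sqrt (1 - c\<^sup>2)) has_real_derivative
        ((p - 1) * c powr (p - 1 - 1) * r + c powr (p - 1) * (- (2 * c) * (inverse r / 2)))) (at c)"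
    proof -
      have d1: "((\<lambda>c. c powr (p - 1)) has_real_derivative (p - 1) * c powr (p - 1 - 1)) (at c)"
        by (rule has_real_derivative_powr[OF c0])
      have "((\<lambda>c::real. 1 - c\<^sup>2) has_real_derivative (- (2 * c))) (at c)"
        by (auto intro!: derivative_eq_intros)
      from DERIV_chain2[OF DERIV_real_sqrt this]
      have d2: "((\<lambda>c. sqrt (1 - c\<^sup>2)) has_real_derivative inverse r / 2 * (- (2 * c))) (at c)"
        using c1 by (simp add: r_def)
      from DERIV_mult[OF d1 d2] show ?thesis by (simp add: r_def mult_ac)
    qed
    also have "(p - 1) * c powr (p - 1 - 1) * r + c powr (p - 1) * (- (2 * c) * (inverse r / 2))
       = (p - 1) * (c powr (p - 2) / r) - p * (c powr p / r)"
    proof -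
      have "(p - 1) * c powr (p - 1 - 1) * r = (p - 1) * c powr (p - 2) * (r * r) / r" using r(1) by simp
      also have "\<dots> = (p - 1) * c powr (p - 2) * (1 - c\<^sup>2) / r" unfolding r ..
      finally have *: "(p - 1) * c powr (p - 1 - 1) * r = (p - 1) * c powr (p - 2) * (1 - c\<^sup>2) / r" .
      show ?thesis
      proof -
        define X where "X = c powr (p - 2)"
        have "X * c * (- (2 * c) * (inverse r / 2)) = - (X * c\<^sup>2) / r"
          by (simp add: power2_eq_square inverse_eq_divide)
        moreover have "(p - 1) * (X / r) - p * (X * c\<^sup>2 / r) = ((p - 1) * X - p * (X * c\<^sup>2)) / r"
          by (simp add: diff_divide_distrib)
        moreover have "(p - 1) * X - p * (X * c\<^sup>2) = (p - 1) * X * (1 - c\<^sup>2) + - (X * c\<^sup>2)"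
          by algebra
        ultimately have "(p - 1) * X * (1 - c\<^sup>2) / r + X * c * (- (2 * c) * (inverse r / 2))
            = (p - 1) * (X / r) - p * (X * c\<^sup>2 / r)"
          by (simp only: add_divide_distrib)
        then show ?thesis unfolding * e X_def .
      qed
    qed
    finally show "((\<lambda>c. c powr (p - 1) * sqrt (1 - c\<^sup>2)) has_vector_derivative
        (p - 1) * (c powr (p - 2) / sqrt (1 - c\<^sup>2)) - p * (c powr p / sqrt (1 - c\<^sup>2))) (at c)"
      unfolding r_def by (simp add: has_real_derivative_iff_has_vector_derivative)
  qed (use assms in auto)
  from has_integral_add[OF this has_integral_mult_right[OF I, of p]]
  have "((\<lambda>c. (p - 1) * (c powr (p - 2) / sqrt (1 - c\<^sup>2))) has_integral
     (p - 1) * arcsine_tail (p - 2) d) {d..1}"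
    using arcsine_tail_rec[OF assms(1-3)] by simp
  from has_integral_mult_right[OF this, of "1 / (p - 1)"] show ?thesis
    using \<open>p \<noteq> 1\<close> by simp
qed

lemma has_integral_arcsine_tail:
  assumes "s \<notin> \<int>" "s > -1" "0 < d" "d < 1"
  shows "((\<lambda>c. c powr (s - 2 * real n) / sqrt (1 - c\<^sup>2)) has_integral arcsine_tail (s - 2 * real n) d) {d..1}"
proof (induction n)
  case 0
  then show ?case using has_integral_arcsine_tail_base[of s d] assms by simp
next
  case (Suc n)
  have "s - 2 * real n \<notin> \<int>"
  proof
    assume "s - 2 * real n \<in> \<int>"
    then have "s - 2 * real n + 2 * real n \<in> \<int>" by (intro Ints_add Ints_mult) auto
    with assms show False by simp
  qed
  from has_integral_arcsine_tail_step[OF this assms(3,4) Suc] show ?case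
    by (simp add: algebra_simps)
qed

section \<open>Two-sided expansions and the arcsine mean\<close>

text \<open>A majorant of product form makes the double family absolutely summable over pairs of
  indices. Iterated \<open>suminf\<close> is exchanged through \<open>infsum\<close>, with which it
  agrees for absolutely convergent series.\<close>

lemma suminf_swap:
  fixes f :: "nat \<Rightarrow> nat \<Rightarrow> real"
  assumes A: "summable A" "\<And>n. A n \<ge> 0" and B: "summable B" "\<And>n. B n \<ge> 0"
    and le: "\<And>n j. \<bar>f n j\<bar> \<le> A n * B j"
  shows "(\<Sum>n. \<Sum>j. f n j) = (\<Sum>j. \<Sum>n. f n j)"
    and "summable (\<lambda>n. \<Sum>j. f n j)"
    and "\<And>n. summable (f n)"
    and "\<And>j. summable (\<lambda>n. f n j)"
proof -
  have row: "summable (\<lambda>j. \<bar>f n j\<bar>)" for n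
    by (rule summable_comparison_test'[of "\<lambda>j. A n * B j"]) (use le B in \<open>auto intro: summable_mult\<close>)
  have col: "summable (\<lambda>n. \<bar>f n j\<bar>)" for j
    by (rule summable_comparison_test'[of "\<lambda>n. A n * B j"]) (use le A in \<open>auto intro: summable_mult2\<close>)
  show row': "summable (f n)" for n by (rule summable_rabs_cancel[OF row])
  show col': "summable (\<lambda>n. f n j)" for j by (rule summable_rabs_cancel[OF col])
  have rows: "\<bar>\<Sum>j. f n j\<bar> \<le> A n * suminf B" for n
  proof -
    have "\<bar>\<Sum>j. f n j\<bar> \<le> (\<Sum>j. \<bar>f n j\<bar>)" by (rule summable_rabs[OF row])
    also have "\<dots> \<le> (\<Sum>j. A n * B j)" by (intro suminf_le row summable_mult B le)
    finally show ?thesis by (simp add: suminf_mult[OF B(1)])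
  qed
  have cols: "\<bar>\<Sum>n. f n j\<bar> \<le> suminf A * B j" for j
  proof -
    have "\<bar>\<Sum>n. f n j\<bar> \<le> (\<Sum>n. \<bar>f n j\<bar>)" by (rule summable_rabs[OF col])
    also have "\<dots> \<le> (\<Sum>n. A n * B j)" by (intro suminf_le col summable_mult2 A le)
    finally show ?thesis by (simp add: suminf_mult2[OF A(1)])
  qed
  have rows': "summable (\<lambda>n. \<bar>\<Sum>j. f n j\<bar>)"
    by (rule summable_comparison_test'[of "\<lambda>n. A n * suminf B"]) (use rows A in \<open>auto intro: summable_mult2\<close>)
  have cols': "summable (\<lambda>j. \<bar>\<Sum>n. f n j\<bar>)"
    by (rule summable_comparison_test'[of "\<lambda>n. suminf A * B n"]) (use cols B in \<open>auto intro: summable_mult\<close>)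
  show "summable (\<lambda>n. \<Sum>j. f n j)" by (rule summable_rabs_cancel[OF rows'])
  have to_inf: "infsum g UNIV = suminf g" if "summable (\<lambda>n. \<bar>g n\<bar>)" for g :: "nat \<Rightarrow> real"
    using norm_summable_imp_has_sum[of g "suminf g"] that
    by (auto intro!: infsumI summable_sums summable_rabs_cancel)
  have "(\<lambda>(n, j). A n * B j) summable_on (SIGMA n:UNIV. UNIV)"
  proof (rule summable_on_SigmaI[where g = "\<lambda>n. A n * suminf B"])
    show "((\<lambda>j. case (n, j) of (n, j) \<Rightarrow> A n * B j) has_sum A n * suminf B) UNIV" for n
      using norm_summable_imp_has_sum[of "\<lambda>j. A n * B j" "A n * suminf B"] A B
      by (auto intro!: sums_mult summable_sums summable_mult)
    show "(\<lambda>n. A n * suminf B) summable_on UNIV"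
      using A B by (intro norm_summable_imp_summable_on) (simp add: abs_mult suminf_nonneg summable_mult2)
  qed (use A B in auto)
  then have "(\<lambda>p. norm (case p of (n, j) \<Rightarrow> f n j)) summable_on (UNIV \<times> UNIV)"
    by (rule Infinite_Sum.abs_summable_on_comparison_test') (use le in auto)
  then have "(\<lambda>(n, j). f n j) summable_on (UNIV \<times> UNIV)"
    by (rule Infinite_Sum.abs_summable_summable)
  from infsum_swap_banach[OF this] show "(\<Sum>n. \<Sum>j. f n j) = (\<Sum>j. \<Sum>n. f n j)"
    by (simp only: to_inf[OF row] to_inf[OF col] to_inf[OF rows'] to_inf[OF cols'])
qed

lemma nn_integral_powr_to_inf:
  assumes "q < -1"
  shows "(\<integral>\<^sup>+x. ennreal (x powr q) * indicator {1..} x \<partial>lborel) = ennreal (- 1 / (q + 1))"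
  using nn_integral_has_integral_lebesgue'[OF _ has_integral_powr_to_inf[OF assms, of 1]] by simp

text \<open>The weighted terms tend to 0, so \<open>a n\<close> grows at most linearly, which a
  geometric factor outweighs.\<close>

lemma summable_weighted_power:
  fixes a :: "nat \<Rightarrow> real"
  assumes "summable (\<lambda>n. a n / (real n + 1))" "\<And>n. a n \<ge> 0" "0 \<le> y" "y < 1"
  shows "summable (\<lambda>n. a n * y ^ n)"
proof -
  have "(\<lambda>n. a n / (real n + 1)) \<longlonglongrightarrow> 0" by (rule summable_LIMSEQ_zero[OF assms(1)])
  then have "Bseq (\<lambda>n. a n / (real n + 1))" by (simp add: convergentI convergent_imp_Bseq)
  then obtain K where K: "\<And>n. \<bar>a n / (real n + 1)\<bar> \<le> K" by (auto simp: Bseq_def)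
  have "summable (\<lambda>n. of_nat (Suc n) * y ^ n)"
    using geometric_deriv_sums[of y] assms by (auto simp: sums_iff)
  then have "summable (\<lambda>n. K * (of_nat (Suc n) * y ^ n))" by (rule summable_mult)
  then show ?thesis
  proof (rule summable_comparison_test')
    fix n
    have "a n \<le> K * (real n + 1)" using K[of n] assms(2)[of n] by (simp add: field_simps)
    then have "a n * y ^ n \<le> K * (real n + 1) * y ^ n" using assms by (intro mult_right_mono) auto
    then show "norm (a n * y ^ n) \<le> K * (of_nat (Suc n) * y ^ n)"
      using assms by (simp add: abs_mult algebra_simps)
  qed
qed

text \<open>The weight is the density of the absolute value of \<open>cos t\<close> for uniformly
  distributed \<open>t\<close>. The operator is a multiplicative convolution, hence diagonal under
  the Mellin transform.\<close>

definition arcsine_mean :: "(real \<Rightarrow> ennreal) \<Rightarrow> real \<Rightarrow> ennreal" where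
  "arcsine_mean G x = (\<integral>\<^sup>+c. ennreal (indicator {0<..<1} c * (2 / pi / sqrt (1 - c\<^sup>2))) * G (x * c) \<partial>lborel)"

lemma measurable_arcsine_mean [measurable]:
  assumes [measurable]: "G \<in> borel_measurable borel"
  shows "arcsine_mean G \<in> borel_measurable borel"
  unfolding arcsine_mean_def by measurable

lemma nn_integral_arcsine_density_powr:
  assumes "p > -1"
  shows "(\<integral>\<^sup>+c. ennreal (indicator {0<..<1} c * (2 / pi / sqrt (1 - c\<^sup>2))) * ennreal (c powr p) \<partial>lborel)
    = ennreal (cos_moment p)"
proof -
  have "(\<integral>\<^sup>+c. ennreal (indicator {0<..<1} c * (2 / pi / sqrt (1 - c\<^sup>2))) * ennreal (c powr p) \<partial>lborel)
     = (\<integral>\<^sup>+c. ennreal (2 / pi) * ennreal (indicator {0<..<1} c * (c powr p / sqrt (1 - c\<^sup>2))) \<partial>lborel)"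
    by (intro nn_integral_cong) (auto simp: indicator_def abs_square_le_1 simp flip: ennreal_mult' ennreal_mult'')
  also have "\<dots> = ennreal (2 / pi) * ennreal (pi / 2 * cos_moment p)"
    by (subst nn_integral_cmult, simp, subst nn_integral_arcsine_moment[OF assms], rule refl)
  also have "\<dots> = ennreal (cos_moment p)"
    by (simp flip: ennreal_mult')
  finally show ?thesis .
qed

text \<open>After Tonelli, the scaling \<open>x * c\<close> takes the factor
  \<open>c powr (-w)\<close> out of the inner Mellin integral, and the mean of that factor is a
  cosine moment. It is a convergent one because \<open>w < 1\<close>.\<close>

lemma nn_integral_Mellin_arcsine_mean:
  assumes [measurable]: "G \<in> borel_measurable borel" and w: "w < 1"
  shows "(\<integral>\<^sup>+x. ennreal (x powr (w - 1)) * indicator {0<..} x * arcsine_mean G x \<partial>lborel)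
    = ennreal (cos_moment (-w)) * (\<integral>\<^sup>+x. ennreal (x powr (w - 1)) * indicator {0<..} x * G x \<partial>lborel)"
proof -
  let ?d = "\<lambda>c. ennreal (indicator {0<..<1} c * (2 / pi / sqrt (1 - c\<^sup>2)))"
  let ?M = "\<integral>\<^sup>+x. ennreal (x powr (w - 1)) * indicator {0<..} x * G x \<partial>lborel"
  have "(\<integral>\<^sup>+x. ennreal (x powr (w - 1)) * indicator {0<..} x * arcsine_mean G x \<partial>lborel)
     = (\<integral>\<^sup>+x. \<integral>\<^sup>+c. ennreal (x powr (w - 1)) * indicator {0<..} x * (?d c * G (x * c)) \<partial>lborel \<partial>lborel)"
    unfolding arcsine_mean_def by (intro nn_integral_cong nn_integral_cmult[symmetric]) simp
  also have "\<dots> = (\<integral>\<^sup>+c. \<integral>\<^sup>+x. ennreal (x powr (w - 1)) * indicator {0<..} x * (?d c * G (x * c)) \<partial>lborel \<partial>lborel)"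
    by (rule lborel_pair.Fubini') measurable
  also have "\<dots> = (\<integral>\<^sup>+c. ?M * (?d c * ennreal (c powr (-w))) \<partial>lborel)"
  proof (rule nn_integral_cong)
    fix c :: real
    show "(\<integral>\<^sup>+x. ennreal (x powr (w - 1)) * indicator {0<..} x * (?d c * G (x * c)) \<partial>lborel)
       = ?M * (?d c * ennreal (c powr (-w)))"
    proof (cases "0 < c \<and> c < 1")
      case True
      have "?M = ennreal \<bar>c\<bar> * (\<integral>\<^sup>+x. ennreal ((0 + c * x) powr (w - 1)) * indicator {0<..} (0 + c * x) * G (0 + c * x) \<partial>lborel)"
        using True by (intro nn_integral_real_affine) auto
      also have "\<dots> = ennreal c * (\<integral>\<^sup>+x. ennreal (c powr (w - 1)) * (ennreal (x powr (w - 1)) * indicator {0<..} x * G (x * c)) \<partial>lborel)"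
        using True
        by (intro arg_cong2[where f = "(*)" and a = "ennreal \<bar>c\<bar>"] nn_integral_cong)
           (auto simp: indicator_def zero_less_mult_iff powr_mult ennreal_mult mult_ac)
      also have "\<dots> = ennreal (c powr w) * (\<integral>\<^sup>+x. ennreal (x powr (w - 1)) * indicator {0<..} x * G (x * c) \<partial>lborel)"
        using True
        by (subst nn_integral_cmult)
           (auto simp: powr_diff simp flip: mult.assoc ennreal_mult)
      finally have M: "?M = ennreal (c powr w) * (\<integral>\<^sup>+x. ennreal (x powr (w - 1)) * indicator {0<..} x * G (x * c) \<partial>lborel)" .
      have "?M * ennreal (c powr (-w)) = ennreal (c powr (-w)) * ennreal (c powr w) * (\<integral>\<^sup>+x. ennreal (x powr (w - 1)) * indicator {0<..} x * G (x * c) \<partial>lborel)"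
        unfolding M by (simp add: mult_ac)
      also have "ennreal (c powr (-w)) * ennreal (c powr w) = 1"
        using True by (simp flip: ennreal_mult powr_add)
      finally have M': "?M * ennreal (c powr (-w)) = (\<integral>\<^sup>+x. ennreal (x powr (w - 1)) * indicator {0<..} x * G (x * c) \<partial>lborel)"
        by simp
      have "(\<integral>\<^sup>+x. ennreal (x powr (w - 1)) * indicator {0<..} x * (?d c * G (x * c)) \<partial>lborel)
        = (\<integral>\<^sup>+x. ?d c * (ennreal (x powr (w - 1)) * indicator {0<..} x * G (x * c)) \<partial>lborel)"
        by (intro nn_integral_cong) (simp add: mult_ac)
      also have "\<dots> = ?d c * (\<integral>\<^sup>+x. ennreal (x powr (w - 1)) * indicator {0<..} x * G (x * c) \<partial>lborel)"
        by (rule nn_integral_cmult) simp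
      finally show ?thesis unfolding M'[symmetric] by (simp add: mult_ac)
    qed (auto simp: indicator_def)
  qed
  also have "\<dots> = ?M * (\<integral>\<^sup>+c. ?d c * ennreal (c powr (-w)) \<partial>lborel)"
    by (rule nn_integral_cmult) simp
  also have "(\<integral>\<^sup>+c. ?d c * ennreal (c powr (-w)) \<partial>lborel) = ennreal (cos_moment (-w))"
    using w by (intro nn_integral_arcsine_density_powr) auto
  finally show ?thesis by (simp add: mult.commute)
qed

text \<open>On the unit interval \<open>c powr (2 * n)\<close> is at most 1, and the density has
  total mass \<open>cos_moment 0 = 1\<close>.\<close>

lemma cos_moment_nat_le_1: "cos_moment (2 * real n) \<le> 1"
proof -
  have "ennreal (cos_moment (2 * real n)) \<le> ennreal (cos_moment 0)"
  proof (subst (1 2) nn_integral_arcsine_density_powr[symmetric]; (rule nn_integral_mono)?)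
    fix c :: real
    show "ennreal (indicator {0<..<1} c * (2 / pi / sqrt (1 - c\<^sup>2))) * ennreal (c powr (2 * real n))
       \<le> ennreal (indicator {0<..<1} c * (2 / pi / sqrt (1 - c\<^sup>2))) * ennreal (c powr 0)"
      by (cases "c \<in> {0<..<1}") (auto intro!: mult_left_mono ennreal_leI powr_le1 simp del: ennreal_1)
  qed auto
  moreover have "cos_moment 0 = 1" by (simp add: cos_moment_def Gamma_one_half_real)
  ultimately show ?thesis by (simp add: ennreal_le_iff)
qed

text \<open>Each step multiplies by \<open>p / (p - 1)\<close>, which lies between 0 and 1 for
  negative \<open>p\<close>. Thus the outer coefficients stay nonnegative and controlled after
  averaging, although these moments are no longer integrals of positive functions for
  \<open>n > 0\<close>.\<close>

lemma cos_moment_shift_bounds: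
  assumes "-1 < s" "s < 0"
  shows "0 < cos_moment (s - 2 * real n) \<and> cos_moment (s - 2 * real n) \<le> cos_moment s"
proof (induction n)
  case 0
  then show ?case using cos_moment_pos[of s] assms by simp
next
  case (Suc n)
  let ?p = "s - 2 * real n"
  have ni: "?p \<notin> \<int>"
  proof
    assume "?p \<in> \<int>"
    then have "?p + 2 * real n \<in> \<int>" by (intro Ints_add Ints_mult) auto
    then obtain z where "s = of_int z" by (auto elim!: Ints_cases)
    with assms have "-1 < z" "z < 0" by linarith+
    then show False by simp
  qed
  have neg: "?p < 0" using assms by simp
  define q where "q = ?p / (?p - 1)"
  have "cos_moment (?p - 2) = q * cos_moment ?p"
    using cos_moment_rec[OF ni] neg by (simp add: field_simps q_def)
  moreover have "0 < q" "q \<le> 1" using neg by (auto simp: divide_simps q_def)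
  ultimately have "0 < cos_moment (?p - 2)" "cos_moment (?p - 2) \<le> cos_moment ?p"
    using Suc by (auto simp: mult_left_le_one_le intro!: mult_pos_pos)
  moreover have "s - 2 * real (Suc n) = ?p - 2" by simp
  ultimately show ?case using Suc by (metis order.trans)
qed

text \<open>The weight \<open>1 / (n + 1)\<close> matters: a singularity like that of
  \<open>\<bar>1 - x\<bar> powr s\<close> at 1 makes the coefficients themselves non-summable, while
  the weighted series still converges because \<open>s > -1\<close>. Nothing is required at
  \<open>x = 1\<close>, a null set.\<close>

locale two_sided_expansion =
  fixes s :: real and G :: "real \<Rightarrow> ennreal" and a b :: "nat \<Rightarrow> real"
  assumes s_gt: "-1 < s" and s_lt: "s < 0"
    and measurable_G [measurable]: "G \<in> borel_measurable borel"
    and a_nonneg: "\<And>n. a n \<ge> 0" and b_nonneg: "\<And>n. b n \<ge> 0"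
    and summable_a: "summable (\<lambda>n. a n / (real n + 1))"
    and summable_b: "summable (\<lambda>n. b n / (real n + 1))"
    and inside: "\<And>x. 0 < x \<Longrightarrow> x < 1 \<Longrightarrow> G x = ennreal (\<Sum>n. b n * x ^ (2 * n))"
    and outside: "\<And>x. x > 1 \<Longrightarrow> G x = ennreal (\<Sum>n. a n * x powr (s - 2 * real n))"
begin

lemma s_notin_Ints: "s \<notin> \<int>"
  using s_gt s_lt by (auto elim!: Ints_cases)

lemma summable_inside:
  assumes "0 \<le> x" "x < 1"
  shows "summable (\<lambda>n. b n * x ^ (2 * n))"
  using summable_weighted_power[OF summable_b b_nonneg, of "x\<^sup>2"] assms
  by (simp add: power_mult abs_square_less_1)

lemma powr_shift:
  assumes "x > (0::real)"
  shows "x powr (p - 2 * real n) = x powr p * ((1 / x)\<^sup>2) ^ n"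
proof -
  have "x powr (2 * real n) = (x\<^sup>2) ^ n"
    using powr_realpow[of x "2 * n"] assms by (simp add: power_mult)
  then show ?thesis by (simp add: powr_diff power_divide)
qed

lemma summable_outside:
  assumes "x > 1"
  shows "summable (\<lambda>n. a n * x powr (s - 2 * real n))"
proof -
  have "summable (\<lambda>n. x powr s * (a n * ((1 / x)\<^sup>2) ^ n))"
    using assms
    by (intro summable_mult summable_weighted_power[OF summable_a a_nonneg]) (auto simp: abs_square_less_1)
  moreover have "x > 0" using assms by simp
  ultimately show ?thesis by (simp only: powr_shift mult.left_commute)
qed

lemma summable_weights:
  fixes u v :: "nat \<Rightarrow> real"
  assumes "summable (\<lambda>n. u n / (real n + 1))" "\<And>n. u n \<ge> 0" "\<And>n. \<bar>v n\<bar> * (real n + 1) \<le> K"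
  shows "summable (\<lambda>n. u n * v n)"
proof (rule summable_comparison_test'[OF summable_mult[OF assms(1), of K]])
  fix n
  have "u n * \<bar>v n\<bar> = u n / (real n + 1) * (\<bar>v n\<bar> * (real n + 1))" by (simp add: field_simps)
  also have "\<dots> \<le> u n / (real n + 1) * K" using assms by (intro mult_left_mono) auto
  finally show "norm (u n * v n) \<le> K * (u n / (real n + 1))" using assms(2) by (simp add: abs_mult mult_ac)
qed

lemma summable_Mellin_inside:
  assumes "0 < w"
  shows "summable (\<lambda>n. b n / (2 * real n + w))"
proof -
  have "\<bar>1 / (2 * real n + w)\<bar> * (real n + 1) \<le> 1 + 1 / w" for n
    using assms by (simp add: field_simps add_nonneg_pos)
  from summable_weights[OF summable_b b_nonneg this] show ?thesis by simp
qed

lemma summable_Mellin_outside: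
  assumes "w < - s"
  shows "summable (\<lambda>n. a n / (2 * real n - s - w))"
proof -
  have "\<bar>1 / (2 * real n + (- s - w))\<bar> * (real n + 1) \<le> 1 + 1 / (- s - w)" for n
  proof -
    have "v > 0 \<Longrightarrow> \<bar>1 / (2 * real n + v)\<bar> * (real n + 1) \<le> 1 + 1 / v" for v
      by (simp add: field_simps add_nonneg_pos)
    from this[of "-s-w"] assms show ?thesis by simp
  qed
  from summable_weights[OF summable_a a_nonneg this] show ?thesis by (simp add: algebra_simps)
qed

text \<open>Splitting at 1 and integrating termwise: \<open>w > 0\<close> gives convergence of every
  inner power at 0, and \<open>w < -s\<close> gives convergence of every outer power at
  infinity.\<close>

lemma nn_integral_Mellin:
  assumes w: "0 < w" "w < - s"
  shows "(\<integral>\<^sup>+x. ennreal (x powr (w - 1)) * indicator {0<..} x * G x \<partial>lborel)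
    = ennreal ((\<Sum>n. b n / (2 * real n + w)) + (\<Sum>n. a n / (2 * real n - s - w)))"
proof -
  let ?f = "\<lambda>n x. ennreal (b n) * (ennreal (x powr (2 * real n + w - 1)) * indicator {0..1} x)"
  let ?g = "\<lambda>n x. ennreal (a n) * (ennreal (x powr (s - 2 * real n + w - 1)) * indicator {1..} x)"
  have "AE x in lborel. x \<noteq> (0::real) \<and> x \<noteq> 1"
    using AE_lborel_singleton[of "0::real"] AE_lborel_singleton[of "1::real"] by eventually_elim auto
  then have "AE x in lborel. ennreal (x powr (w - 1)) * indicator {0<..} x * G x = (\<Sum>n. ?f n x) + (\<Sum>n. ?g n x)"
  proof eventually_elim
    case (elim x)
    consider "x < 0" | "0 < x" "x < 1" | "x > 1" using elim by linarith
    then show ?case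
    proof cases
      case 2
      have "ennreal (x powr (w - 1)) * G x = ennreal (x powr (w - 1) * (\<Sum>n. b n * x ^ (2 * n)))"
        using 2 by (simp add: inside ennreal_mult')
      also have "x powr (w - 1) * (\<Sum>n. b n * x ^ (2 * n)) = (\<Sum>n. x powr (w - 1) * (b n * x ^ (2 * n)))"
        using 2 by (intro suminf_mult[symmetric] summable_inside) auto
      also have "ennreal \<dots> = (\<Sum>n. ennreal (x powr (w - 1) * (b n * x ^ (2 * n))))"
        using 2 b_nonneg by (intro suminf_ennreal2[symmetric] summable_mult summable_inside) auto
      also have "\<dots> = (\<Sum>n. ?f n x)"
      proof (rule suminf_cong)
        fix n
        have "x powr (2 * real n + w - 1) = x powr (w - 1) * x ^ (2 * n)"
          using 2 powr_realpow[of x "2 * n"] by (simp add: powr_add powr_diff)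
        then show "ennreal (x powr (w - 1) * (b n * x ^ (2 * n))) = ?f n x"
          using 2 b_nonneg[of n] by (simp add: mult_ac flip: ennreal_mult')
      qed
      finally show ?thesis using 2 by simp
    next
      case 3
      have "ennreal (x powr (w - 1)) * G x = ennreal (x powr (w - 1) * (\<Sum>n. a n * x powr (s - 2 * real n)))"
        using 3 by (simp add: outside ennreal_mult')
      also have "x powr (w - 1) * (\<Sum>n. a n * x powr (s - 2 * real n)) = (\<Sum>n. x powr (w - 1) * (a n * x powr (s - 2 * real n)))"
        using 3 by (intro suminf_mult[symmetric] summable_outside) auto
      also have "ennreal \<dots> = (\<Sum>n. ennreal (x powr (w - 1) * (a n * x powr (s - 2 * real n))))"
        using 3 a_nonneg by (intro suminf_ennreal2[symmetric] summable_mult summable_outside) auto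
      also have "\<dots> = (\<Sum>n. ?g n x)"
      proof (rule suminf_cong)
        fix n
        have "x powr (s - 2 * real n + w - 1) = x powr (w - 1) * x powr (s - 2 * real n)"
          by (simp add: algebra_simps flip: powr_add)
        then show "ennreal (x powr (w - 1) * (a n * x powr (s - 2 * real n))) = ?g n x"
          using 3 a_nonneg[of n] by (simp add: mult_ac flip: ennreal_mult')
      qed
      finally show ?thesis using 3 by simp
    qed simp
  qed
  then have "(\<integral>\<^sup>+x. ennreal (x powr (w - 1)) * indicator {0<..} x * G x \<partial>lborel)
      = (\<integral>\<^sup>+x. (\<Sum>n. ?f n x) + (\<Sum>n. ?g n x) \<partial>lborel)"
    by (rule nn_integral_cong_AE)
  also have "\<dots> = (\<Sum>n. \<integral>\<^sup>+x. ?f n x \<partial>lborel) + (\<Sum>n. \<integral>\<^sup>+x. ?g n x \<partial>lborel)"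
    by (subst nn_integral_add, simp, simp, subst (1 2) nn_integral_suminf, simp_all)
  finally have split: "(\<integral>\<^sup>+x. ennreal (x powr (w - 1)) * indicator {0<..} x * G x \<partial>lborel)
      = (\<Sum>n. \<integral>\<^sup>+x. ?f n x \<partial>lborel) + (\<Sum>n. \<integral>\<^sup>+x. ?g n x \<partial>lborel)" .
  have int_f: "(\<integral>\<^sup>+x. ?f n x \<partial>lborel) = ennreal (b n / (2 * real n + w))" for n
    using w b_nonneg[of n]
    by (subst nn_integral_cmult, simp, subst nn_integral_powr_from_0) (auto simp flip: ennreal_mult')
  have int_g: "(\<integral>\<^sup>+x. ?g n x \<partial>lborel) = ennreal (a n / (2 * real n - s - w))" for n
  proof -
    have "- 1 / (s - 2 * real n + w - 1 + 1) = - 1 / (- (2 * real n - s - w))"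
      by (rule arg_cong2[where f = "(/)"]) auto
    also have "\<dots> = 1 / (2 * real n - s - w)" by (simp only: minus_divide_divide)
    finally show ?thesis
      using w a_nonneg[of n]
      by (subst nn_integral_cmult, simp, subst nn_integral_powr_to_inf) (auto simp flip: ennreal_mult')
  qed
  have sum_f: "(\<Sum>n. ennreal (b n / (2 * real n + w))) = ennreal (\<Sum>n. b n / (2 * real n + w))"
    using w b_nonneg by (intro suminf_ennreal2 summable_Mellin_inside) auto
  have sum_g: "(\<Sum>n. ennreal (a n / (2 * real n - s - w))) = ennreal (\<Sum>n. a n / (2 * real n - s - w))"
    using w a_nonneg by (intro suminf_ennreal2 summable_Mellin_outside) auto
  show ?thesis
    unfolding split int_f int_g sum_f sum_g using w a_nonneg b_nonneg
    by (subst ennreal_plus) (auto intro!: suminf_nonneg summable_Mellin_inside summable_Mellin_outside)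
qed

text \<open>For \<open>x < 1\<close> the product \<open>x * c\<close> also stays below 1, so only
  the inner expansion enters and no correction series appears.\<close>

lemma arcsine_mean_inside:
  assumes x: "0 < x" "x < 1"
  shows "arcsine_mean G x = ennreal (\<Sum>n. b n * cos_moment (2 * real n) * x ^ (2 * n))"
proof -
  let ?d = "\<lambda>c. ennreal (indicator {0<..<1} c * (2 / pi / sqrt (1 - c\<^sup>2)))"
  have "?d c * G (x * c) = (\<Sum>n. ennreal (b n * x ^ (2 * n)) * (?d c * ennreal (c powr (2 * real n))))" for c
  proof (cases "0 < c \<and> c < 1")
    case True
    then have xc: "0 < x * c" "x * c < 1" using x mult_strict_mono[of x 1 c 1] by auto
    have "G (x * c) = (\<Sum>n. ennreal (b n * (x * c) ^ (2 * n)))"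
      unfolding inside[OF xc] using xc b_nonneg by (intro suminf_ennreal2[symmetric] summable_inside) auto
    also have "\<dots> = (\<Sum>n. ennreal (b n * x ^ (2 * n)) * ennreal (c powr (2 * real n)))"
    proof (rule suminf_cong)
      fix n
      have "c powr (2 * real n) = c ^ (2 * n)" using True powr_realpow[of c "2 * n"] by simp
      then show "ennreal (b n * (x * c) ^ (2 * n)) = ennreal (b n * x ^ (2 * n)) * ennreal (c powr (2 * real n))"
        using b_nonneg[of n] x True by (simp add: power_mult_distrib mult_ac flip: ennreal_mult)
    qed
    finally have "G (x * c) = (\<Sum>n. ennreal (b n * x ^ (2 * n)) * ennreal (c powr (2 * real n)))" .
    then show ?thesis
      by (simp only: ennreal_suminf_cmult[symmetric]) (simp add: mult_ac)
  qed auto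
  then have "arcsine_mean G x = (\<Sum>n. \<integral>\<^sup>+c. ennreal (b n * x ^ (2 * n)) * (?d c * ennreal (c powr (2 * real n))) \<partial>lborel)"
    unfolding arcsine_mean_def by (simp add: nn_integral_suminf)
  also have "\<dots> = (\<Sum>n. ennreal (b n * cos_moment (2 * real n) * x ^ (2 * n)))"
  proof (rule suminf_cong)
    fix n
    have "(\<integral>\<^sup>+c. ennreal (b n * x ^ (2 * n)) * (?d c * ennreal (c powr (2 * real n))) \<partial>lborel)
       = ennreal (b n * x ^ (2 * n)) * ennreal (cos_moment (2 * real n))"
      by (subst nn_integral_cmult, simp, subst nn_integral_arcsine_density_powr) auto
    then show "(\<integral>\<^sup>+c. ennreal (b n * x ^ (2 * n)) * (?d c * ennreal (c powr (2 * real n))) \<partial>lborel)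
       = ennreal (b n * cos_moment (2 * real n) * x ^ (2 * n))"
      using b_nonneg[of n] x cos_moment_pos[of "2 * real n"] by (simp add: mult_ac flip: ennreal_mult)
  qed
  also have "\<dots> = ennreal (\<Sum>n. b n * cos_moment (2 * real n) * x ^ (2 * n))"
  proof (rule suminf_ennreal2)
    fix n
    show "0 \<le> b n * cos_moment (2 * real n) * x ^ (2 * n)"
      using b_nonneg[of n] x cos_moment_pos[of "2 * real n"] by simp
  next
    show "summable (\<lambda>n. b n * cos_moment (2 * real n) * x ^ (2 * n))"
    proof (rule summable_comparison_test'[OF summable_inside])
      show "0 \<le> x" "x < 1" using x by auto
      fix n
      have "b n * x ^ (2 * n) * cos_moment (2 * real n) \<le> b n * x ^ (2 * n) * 1"
        using b_nonneg[of n] x cos_moment_nat_le_1[of n] by (intro mult_left_mono) auto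
      then show "norm (b n * cos_moment (2 * real n) * x ^ (2 * n)) \<le> b n * x ^ (2 * n)"
        using b_nonneg[of n] x cos_moment_pos[of "2 * real n"] by (simp add: abs_mult mult_ac)
    qed
  qed
  finally show ?thesis .
qed

end

section \<open>The arcsine mean for \<open>x > 1\<close> and its odd power series\<close>

context two_sided_expansion
begin

text \<open>The denominators stay away from 0 because \<open>s\<close> lies strictly between two
  consecutive integers: for \<open>n \<le> j\<close> they are at least \<open>s + 1\<close>, and
  otherwise negative and growing with \<open>n - j\<close>. The loss of a factor
  \<open>j + 1\<close> is harmless against the geometric decay in \<open>j\<close>.\<close>

lemma denominator_bound:
  "\<bar>1 / (s - 2 * real n + (1 + 2 * real j))\<bar> * (real n + 1) \<le> 1 / min (s + 1) (1 / 2) * (real j + 1)"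
proof -
  define D where "D = s - 2 * real n + (1 + 2 * real j)"
  define k where "k = min (s + 1) (1 / 2)"
  have k: "k > 0" "k \<le> s + 1" "k \<le> 1 / 2" using s_gt min.cobounded2[of "s + 1" "1 / 2"] by (auto simp: k_def simp del: min.cobounded2)
  have "k * (real n + 1) \<le> \<bar>D\<bar> * (real j + 1) \<and> D \<noteq> 0"
  proof (cases "n \<le> j")
    case True
    then have "D \<ge> s + 1" by (simp add: D_def)
    then have "k * (real n + 1) \<le> D * (real j + 1)" "D > 0" using k True by (auto intro!: mult_mono)
    then show ?thesis by simp
  next
    case False
    \<comment> \<open>With this \<open>i\<close>, \<open>D = s - 1 - 2 * i\<close>, and
      \<open>n\<close> is at most \<open>(i + 1) * (j + 1)\<close>.\<close>
    then obtain i where i: "n = j + i + 1" by (metis add.assoc less_imp_Suc_add not_le Suc_eq_plus1)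
    have D: "D \<le> - (real i + 1)" using s_lt by (simp add: D_def i)
    have "k * (real n + 1) \<le> 1 / 2 * (real n + 1)" using k by (intro mult_right_mono) auto
    also have "\<dots> \<le> real n" using i by simp
    also have "real n \<le> (real i + 1) * (real j + 1)" by (simp add: i algebra_simps)
    also have "\<dots> \<le> \<bar>D\<bar> * (real j + 1)" using D by (intro mult_right_mono) auto
    finally show ?thesis using D by auto
  qed
  then have "(real n + 1) / \<bar>D\<bar> \<le> (real j + 1) / k"
    using k by (simp add: field_simps)
  then show ?thesis by (simp add: D_def k_def mult_ac)
qed

text \<open>The partial fraction form of the Mellin transform. The minus sign comes from the
  integrals over \<open>[1, \<infinity>)\<close>, which are \<open>-1 / (s - 2 * n + w)\<close>. The
  expression makes sense off its poles, also where the transform diverges.\<close>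

definition Mellin_diff :: "real \<Rightarrow> real" where
  "Mellin_diff w = (\<Sum>n. b n / (2 * real n + w)) - (\<Sum>n. a n / (s - 2 * real n + w))"

text \<open>The expansion in use changes at \<open>c = d\<close>. Below \<open>d\<close> the inner
  one meets head integrals; above \<open>d\<close> the outer one meets tails, each a continued
  moment minus a series. Both series run over the same powers \<open>d ^ (1 + 2 * j)\<close>, so
  exchanging the summations produces \<open>Mellin_diff\<close> at odd integers. The nonnegativity
  claim is needed to recover the real value from its \<open>ennreal\<close> image.\<close>

lemma arcsine_mean_outside:
  assumes x: "x > 1"
  defines "d \<equiv> 1 / x"
  shows "arcsine_mean G x = ennreal ((\<Sum>n. a n * cos_moment (s - 2 * real n) * x powr (s - 2 * real n))
      + 2 / pi * (\<Sum>j. arcsine_coeff j * d ^ (1 + 2 * j) * Mellin_diff (1 + 2 * real j)))"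
    and "summable (\<lambda>j. arcsine_coeff j * d ^ (1 + 2 * j) * Mellin_diff (1 + 2 * real j))"
    and "0 \<le> (\<Sum>n. a n * cos_moment (s - 2 * real n) * x powr (s - 2 * real n))
      + 2 / pi * (\<Sum>j. arcsine_coeff j * d ^ (1 + 2 * j) * Mellin_diff (1 + 2 * real j))"
proof -
  have d: "0 < d" "d < 1" "x * d = 1" "d * x = 1" using x by (auto simp: d_def)
  let ?d = "\<lambda>c. ennreal (indicator {0<..<1} c * (2 / pi / sqrt (1 - c\<^sup>2)))"
  let ?f = "\<lambda>n c. ennreal (b n * (2 / pi) * x ^ (2 * n)) *
      ennreal (indicator {0<..d} c * (c powr (2 * real n) / sqrt (1 - c\<^sup>2)))"
  let ?g = "\<lambda>n c. ennreal (a n * (2 / pi) * x powr (s - 2 * real n)) *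
      (ennreal (c powr (s - 2 * real n) / sqrt (1 - c\<^sup>2)) * indicator {d..1} c)"
  \<comment> \<open>\<open>A n\<close> and \<open>B n\<close> are the contributions of the
    \<open>n\<close>-th inner term over \<open>c < d\<close> and of the \<open>n\<close>-th outer
    term over \<open>c > d\<close>.\<close>
  define A where "A n = b n * (2 / pi) * x ^ (2 * n) * (\<Sum>j. arcsine_tail_term (2 * real n) d j)" for n
  define B where "B n = a n * (2 / pi) * x powr (s - 2 * real n) * arcsine_tail (s - 2 * real n) d" for n
  have "AE c in lborel. c \<noteq> d \<and> c \<noteq> (1::real)"
    using AE_lborel_singleton[of d] AE_lborel_singleton[of "1::real"] by eventually_elim auto
  then have "AE c in lborel. ?d c * G (x * c) = (\<Sum>n. ?f n c) + (\<Sum>n. ?g n c)"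
  proof eventually_elim
    case (elim c)
    consider "c \<le> 0" | "0 < c" "c < d" | "d < c" "c < 1" | "c > 1" using elim by linarith
    then show ?case
    proof cases
      case 2
      define K where "K = 2 / pi / sqrt (1 - c\<^sup>2)"
      have K: "K \<ge> 0" "c < 1" using 2 d by (auto simp: K_def abs_square_le_1)
      have xc: "0 < x * c" "x * c < 1" using 2 x d by (auto simp: d_def field_simps)
      have "ennreal K * G (x * c) = ennreal (K * (\<Sum>n. b n * (x * c) ^ (2 * n)))"
        using K by (simp add: inside[OF xc] ennreal_mult')
      also have "K * (\<Sum>n. b n * (x * c) ^ (2 * n)) = (\<Sum>n. K * (b n * (x * c) ^ (2 * n)))"
        using xc by (intro suminf_mult[symmetric] summable_inside) auto
      also have "ennreal \<dots> = (\<Sum>n. ennreal (K * (b n * (x * c) ^ (2 * n))))"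
        using xc K b_nonneg by (intro suminf_ennreal2[symmetric] summable_mult summable_inside) auto
      also have "\<dots> = (\<Sum>n. ?f n c)"
      proof (rule suminf_cong)
        fix n
        have e: "c powr (2 * real n) = c ^ (2 * n)" using 2 powr_realpow[of c "2 * n"] by simp
        have "K * (b n * (x * c) ^ (2 * n)) = b n * (2 / pi) * x ^ (2 * n) * (c powr (2 * real n) / sqrt (1 - c\<^sup>2))"
          unfolding e K_def by (simp add: power_mult_distrib)
        then show "ennreal (K * (b n * (x * c) ^ (2 * n))) = ?f n c"
          using 2 b_nonneg[of n] x by (simp flip: ennreal_mult')
      qed
      finally show ?thesis using 2 K d by (simp add: K_def)
    next
      case 3
      define K where "K = 2 / pi / sqrt (1 - c\<^sup>2)"
      have K: "K \<ge> 0" "c > 0" using 3 d by (auto simp: K_def abs_square_le_1)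
      have xc: "x * c > 1" using 3 x d by (auto simp: d_def field_simps)
      have "ennreal K * G (x * c) = ennreal (K * (\<Sum>n. a n * (x * c) powr (s - 2 * real n)))"
        using K by (simp add: outside[OF xc] ennreal_mult')
      also have "K * (\<Sum>n. a n * (x * c) powr (s - 2 * real n)) = (\<Sum>n. K * (a n * (x * c) powr (s - 2 * real n)))"
        using xc by (intro suminf_mult[symmetric] summable_outside) auto
      also have "ennreal \<dots> = (\<Sum>n. ennreal (K * (a n * (x * c) powr (s - 2 * real n))))"
        using xc K a_nonneg by (intro suminf_ennreal2[symmetric] summable_mult summable_outside) auto
      also have "\<dots> = (\<Sum>n. ?g n c)"
      proof (rule suminf_cong)
        fix n
        have "K * (a n * (x * c) powr (s - 2 * real n)) =
            a n * (2 / pi) * x powr (s - 2 * real n) * (c powr (s - 2 * real n) / sqrt (1 - c\<^sup>2))"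
          unfolding K_def using x K by (simp add: powr_mult)
        then show "ennreal (K * (a n * (x * c) powr (s - 2 * real n))) = ?g n c"
          using 3 a_nonneg[of n] x by (simp flip: ennreal_mult')
      qed
      finally show ?thesis using 3 K d by (simp add: K_def)
    qed (use d in auto)
  qed
  then have "arcsine_mean G x = (\<integral>\<^sup>+c. (\<Sum>n. ?f n c) + (\<Sum>n. ?g n c) \<partial>lborel)"
    unfolding arcsine_mean_def by (rule nn_integral_cong_AE)
  also have "\<dots> = (\<Sum>n. \<integral>\<^sup>+c. ?f n c \<partial>lborel) + (\<Sum>n. \<integral>\<^sup>+c. ?g n c \<partial>lborel)"
    by (subst nn_integral_add, simp, simp, subst (1 2) nn_integral_suminf, simp_all)
  finally have mean: "arcsine_mean G x = (\<Sum>n. \<integral>\<^sup>+c. ?f n c \<partial>lborel) + (\<Sum>n. \<integral>\<^sup>+c. ?g n c \<partial>lborel)" .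
  have int_f: "(\<integral>\<^sup>+c. ?f n c \<partial>lborel) = ennreal (A n)" for n
    using d b_nonneg[of n] x
    by (subst nn_integral_cmult, simp, subst nn_integral_arcsine_head) (auto simp: A_def simp flip: ennreal_mult')
  have tail_nonneg: "arcsine_tail (s - 2 * real n) d \<ge> 0" for n
    by (rule has_integral_nonneg[OF has_integral_arcsine_tail[OF s_notin_Ints s_gt]])
       (use d in \<open>auto simp: abs_square_le_1\<close>)
  have int_g: "(\<integral>\<^sup>+c. ?g n c \<partial>lborel) = ennreal (B n)" for n
    using d a_nonneg[of n] x tail_nonneg[of n]
    by (subst nn_integral_cmult, simp,
        subst nn_integral_has_integral_lebesgue'[OF _ has_integral_arcsine_tail[OF s_notin_Ints s_gt]])
       (auto simp: B_def abs_square_le_1 simp flip: ennreal_mult')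
  have mean: "arcsine_mean G x = (\<Sum>n. ennreal (A n)) + (\<Sum>n. ennreal (B n))"
    unfolding mean int_f int_g ..

  \<comment> \<open>In both double series \<open>n\<close> enters only through the coefficient and
    the denominator, which is what makes the column sums partial fraction series in
    \<open>1 + 2 * j\<close>.\<close>
  define u where "u n j = b n * (arcsine_coeff j * d ^ (1 + 2 * j) / (2 * real n + (1 + 2 * real j)))" for n j
  define v where "v n j = a n * (arcsine_coeff j * d ^ (1 + 2 * j) / (s - 2 * real n + (1 + 2 * real j)))" for n j
  have A_eq: "A n = 2 / pi * (\<Sum>j. u n j)" for n
  proof -
    have "b n * x ^ (2 * n) * arcsine_tail_term (2 * real n) d j = u n j" for j
    proof -
      \<comment> \<open>Since \<open>x * d = 1\<close>, the power depending on \<open>n\<close>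
        disappears.\<close>
      have "x ^ (2 * n) * d powr (2 * real n + 1 + 2 * real j) = (x * d) ^ (2 * n) * d ^ (1 + 2 * j)"
      proof -
        have "d powr (2 * real n + 1 + 2 * real j) = d ^ (2 * n + (1 + 2 * j))"
          using d powr_realpow[of d "2 * n + (1 + 2 * j)"] by (simp add: algebra_simps)
        then show ?thesis by (simp only: power_add power_mult_distrib mult.assoc)
      qed
      then have "x ^ (2 * n) * d powr (2 * real n + 1 + 2 * real j) = d ^ (1 + 2 * j)" using d by simp
      then have "b n * arcsine_coeff j / (2 * real n + 1 + 2 * real j) *
         (x ^ (2 * n) * d powr (2 * real n + 1 + 2 * real j))
        = b n * arcsine_coeff j / (2 * real n + 1 + 2 * real j) * d ^ (1 + 2 * j)" by (simp only:)
      then show ?thesis by (simp add: u_def arcsine_tail_term_def mult_ac add_ac)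
    qed
    then have "(\<Sum>j. u n j) = (\<Sum>j. b n * x ^ (2 * n) * arcsine_tail_term (2 * real n) d j)" by simp
    also have "\<dots> = b n * x ^ (2 * n) * (\<Sum>j. arcsine_tail_term (2 * real n) d j)"
      using d by (intro suminf_mult summable_arcsine_tail_term) auto
    finally show ?thesis by (simp add: A_def)
  qed
  have B_eq: "B n = a n * cos_moment (s - 2 * real n) * x powr (s - 2 * real n) - 2 / pi * (\<Sum>j. v n j)" for n
  proof -
    let ?p = "s - 2 * real n"
    have "a n * x powr ?p * arcsine_tail_term ?p d j = v n j" for j
    proof -
      have "x powr ?p * d powr ?p = (x * d) powr ?p"
        by (rule powr_mult[symmetric])
      then have "x powr ?p * d powr (?p + (1 + 2 * real j)) = (x * d) powr ?p * d powr (1 + 2 * real j)"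
        by (simp only: powr_add mult.assoc[symmetric])
      also have "\<dots> = d ^ (1 + 2 * j)"
        using d powr_realpow[of d "1 + 2 * j"] by simp
      finally have "x powr ?p * d powr (?p + (1 + 2 * real j)) = d ^ (1 + 2 * j)" .
      then have "a n * arcsine_coeff j / (?p + (1 + 2 * real j)) * (x powr ?p * d powr (?p + (1 + 2 * real j)))
         = a n * arcsine_coeff j / (?p + (1 + 2 * real j)) * d ^ (1 + 2 * j)" by (simp only:)
      then show ?thesis by (simp add: v_def arcsine_tail_term_def mult_ac add_ac)
    qed
    then have "(\<Sum>j. v n j) = (\<Sum>j. a n * x powr ?p * arcsine_tail_term ?p d j)" by simp
    also have "\<dots> = a n * x powr ?p * (\<Sum>j. arcsine_tail_term ?p d j)"
      using d by (intro suminf_mult summable_arcsine_tail_term) auto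
    finally show ?thesis by (simp add: B_def arcsine_tail_def right_diff_distrib)
  qed
  have sum_d: "summable (\<lambda>j. (real j + 1) * d ^ (1 + 2 * j))"
  proof -
    have "norm (d\<^sup>2) < 1" using d by (simp add: abs_square_less_1)
    from geometric_deriv_sums[OF this] have "summable (\<lambda>j. of_nat (Suc j) * (d\<^sup>2) ^ j)" by (simp add: sums_iff)
    then have "summable (\<lambda>j. d * (of_nat (Suc j) * (d\<^sup>2) ^ j))" by (rule summable_mult)
    moreover have "d * (of_nat (Suc j) * (d\<^sup>2) ^ j) = (real j + 1) * d ^ (1 + 2 * j)" for j
      unfolding power_add power_mult power_one_right by simp
    ultimately show ?thesis by (simp only:)
  qed
  have u_le: "\<bar>u n j\<bar> \<le> b n / (real n + 1) * ((real j + 1) * d ^ (1 + 2 * j))" for n j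
  proof -
    have "\<bar>u n j\<bar> = b n * (arcsine_coeff j * d ^ (1 + 2 * j)) * (1 / (2 * real n + (1 + 2 * real j)))"
      using b_nonneg[of n] arcsine_coeff_pos[of j] d by (simp add: u_def abs_mult)
    also have "\<dots> \<le> b n * ((real j + 1) * d ^ (1 + 2 * j)) * (1 / (real n + 1))"
      using b_nonneg[of n] arcsine_coeff_pos[of j] arcsine_coeff_le_1[of j] d
      by (intro mult_mono mult_left_mono divide_left_mono mult_nonneg_nonneg) auto
    finally show ?thesis by simp
  qed
  define k where "k = 1 / min (s + 1) (1 / 2)"
  have k: "k > 0" using s_gt by (simp add: k_def)
  have v_le: "\<bar>v n j\<bar> \<le> k * (a n / (real n + 1)) * ((real j + 1) * d ^ (1 + 2 * j))" for n j
  proof -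
    let ?D = "1 / (s - 2 * real n + (1 + 2 * real j))"
    have "\<bar>v n j\<bar> = a n / (real n + 1) * (arcsine_coeff j * d ^ (1 + 2 * j)) * (\<bar>?D\<bar> * (real n + 1))"
      using a_nonneg[of n] arcsine_coeff_pos[of j] d by (simp add: v_def abs_mult)
    also have "\<dots> \<le> a n / (real n + 1) * (1 * d ^ (1 + 2 * j)) * (k * (real j + 1))"
    proof (rule mult_mono)
      show "a n / (real n + 1) * (arcsine_coeff j * d ^ (1 + 2 * j)) \<le> a n / (real n + 1) * (1 * d ^ (1 + 2 * j))"
        using a_nonneg[of n] arcsine_coeff_le_1[of j] d by (intro mult_left_mono mult_right_mono) auto
      show "\<bar>?D\<bar> * (real n + 1) \<le> k * (real j + 1)"
        unfolding k_def by (rule denominator_bound)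
    qed (use a_nonneg[of n] d in auto)
    finally show ?thesis by (simp add: mult_ac)
  qed
  have sum_ka: "summable (\<lambda>n. k * (a n / (real n + 1)))" by (intro summable_mult summable_a)
  have nn: "(real j + 1) * d ^ (1 + 2 * j) \<ge> 0" "b j / (real j + 1) \<ge> 0" "k * (a j / (real j + 1)) \<ge> 0" for j
    using d k a_nonneg[of j] b_nonneg[of j] by auto
  note U = suminf_swap[OF summable_b nn(2) sum_d nn(1) u_le]
  note V = suminf_swap[OF sum_ka nn(3) sum_d nn(1) v_le]
  have sum_a: "summable (\<lambda>n. a n * cos_moment (s - 2 * real n) * x powr (s - 2 * real n))"
  proof (rule summable_comparison_test'[OF summable_mult[OF summable_outside[OF x], of "cos_moment s"]])
    fix n
    have "a n * x powr (s - 2 * real n) * cos_moment (s - 2 * real n) \<le> a n * x powr (s - 2 * real n) * cos_moment s"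
      using a_nonneg[of n] cos_moment_shift_bounds[OF s_gt s_lt, of n] by (intro mult_left_mono) auto
    then show "norm (a n * cos_moment (s - 2 * real n) * x powr (s - 2 * real n)) \<le> cos_moment s * (a n * x powr (s - 2 * real n))"
      using a_nonneg[of n] cos_moment_shift_bounds[OF s_gt s_lt, of n] by (simp add: abs_mult mult_ac)
  qed
  have sA: "summable A" unfolding A_eq by (intro summable_mult U)
  have sB: "summable B" unfolding B_eq by (intro summable_diff summable_mult V sum_a)
  have A0: "A n \<ge> 0" for n
    using b_nonneg[of n] arcsine_coeff_pos d unfolding A_eq u_def
    by (intro mult_nonneg_nonneg suminf_nonneg) (use U(3) in \<open>auto simp: u_def less_imp_le\<close>)
  have B0: "B n \<ge> 0" for n
    using a_nonneg[of n] tail_nonneg[of n] by (simp add: B_def)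
  have colU: "(\<Sum>n. u n j) = arcsine_coeff j * d ^ (1 + 2 * j) * (\<Sum>n. b n / (2 * real n + (1 + 2 * real j)))" for j
    by (subst suminf_mult[symmetric, OF summable_Mellin_inside]) (auto simp: u_def mult_ac)
  have colV: "(\<Sum>n. v n j) = arcsine_coeff j * d ^ (1 + 2 * j) * (\<Sum>n. a n / (s - 2 * real n + (1 + 2 * real j)))" for j
  proof (subst suminf_mult[symmetric])
    show "summable (\<lambda>n. a n / (s - 2 * real n + (1 + 2 * real j)))"
      using summable_weights[OF summable_a a_nonneg denominator_bound[of _ j]] by simp
  qed (auto simp: v_def mult_ac)
  have eq: "(\<Sum>n. u n j) - (\<Sum>n. v n j) = arcsine_coeff j * d ^ (1 + 2 * j) * Mellin_diff (1 + 2 * real j)" for j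
    unfolding colU colV Mellin_diff_def by (simp add: right_diff_distrib)
  \<comment> \<open>Summability of the column sums comes from the same exchange lemma with the two
    indices interchanged.\<close>
  have U5: "summable (\<lambda>j. \<Sum>n. u n j)" and V5: "summable (\<lambda>j. \<Sum>n. v n j)"
    using suminf_swap(2)[OF sum_d nn(1) summable_b nn(2), of "\<lambda>j n. u n j"] u_le
      suminf_swap(2)[OF sum_d nn(1) sum_ka nn(3), of "\<lambda>j n. v n j"] v_le
    by (auto simp: mult_ac)
  show "summable (\<lambda>j. arcsine_coeff j * d ^ (1 + 2 * j) * Mellin_diff (1 + 2 * real j))"
    using summable_diff[OF U5 V5] unfolding eq .
  have sums_AB: "(\<Sum>n. ennreal (A n)) + (\<Sum>n. ennreal (B n)) = ennreal (suminf A + suminf B)"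
    by (simp add: suminf_ennreal2[OF A0 sA] suminf_ennreal2[OF B0 sB] suminf_nonneg[OF sA A0] suminf_nonneg[OF sB B0])
  have "suminf A = 2 / pi * (\<Sum>j. \<Sum>n. u n j)"
    unfolding A_eq by (subst suminf_mult[OF U(2)]) (simp add: U(1))
  moreover have "suminf B = (\<Sum>n. a n * cos_moment (s - 2 * real n) * x powr (s - 2 * real n)) - 2 / pi * (\<Sum>j. \<Sum>n. v n j)"
    unfolding B_eq by (subst suminf_diff[OF sum_a summable_mult[OF V(2)], symmetric], subst suminf_mult[OF V(2)]) (simp add: V(1))
  moreover have "2 / pi * (\<Sum>j. \<Sum>n. u n j) + ((\<Sum>n. a n * cos_moment (s - 2 * real n) * x powr (s - 2 * real n)) - 2 / pi * (\<Sum>j. \<Sum>n. v n j))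
      = (\<Sum>n. a n * cos_moment (s - 2 * real n) * x powr (s - 2 * real n)) + 2 / pi * ((\<Sum>j. \<Sum>n. u n j) - (\<Sum>j. \<Sum>n. v n j))"
    by (simp add: right_diff_distrib)
  moreover have "(\<Sum>j. \<Sum>n. u n j) - (\<Sum>j. \<Sum>n. v n j) = (\<Sum>j. arcsine_coeff j * d ^ (1 + 2 * j) * Mellin_diff (1 + 2 * real j))"
    using suminf_diff[OF U5 V5] unfolding eq .
  ultimately have total: "suminf A + suminf B = (\<Sum>n. a n * cos_moment (s - 2 * real n) * x powr (s - 2 * real n))
      + 2 / pi * (\<Sum>j. arcsine_coeff j * d ^ (1 + 2 * j) * Mellin_diff (1 + 2 * real j))"
    by (simp only:)
  show "arcsine_mean G x = ennreal ((\<Sum>n. a n * cos_moment (s - 2 * real n) * x powr (s - 2 * real n))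
      + 2 / pi * (\<Sum>j. arcsine_coeff j * d ^ (1 + 2 * j) * Mellin_diff (1 + 2 * real j)))"
    unfolding mean sums_AB total ..
  show "0 \<le> (\<Sum>n. a n * cos_moment (s - 2 * real n) * x powr (s - 2 * real n))
      + 2 / pi * (\<Sum>j. arcsine_coeff j * d ^ (1 + 2 * j) * Mellin_diff (1 + 2 * real j))"
    unfolding total[symmetric] by (intro add_nonneg_nonneg suminf_nonneg sA sB A0 B0)
qed

text \<open>Without the odd series the mean is again of two-sided form and can be averaged once
  more. The weighted summability survives because the inner moments are bounded by 1 and the outer
  ones by \<open>cos_moment s\<close>.\<close>

lemma two_sided_expansion_arcsine_mean:
  assumes "\<And>j. Mellin_diff (1 + 2 * real j) = 0"
  shows "two_sided_expansion s (arcsine_mean G)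
      (\<lambda>n. a n * cos_moment (s - 2 * real n)) (\<lambda>n. b n * cos_moment (2 * real n))"
proof
  show "arcsine_mean G x = ennreal (\<Sum>n. a n * cos_moment (s - 2 * real n) * x powr (s - 2 * real n))" if "x > 1" for x
    using arcsine_mean_outside(1)[OF that] assms by simp
  show "summable (\<lambda>n. a n * cos_moment (s - 2 * real n) / (real n + 1))"
  proof (rule summable_comparison_test'[OF summable_mult[OF summable_a, of "cos_moment s"]])
    fix n
    have "a n / (real n + 1) * cos_moment (s - 2 * real n) \<le> a n / (real n + 1) * cos_moment s"
      using a_nonneg[of n] cos_moment_shift_bounds[OF s_gt s_lt, of n] by (intro mult_left_mono) auto
    then show "norm (a n * cos_moment (s - 2 * real n) / (real n + 1)) \<le> cos_moment s * (a n / (real n + 1))"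
      using a_nonneg[of n] cos_moment_shift_bounds[OF s_gt s_lt, of n] by (simp add: abs_mult mult_ac)
  qed
  show "summable (\<lambda>n. b n * cos_moment (2 * real n) / (real n + 1))"
  proof (rule summable_comparison_test'[OF summable_b])
    fix n
    have "b n / (real n + 1) * cos_moment (2 * real n) \<le> b n / (real n + 1) * 1"
      using b_nonneg[of n] cos_moment_nat_le_1[of n] by (intro mult_left_mono) auto
    then show "norm (b n * cos_moment (2 * real n) / (real n + 1)) \<le> b n / (real n + 1)"
      using b_nonneg[of n] cos_moment_pos[of "2 * real n"] by (simp add: abs_mult mult_ac)
  qed
  show "0 \<le> a n * cos_moment (s - 2 * real n)" "0 \<le> b n * cos_moment (2 * real n)" for n
    using a_nonneg[of n] b_nonneg[of n] cos_moment_shift_bounds[OF s_gt s_lt, of n] cos_moment_pos[of "2 * real n"] by auto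
qed (use s_gt s_lt arcsine_mean_inside in auto)

end

section \<open>The binomial kernel and its Mellin transform\<close>

lemma absolutely_integrable_imp_nn_integral:
  fixes f :: "real \<Rightarrow> real"
  assumes "f absolutely_integrable_on S" "integral S f = v" "\<And>x. x \<in> S \<Longrightarrow> f x \<ge> 0"
  shows "(\<integral>\<^sup>+x. ennreal (f x) * indicator S x \<partial>lborel) = ennreal v"
proof -
  have "(f has_integral v) S"
    using assms(1,2) by (auto simp: set_lebesgue_integral_eq_integral dest: set_lebesgue_integral_eq_integral(1) integrable_integral)
  then show ?thesis using assms(3) by (intro nn_integral_has_integral_lebesgue')
qed

text \<open>The substitution \<open>y / (1 - y)\<close> maps the unit interval onto the half-line;
  its Jacobian combines with the powers of \<open>1 - y\<close> to the exponent \<open>b - 1\<close>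
  of the usual Beta integrand.\<close>

lemma nn_integral_Beta_halfline:
  assumes "a > 0" "b > (0::real)"
  shows "(\<integral>\<^sup>+y. ennreal (y powr (a - 1) * (1 + y) powr (- a - b)) * indicator {0<..} y \<partial>lborel) = ennreal (Beta a b)"
proof -
  let ?f = "\<lambda>y::real. y powr (a - 1) * (1 + y) powr (- a - b)"
  let ?h = "\<lambda>y::real. y powr (a - 1) * (1 - y) powr (b - 1)"
  let ?g = "\<lambda>y::real. y / (1 - y)"
  let ?g' = "\<lambda>y::real. 1 / (1 - y)\<^sup>2"
  let ?S = "{0<..<1::real}"
  have eq: "\<bar>?g' y\<bar> * ?f (?g y) = ?h y" if "y \<in> ?S" for y
  proof -
    have y: "0 < y" "y < 1" "1 - y > 0" using that by auto
    have e1: "?g y powr (a - 1) = y powr (a - 1) * (1 - y) powr (1 - a)"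
      using y powr_minus[of "1 - y" "a - 1"] by (simp add: powr_divide field_simps)
    have e2: "(1 + ?g y) powr (- a - b) = (1 - y) powr (a + b)"
    proof -
      have "1 + ?g y = 1 / (1 - y)" using y by (simp add: field_simps)
      then have "(1 + ?g y) powr (- a - b) = 1 / (1 - y) powr (- a - b)" using y by (simp add: powr_divide)
      also have "\<dots> = (1 - y) powr (a + b)"
        using y powr_minus[of "1 - y" "a + b"] by (simp add: inverse_eq_divide)
      finally show ?thesis .
    qed
    have e3: "\<bar>?g' y\<bar> = (1 - y) powr (- 2)"
      using y by (simp add: powr_minus powr_numeral inverse_eq_divide)
    have "\<bar>?g' y\<bar> * ?f (?g y) = y powr (a - 1) * ((1 - y) powr (- 2) * (1 - y) powr (1 - a) * (1 - y) powr (a + b))"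
      unfolding e1 e2 e3 by (simp only: mult_ac)
    also have "(1 - y) powr (- 2) * (1 - y) powr (1 - a) * (1 - y) powr (a + b) = (1 - y) powr (b - 1)"
      by (simp flip: powr_add)
    finally show ?thesis .
  qed
  have im: "?g ` ?S = {0<..}"
  proof (intro equalityI subsetI)
    fix x :: real assume "x \<in> {0<..}"
    then have "x = ?g (x / (1 + x))" "x / (1 + x) \<in> ?S" by (auto simp: field_simps)
    then show "x \<in> ?g ` ?S" by blast
  qed auto
  have "(?h has_integral Beta a b) ?S"
    using has_integral_Beta_real[OF assms] by (simp add: has_integral_Icc_iff_Ioo)
  moreover from this have "?h absolutely_integrable_on ?S"
    by (intro nonnegative_absolutely_integrable_1) (auto simp: has_integral_integrable)
  ultimately have "?h absolutely_integrable_on ?S \<and> integral ?S ?h = Beta a b" by (simp add: integral_unique)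
  moreover have "integral ?S (\<lambda>y. \<bar>?g' y\<bar> * ?f (?g y)) = integral ?S ?h"
    by (rule integral_cong) (rule eq)
  moreover have "(\<lambda>y. \<bar>?g' y\<bar> * ?f (?g y)) absolutely_integrable_on ?S \<longleftrightarrow> ?h absolutely_integrable_on ?S"
    by (rule set_integrable_cong) (use eq in auto)
  ultimately have "(\<lambda>y. \<bar>?g' y\<bar> * ?f (?g y)) absolutely_integrable_on ?S \<and>
      integral ?S (\<lambda>y. \<bar>?g' y\<bar> * ?f (?g y)) = Beta a b" by (simp only:)
  then have "?f absolutely_integrable_on ?g ` ?S \<and> integral (?g ` ?S) ?f = Beta a b"
    by (subst (asm) has_absolute_integral_change_of_variables_1')
       (auto intro!: derivative_eq_intros simp: inj_on_def field_simps power2_eq_square)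
  then show ?thesis
    unfolding im by (intro absolutely_integrable_imp_nn_integral) auto
qed

text \<open>The even part of the kernel suffices because \<open>cos t\<close> and
  \<open>- cos t\<close> have the same distribution; it is what allows only \<open>c > 0\<close> to
  be used in the averages.\<close>

definition binomial_mean :: "real \<Rightarrow> real \<Rightarrow> ennreal" where
  "binomial_mean s x = ennreal ((\<bar>1 + x\<bar> powr s + \<bar>1 - x\<bar> powr s) / 2)"

text \<open>In the average of the binomial series at \<open>x\<close> and at \<open>-x\<close> the
  odd terms cancel, and the even ones are reindexed.\<close>

lemma sums_binomial_mean:
  fixes x s :: real
  assumes "\<bar>x\<bar> < 1"
  shows "(\<lambda>n. (s gchoose (2 * n)) * x ^ (2 * n)) sums (((1 + x) powr s + (1 - x) powr s) / 2)"
proof -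
  let ?f = "\<lambda>n. ((s gchoose n) * x ^ n + (s gchoose n) * (- x) ^ n) / 2"
  have "?f sums (((1 + x) powr s + (1 + (- x)) powr s) / 2)"
    using assms by (intro sums_divide sums_add gen_binomial_real) auto
  moreover have "?f n = 0" if "n \<notin> range (\<lambda>n. 2 * n)" for n
  proof -
    have "odd n" using that by (auto elim!: evenE)
    then show ?thesis by simp
  qed
  moreover have "strict_mono (\<lambda>n::nat. 2 * n)" by (simp add: strict_mono_def)
  ultimately have "(\<lambda>n. ?f (2 * n)) sums (((1 + x) powr s + (1 + (- x)) powr s) / 2)"
    by (subst sums_mono_reindex)
  then show ?thesis by simp
qed

lemma gbinomial_even_nonneg: "s < 0 \<Longrightarrow> (s gchoose (2 * n)) \<ge> (0::real)"
  by (simp add: gbinomial_pochhammer pochhammer_nonneg)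

text \<open>Both sides have the same coefficients, because taking out \<open>x powr s\<close> for
  \<open>x > 1\<close> leaves the kernel at \<open>1 / x\<close>.\<close>

lemma two_sided_expansion_binomial_mean:
  assumes s: "-1 < s" "s < 0"
  shows "two_sided_expansion s (binomial_mean s) (\<lambda>n. s gchoose (2 * n)) (\<lambda>n. s gchoose (2 * n))"
proof unfold_locales
  let ?c = "\<lambda>n. s gchoose (2 * n)"
  show "binomial_mean s \<in> borel_measurable borel" unfolding binomial_mean_def by measurable
  show "binomial_mean s x = ennreal (\<Sum>n. ?c n * x ^ (2 * n))" if "0 < x" "x < 1" for x
  proof -
    have "(\<Sum>n. ?c n * x ^ (2 * n)) = ((1 + x) powr s + (1 - x) powr s) / 2"
      by (rule sums_unique[symmetric, OF sums_binomial_mean]) (use that in auto)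
    moreover have "\<bar>1 + x\<bar> = 1 + x" "\<bar>1 - x\<bar> = 1 - x" using that by auto
    ultimately show ?thesis by (simp only: binomial_mean_def)
  qed
  show "binomial_mean s x = ennreal (\<Sum>n. ?c n * x powr (s - 2 * real n))" if "x > 1" for x
  proof -
    have "(\<lambda>n. x powr s * (?c n * (1 / x) ^ (2 * n))) sums (x powr s * (((1 + 1 / x) powr s + (1 - 1 / x) powr s) / 2))"
      using that by (intro sums_mult sums_binomial_mean) auto
    also have "x powr s * (((1 + 1 / x) powr s + (1 - 1 / x) powr s) / 2)
        = ((x * (1 + 1 / x)) powr s + (x * (1 - 1 / x)) powr s) / 2"
      by (simp only: powr_mult) (simp add: algebra_simps)
    also have "x * (1 + 1 / x) = \<bar>1 + x\<bar>" using that by (auto simp: field_simps)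
    also have "x * (1 - 1 / x) = \<bar>1 - x\<bar>" using that by (auto simp: field_simps)
    also have "(\<lambda>n. x powr s * (?c n * (1 / x) ^ (2 * n))) = (\<lambda>n. ?c n * x powr (s - 2 * real n))"
    proof
      fix n
      have "x powr (2 * real n) = x ^ (2 * n)" using powr_realpow[of x "2 * n"] that by simp
      then show "x powr s * (?c n * (1 / x) ^ (2 * n)) = ?c n * x powr (s - 2 * real n)"
        by (simp add: powr_diff power_divide)
    qed
    finally have S: "(\<lambda>n. ?c n * x powr (s - 2 * real n)) sums ((\<bar>1 + x\<bar> powr s + \<bar>1 - x\<bar> powr s) / 2)" .
    show ?thesis by (simp only: binomial_mean_def sums_unique[OF S])
  qed
  have nonneg: "?c n \<ge> 0" for n using gbinomial_even_nonneg[OF s(2)] .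
  \<comment> \<open>Up to bounded factors these are the integrals of the terms of the inner series
    over the unit interval, so their sum is the integral of the kernel there, which is finite since
    \<open>s > -1\<close>.\<close>
  have summ: "summable (\<lambda>n. ?c n / (real n + 1))"
  proof -
    have "(\<Sum>n. ennreal (?c n / (2 * real n + 1))) = (\<Sum>n. \<integral>\<^sup>+x. ennreal (?c n) * (ennreal (x powr (2 * real n)) * indicator {0..1} x) \<partial>lborel)"
    proof (rule suminf_cong)
      fix n
      have "(\<integral>\<^sup>+x. ennreal (?c n) * (ennreal (x powr (2 * real n)) * indicator {0..1} x) \<partial>lborel)
          = ennreal (?c n) * ennreal (1 powr (2 * real n + 1) / (2 * real n + 1))"
        by (subst nn_integral_cmult, simp, subst nn_integral_powr_from_0) auto
      then show "ennreal (?c n / (2 * real n + 1)) = (\<integral>\<^sup>+x. ennreal (?c n) * (ennreal (x powr (2 * real n)) * indicator {0..1} x) \<partial>lborel)"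
        using nonneg[of n] by (simp flip: ennreal_mult')
    qed
    also have "\<dots> = (\<integral>\<^sup>+x. (\<Sum>n. ennreal (?c n) * (ennreal (x powr (2 * real n)) * indicator {0..1} x)) \<partial>lborel)"
      by (rule nn_integral_suminf[symmetric]) simp
    also have "\<dots> \<le> (\<integral>\<^sup>+x. ennreal (x powr (1 - 1) * (1 - x) powr (s + 1 - 1)) * indicator {0..1} x \<partial>lborel)"
    proof (rule nn_integral_mono_AE)
      have "AE x in lborel. x \<noteq> (0::real) \<and> x \<noteq> 1"
        using AE_lborel_singleton[of "0::real"] AE_lborel_singleton[of "1::real"] by eventually_elim auto
      then show "AE x in lborel. (\<Sum>n. ennreal (?c n) * (ennreal (x powr (2 * real n)) * indicator {0..1} x))
         \<le> ennreal (x powr (1 - 1) * (1 - x) powr (s + 1 - 1)) * indicator {0..1} x"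
      proof eventually_elim
        case (elim x)
        show ?case
        proof (cases "0 < x \<and> x < 1")
          case True
          have S: "(\<lambda>n. ?c n * x ^ (2 * n)) sums (((1 + x) powr s + (1 - x) powr s) / 2)"
            using True by (intro sums_binomial_mean) auto
          have "(\<Sum>n. ennreal (?c n) * (ennreal (x powr (2 * real n)) * indicator {0..1} x)) = (\<Sum>n. ennreal (?c n * x ^ (2 * n)))"
          proof (rule suminf_cong)
            fix n
            have "x powr (2 * real n) = x ^ (2 * n)" using powr_realpow[of x "2 * n"] True by simp
            then show "ennreal (?c n) * (ennreal (x powr (2 * real n)) * indicator {0..1} x) = ennreal (?c n * x ^ (2 * n))"
              using True nonneg[of n] by (simp flip: ennreal_mult')
          qed
          also have "\<dots> = ennreal (\<Sum>n. ?c n * x ^ (2 * n))"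
            by (rule suminf_ennreal2[OF _ sums_summable[OF S]]) (use nonneg True in simp)
          also have "(\<Sum>n. ?c n * x ^ (2 * n)) = ((1 + x) powr s + (1 - x) powr s) / 2"
            by (rule sums_unique[OF S, symmetric])
          \<comment> \<open>For negative \<open>s\<close> the summand at \<open>1 - x\<close> is the
            larger one; it is the integrand of \<open>Beta 1 (s + 1)\<close>.\<close>
          also have "\<dots> \<le> ennreal ((1 - x) powr s)"
            using True s by (intro ennreal_leI) (auto intro: powr_mono2')
          finally show ?thesis using True by simp
        qed (use elim in \<open>auto simp: indicator_def\<close>)
      qed
    qed
    also have "\<dots> = ennreal (Beta 1 (s + 1))"
      using s by (intro nn_integral_has_integral_lebesgue' has_integral_Beta_real) auto
    finally have "(\<Sum>n. ennreal (?c n / (2 * real n + 1))) \<noteq> top"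
      using ennreal_less_top[of "Beta 1 (s + 1)"] by (metis leD)
    then have "summable (\<lambda>n. ?c n / (2 * real n + 1))"
      using nonneg by (intro summable_suminf_not_top) auto
    then have "summable (\<lambda>n. 2 * (?c n / (2 * real n + 1)))" by (rule summable_mult)
    then show ?thesis
    proof (rule summable_comparison_test')
      fix n
      have "?c n / (real n + 1) \<le> ?c n / (real n + 1 / 2)"
        using nonneg[of n] by (intro divide_left_mono) auto
      then show "norm (?c n / (real n + 1)) \<le> 2 * (?c n / (2 * real n + 1))"
        using nonneg[of n] by (simp add: field_simps)
    qed
  qed
  show "summable (\<lambda>n. ?c n / (real n + 1))" by (rule summ)
  show "?c n \<ge> 0" for n by (rule nonneg)
qed (use s in auto)

text \<open>The summand in \<open>1 + x\<close> on the half-line gives the first Beta value. The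
  summand in \<open>1 - x\<close> is split at 1 into the other two, its outer part after a shift of
  the variable by 1.\<close>

lemma nn_integral_Mellin_binomial_mean:
  assumes s: "-1 < s" "s < 0" and w: "0 < w" "w < - s"
  shows "(\<integral>\<^sup>+x. ennreal (x powr (w - 1)) * indicator {0<..} x * binomial_mean s x \<partial>lborel)
    = ennreal ((Beta w (- s - w) + Beta w (s + 1) + Beta (s + 1) (- s - w)) / 2)"
proof -
  let ?f = "\<lambda>x::real. ennreal (x powr (w - 1) * (1 + x) powr (- w - (- s - w))) * indicator {0<..} x"
  let ?g = "\<lambda>x::real. ennreal (x powr (w - 1) * (1 - x) powr (s + 1 - 1)) * indicator {0..1} x"
  let ?h = "\<lambda>y::real. ennreal (y powr (s + 1 - 1) * (1 + y) powr (- (s + 1) - (- s - w))) * indicator {0<..} y"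
  have "AE x in lborel. x \<noteq> (0::real) \<and> x \<noteq> 1"
    using AE_lborel_singleton[of "0::real"] AE_lborel_singleton[of "1::real"] by eventually_elim auto
  then have "AE x in lborel. ennreal (x powr (w - 1)) * indicator {0<..} x * binomial_mean s x
      = ennreal (1 / 2) * (?f x + (?g x + ?h (-1 + 1 * x)))"
  proof eventually_elim
    case (elim x)
    have *: "ennreal p * ennreal ((q + r) / 2) = ennreal (1 / 2) * (ennreal (p * q) + ennreal (p * r))"
      if "p \<ge> 0" "q \<ge> 0" "r \<ge> 0" for p q r
    proof -
      have A: "ennreal (p * q + p * r) = ennreal (p * q) + ennreal (p * r)"
        by (rule ennreal_plus) (use that in auto)
      have B: "ennreal (1 / 2 * (p * q + p * r)) = ennreal (1 / 2) * ennreal (p * q + p * r)"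
        by (rule ennreal_mult) (use that in auto)
      have C: "ennreal (p * ((q + r) / 2)) = ennreal p * ennreal ((q + r) / 2)"
        by (rule ennreal_mult) (use that in auto)
      have "p * ((q + r) / 2) = 1 / 2 * (p * q + p * r)" by (simp add: field_simps)
      then show ?thesis unfolding A[symmetric] B[symmetric] C[symmetric] by (simp only:)
    qed
    consider "x < 0" | "0 < x" "x < 1" | "x > 1" using elim by linarith
    then show ?case
    proof cases
      case 2
      then show ?thesis by (simp add: binomial_mean_def *)
    next
      case 3
      have "ennreal (x powr (w - 1)) * binomial_mean s x
         = ennreal (1 / 2) * (ennreal (x powr (w - 1) * (1 + x) powr s) + ennreal (x powr (w - 1) * (x - 1) powr s))"
        unfolding binomial_mean_def using 3 by (subst *) auto
      then show ?thesis using 3 by (simp add: mult_ac)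
    qed auto
  qed
  then have "(\<integral>\<^sup>+x. ennreal (x powr (w - 1)) * indicator {0<..} x * binomial_mean s x \<partial>lborel)
      = (\<integral>\<^sup>+x. ennreal (1 / 2) * (?f x + (?g x + ?h (-1 + 1 * x))) \<partial>lborel)"
    by (rule nn_integral_cong_AE)
  also have "\<dots> = ennreal (1 / 2) * ((\<integral>\<^sup>+x. ?f x \<partial>lborel) + ((\<integral>\<^sup>+x. ?g x \<partial>lborel) + (\<integral>\<^sup>+x. ?h (-1 + 1 * x) \<partial>lborel)))"
    by (subst nn_integral_cmult, simp, subst nn_integral_add, simp, simp, subst nn_integral_add, simp_all)
  also have "(\<integral>\<^sup>+x. ?h (-1 + 1 * x) \<partial>lborel) = (\<integral>\<^sup>+x. ?h x \<partial>lborel)"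
    using nn_integral_real_affine[of ?h 1 "-1"] by simp
  also have "(\<integral>\<^sup>+x. ?h x \<partial>lborel) = ennreal (Beta (s + 1) (- s - w))"
    using s w by (intro nn_integral_Beta_halfline) auto
  also have "(\<integral>\<^sup>+x. ?f x \<partial>lborel) = ennreal (Beta w (- s - w))"
    using s w by (intro nn_integral_Beta_halfline) auto
  also have "(\<integral>\<^sup>+x. ?g x \<partial>lborel) = ennreal (Beta w (s + 1))"
    using s w by (intro nn_integral_has_integral_lebesgue' has_integral_Beta_real) auto
  also have "ennreal (1 / 2) * (ennreal (Beta w (- s - w)) + (ennreal (Beta w (s + 1)) + ennreal (Beta (s + 1) (- s - w))))
      = ennreal ((Beta w (- s - w) + Beta w (s + 1) + Beta (s + 1) (- s - w)) / 2)"
  proof -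
    have "Beta x y > 0" if "x > 0" "y > 0" for x y :: real
      using that unfolding Beta_def by (intro divide_pos_pos mult_pos_pos Gamma_real_pos) auto
    then have pos: "Beta w (- s - w) > 0" "Beta w (s + 1) > 0" "Beta (s + 1) (- s - w) > 0" using s w by auto
    have *: "ennreal (1 / 2) * (ennreal p + (ennreal q + ennreal r)) = ennreal ((p + q + r) / 2)"
      if "p > 0" "q > 0" "r > 0" for p q r
    proof -
      have "ennreal p + (ennreal q + ennreal r) = ennreal (p + q + r)" using that by (simp add: add_ac flip: ennreal_plus)
      moreover have "ennreal (1 / 2 * (p + q + r)) = ennreal (1 / 2) * ennreal (p + q + r)"
        by (rule ennreal_mult) (use that in auto)
      ultimately show ?thesis by simp
    qed
    show ?thesis by (rule *[OF pos])
  qed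
  finally show ?thesis .
qed

section \<open>Continuation of the Mellin transform to odd integers\<close>

context two_sided_expansion
begin

text \<open>The partial fractions have poles only at \<open>2 * n - s\<close>, but the factor
  \<open>Gamma (- s - w)\<close> of the closed forms has poles at all \<open>n - s\<close>. Removing
  all of them makes both sides holomorphic on one set.\<close>

definition Mellin_domain :: "complex set" where
  "Mellin_domain = {w. Re w > 0} - range (\<lambda>n::nat. of_real (real n - s))"

definition complex_Mellin_diff :: "complex \<Rightarrow> complex" where
  "complex_Mellin_diff w = (\<Sum>n. of_real (b n) / (of_real (2 * real n) + w))
     - (\<Sum>n. of_real (a n) / (of_real (s - 2 * real n) + w))"

text \<open>Distinct removed points are at distance at least 1, so they form a closed set; a
  countable set cannot disconnect an open half-plane.\<close>

lemma open_Mellin_domain: "open Mellin_domain"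
  and connected_Mellin_domain: "connected Mellin_domain"
proof -
  have "closed (range (\<lambda>n::nat. complex_of_real (real n - s)))"
  proof (rule discrete_imp_closed[of 1])
    show "\<forall>x\<in>range (\<lambda>n. complex_of_real (real n - s)). \<forall>y\<in>range (\<lambda>n. complex_of_real (real n - s)). dist y x < 1 \<longrightarrow> y = x"
    proof safe
      fix m n :: nat
      assume "dist (complex_of_real (real m - s)) (complex_of_real (real n - s)) < 1"
      then have "\<bar>real m - real n\<bar> < 1" by (simp add: dist_norm flip: of_real_diff)
      then have "m = n" by linarith
      then show "complex_of_real (real m - s) = complex_of_real (real n - s)" by simp
    qed
  qed simp
  then show "open Mellin_domain"
    unfolding Mellin_domain_def by (intro open_Diff open_halfspace_Re_gt)
  show "connected Mellin_domain"
    unfolding Mellin_domain_def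
    by (intro connected_open_diff_countable open_halfspace_Re_gt convex_connected convex_halfspace_Re_gt) auto
qed

lemma
  assumes "w \<in> Mellin_domain"
  shows denominator_inside_nonzero: "of_real (2 * real n) + w \<noteq> 0"
    and denominator_outside_nonzero: "of_real (s - 2 * real n) + w \<noteq> 0"
proof -
  show "of_real (2 * real n) + w \<noteq> 0"
  proof
    assume "of_real (2 * real n) + w = 0"
    then have "Re (of_real (2 * real n) + w) = 0" by simp
    then show False using assms by (simp add: Mellin_domain_def)
  qed
  show "of_real (s - 2 * real n) + w \<noteq> 0"
  proof
    assume "of_real (s - 2 * real n) + w = 0"
    then have "w = of_real (real (2 * n) - s)" by (simp add: algebra_simps eq_neg_iff_add_eq_0)
    then have "w \<in> range (\<lambda>n::nat. of_real (real n - s))" by blast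
    then show False using assms by (simp only: Mellin_domain_def) blast
  qed
qed

text \<open>Locally uniform convergence: on the unit ball around \<open>x\<close>, as soon as
  \<open>n\<close> reaches \<open>cmod x + 3\<close> the denominator is at least
  \<open>2 * n - 2 - cmod x\<close>, hence at least \<open>n + 1\<close>, and the weighted
  coefficients are a majorant.\<close>

lemma holomorphic_partial_fraction_series:
  fixes u v :: "nat \<Rightarrow> real"
  assumes u: "summable (\<lambda>n. u n / (real n + 1))" "\<And>n. u n \<ge> 0"
    and v: "\<And>n. \<bar>v n\<bar> \<ge> 2 * real n - 1"
    and nz: "\<And>w n. w \<in> S \<Longrightarrow> of_real (v n) + w \<noteq> 0" and S: "open S"
  shows "(\<lambda>w. \<Sum>n. of_real (u n) / (of_real (v n) + w)) holomorphic_on S"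
proof -
  let ?f = "\<lambda>n w. complex_of_real (u n) / (of_real (v n) + w)"
  obtain g where g: "\<forall>x \<in> S. ((\<lambda>n. ?f n x) sums g x) \<and> g field_differentiable (at x)"
  proof (rule series_differentiable_comparison_complex[OF S, of ?f])
    show "?f n field_differentiable at x" if "x \<in> S" for n x
      using nz[OF that] by (intro derivative_intros) auto
    show "\<exists>d h. 0 < d \<and> summable h \<and> range h \<subseteq> \<real>\<^sub>\<ge>\<^sub>0 \<and>
        (\<forall>\<^sub>F n in sequentially. \<forall>y\<in>ball x d \<inter> S. cmod (?f n y) \<le> cmod (h n))" if "x \<in> S" for x
    proof (intro exI conjI)
      let ?h = "\<lambda>n. complex_of_real (u n / (real n + 1))"
      show "summable ?h" using u(1) by (simp only: summable_of_real)
      show "range ?h \<subseteq> \<real>\<^sub>\<ge>\<^sub>0" using u(2) by (auto simp del: of_real_divide)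
      have "\<forall>\<^sub>F n in sequentially. real n \<ge> cmod x + 3"
        using eventually_ge_at_top[of "nat \<lceil>cmod x + 3\<rceil>"] by eventually_elim linarith
      then show "\<forall>\<^sub>F n in sequentially. \<forall>y\<in>ball x 1 \<inter> S. cmod (?f n y) \<le> cmod (?h n)"
      proof eventually_elim
        case (elim n)
        show ?case
        proof
          fix y assume y: "y \<in> ball x 1 \<inter> S"
          have "cmod y \<le> cmod x + 1"
            using y norm_triangle_ineq2[of y x] by (simp add: dist_norm norm_minus_commute)
          moreover have "cmod (of_real (v n) + y) \<ge> \<bar>v n\<bar> - cmod y"
            using norm_diff_ineq[of "complex_of_real (v n)" y] by simp
          ultimately have "cmod (of_real (v n) + y) \<ge> real n + 1" using v[of n] elim by linarith
          then have "u n / cmod (of_real (v n) + y) \<le> u n / (real n + 1)"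
            using u(2)[of n] by (intro divide_left_mono mult_pos_pos) auto
          then show "cmod (?f n y) \<le> cmod (?h n)"
            using u(2)[of n] by (simp add: norm_divide del: of_real_divide)
        qed
      qed
    qed simp
  qed auto
  have "g holomorphic_on S"
    using g by (auto simp: holomorphic_on_def intro: field_differentiable_at_within)
  then show ?thesis
    by (rule holomorphic_transform) (use g in \<open>auto simp: sums_iff\<close>)
qed

lemma holomorphic_complex_Mellin_diff: "complex_Mellin_diff holomorphic_on Mellin_domain"
  unfolding complex_Mellin_diff_def[abs_def]
proof (intro holomorphic_on_diff holomorphic_partial_fraction_series)
  show "2 * real n - 1 \<le> \<bar>s - 2 * real n\<bar>" for n
    using s_lt by linarith
qed (use denominator_inside_nonzero denominator_outside_nonzero open_Mellin_domain
      summable_a summable_b a_nonneg b_nonneg in auto)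

lemma complex_Mellin_diff_of_real:
  assumes "w > 0" "summable (\<lambda>n. a n / (s - 2 * real n + w))"
  shows "complex_Mellin_diff (of_real w) = of_real (Mellin_diff w)"
  using assms summable_Mellin_inside[of w]
  unfolding complex_Mellin_diff_def Mellin_diff_def
  by (simp add: suminf_of_real)

lemma odd_in_Mellin_domain: "complex_of_real (1 + 2 * real j) \<in> Mellin_domain"
proof -
  have "complex_of_real (1 + 2 * real j) \<noteq> of_real (real n - s)" for n
  proof
    assume "complex_of_real (1 + 2 * real j) = of_real (real n - s)"
    then have "s = real n - (1 + 2 * real j)" by (simp only: of_real_eq_iff)
    also have "\<dots> = of_int (int n - (1 + 2 * int j))" by simp
    finally show False using s_notin_Ints by (metis Ints_of_int)
  qed
  then show ?thesis by (auto simp: Mellin_domain_def)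
qed

lemma complex_Mellin_diff_odd: "complex_Mellin_diff (of_real (1 + 2 * real j)) = of_real (Mellin_diff (1 + 2 * real j))"
proof (rule complex_Mellin_diff_of_real)
  show "summable (\<lambda>n. a n / (s - 2 * real n + (1 + 2 * real j)))"
    using summable_weights[OF summable_a a_nonneg denominator_bound[of _ j]] by simp
qed simp

lemma nn_integral_Mellin_diff:
  assumes w: "0 < w" "w < - s"
  shows "(\<integral>\<^sup>+x. ennreal (x powr (w - 1)) * indicator {0<..} x * G x \<partial>lborel) = ennreal (Mellin_diff w)"
    and "Mellin_diff w \<ge> 0"
    and "complex_Mellin_diff (of_real w) = of_real (Mellin_diff w)"
proof -
  have eq: "a n / (s - 2 * real n + w) = - (a n / (2 * real n - s - w))" for n
  proof -
    have "s - 2 * real n + w = - (2 * real n - s - w)" by simp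
    then show ?thesis by (simp only: divide_minus_right)
  qed
  have S: "summable (\<lambda>n. a n / (s - 2 * real n + w))"
    unfolding eq using w by (intro summable_minus summable_Mellin_outside)
  have D: "Mellin_diff w = (\<Sum>n. b n / (2 * real n + w)) + (\<Sum>n. a n / (2 * real n - s - w))"
    unfolding Mellin_diff_def eq using w by (simp add: suminf_minus summable_Mellin_outside)
  show "(\<integral>\<^sup>+x. ennreal (x powr (w - 1)) * indicator {0<..} x * G x \<partial>lborel) = ennreal (Mellin_diff w)"
    unfolding D by (rule nn_integral_Mellin[OF w])
  show "Mellin_diff w \<ge> 0"
    unfolding D using w a_nonneg b_nonneg
    by (intro add_nonneg_nonneg suminf_nonneg summable_Mellin_inside summable_Mellin_outside) auto
  show "complex_Mellin_diff (of_real w) = of_real (Mellin_diff w)"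
    by (rule complex_Mellin_diff_of_real[OF w(1) S])
qed

text \<open>The Mellin transform converges only for \<open>0 < w < -s\<close>, but its partial fraction expansion,
  continued to odd integers, gives the coefficients in \<open>arcsine_mean_outside\<close>.\<close>

lemma Mellin_diff_odd_eqI:
  assumes F: "F holomorphic_on Mellin_domain"
    and eq: "\<And>w. 0 < w \<Longrightarrow> w < - s \<Longrightarrow> F (of_real w) = of_real (Mellin_diff w)"
  shows "of_real (Mellin_diff (1 + 2 * real j)) = F (of_real (1 + 2 * real j))"
proof -
  \<comment> \<open>Agreement on the real strip suffices; its midpoint serves as accumulation point
    inside the domain.\<close>
  let ?U = "complex_of_real ` {0<..<-s}" and ?z = "complex_of_real (- s / 2)"
  have mem: "of_real w \<in> Mellin_domain" if "0 < w" "w < - s" for w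
    using that by (auto simp: Mellin_domain_def simp flip: of_real_diff)
  have "F (of_real (1 + 2 * real j)) - complex_Mellin_diff (of_real (1 + 2 * real j)) = 0"
  proof (rule analytic_continuation[of "\<lambda>w. F w - complex_Mellin_diff w" Mellin_domain ?U ?z])
    show "(\<lambda>w. F w - complex_Mellin_diff w) holomorphic_on Mellin_domain"
      by (intro holomorphic_intros F holomorphic_complex_Mellin_diff)
    show "?U \<subseteq> Mellin_domain" using mem by auto
    show "?z \<in> Mellin_domain" by (rule mem) (use s_lt in auto)
    show "?z islimpt ?U"
      unfolding islimpt_approachable
    proof (intro allI impI)
      fix e :: real assume "e > 0"
      define t where "t = min (e / 2) (- s / 4)"
      have t: "t > 0" "t < e" "t < - s / 2" using \<open>e > 0\<close> s_lt by (auto simp: t_def min_def)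
      show "\<exists>x'\<in>?U. x' \<noteq> ?z \<and> dist x' ?z < e"
      proof (intro bexI conjI)
        show "complex_of_real (- s / 2 + t) \<in> ?U" using t s_lt by (intro imageI) auto
        show "complex_of_real (- s / 2 + t) \<noteq> ?z" using t by (simp only: of_real_eq_iff)
        show "dist (complex_of_real (- s / 2 + t)) ?z < e" using t by (simp add: dist_norm)
      qed
    qed
    show "F z - complex_Mellin_diff z = 0" if "z \<in> ?U" for z
      using that nn_integral_Mellin_diff(3) eq by auto
  qed (use open_Mellin_domain connected_Mellin_domain odd_in_Mellin_domain in auto)
  then show ?thesis by (simp only: complex_Mellin_diff_odd) simp
qed

end

section \<open>Gamma product formulas for the Mellin transforms and their values at odd
  integers\<close>

lemma Gamma_mult_rGamma: "(x::'a::Gamma) \<notin> \<int>\<^sub>\<le>\<^sub>0 \<Longrightarrow> Gamma x * rGamma x = 1"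
  by (simp add: Gamma_def rGamma_eq_zero_iff)

text \<open>Reflection rewrites the reciprocal Gamma of each Beta value as a Gamma factor times a
  sine, so all three share the product of three Gammas. The sine arguments add up to pi, and for
  such angles the sum of the sines is four times the product of the cosines of the half angles; the
  minus sign comes from \<open>cos (pi * (z + 1) / 2) = - sin (pi * z / 2)\<close>.\<close>

lemma sum_of_three_Betas:
  fixes w z :: complex
  assumes "w \<notin> \<int>\<^sub>\<le>\<^sub>0" "- z - w \<notin> \<int>\<^sub>\<le>\<^sub>0" "z + 1 \<notin> \<int>\<^sub>\<le>\<^sub>0"
  shows "(Beta w (- z - w) + Beta w (z + 1) + Beta (z + 1) (- z - w)) / 2
    = - (2 / of_real pi) * Gamma w * Gamma (- z - w) * Gamma (z + 1)
        * cos (of_real pi * (w + z) / 2) * cos (of_real pi * w / 2) * sin (of_real pi * z / 2)"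
proof -
  let ?p = "of_real pi :: complex"
  have refl: "rGamma (1 - x) = Gamma x * (sin (?p * x) / ?p)" if "x \<notin> \<int>\<^sub>\<le>\<^sub>0" for x
  proof -
    have "Gamma x * (rGamma x * rGamma (1 - x)) = Gamma x * (sin (?p * x) / ?p)"
      by (simp only: rGamma_reflection_complex)
    then show ?thesis using Gamma_mult_rGamma[OF that] by (simp flip: mult.assoc)
  qed
  have a: "Beta w (- z - w) = Gamma w * Gamma (- z - w) * (Gamma (z + 1) * (sin (?p * (z + 1)) / ?p))"
    using refl[OF assms(3)] by (simp add: Beta_altdef)
  have b: "Beta w (z + 1) = Gamma w * Gamma (z + 1) * (Gamma (- z - w) * (sin (?p * (- z - w)) / ?p))"
    using refl[OF assms(2)] by (simp add: Beta_altdef algebra_simps)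
  have c: "Beta (z + 1) (- z - w) = Gamma (z + 1) * Gamma (- z - w) * (Gamma w * (sin (?p * w) / ?p))"
    using refl[OF assms(1)] by (simp add: Beta_altdef)
  have "sin (?p * (z + 1)) + sin (?p * (- z - w)) + sin (?p * w)
     = - 4 * cos (?p * (w + z) / 2) * cos (?p * w / 2) * sin (?p * z / 2)"
  proof -
    define x y where "x = ?p * w / 2" and "y = ?p * z / 2"
    have e: "?p * (w + z) / 2 = x + y" "?p * w / 2 = x" "?p * z / 2 = y"
      "?p * w = 2 * x" "?p * (- z - w) = - (2 * (x + y))" "?p * (z + 1) = 2 * y + ?p"
      by (simp_all add: x_def y_def field_simps)
    have sx: "(sin x)\<^sup>2 = 1 - (cos x)\<^sup>2" and sy: "(sin y)\<^sup>2 = 1 - (cos y)\<^sup>2"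
      by (simp_all add: sin_squared_eq)
    have "sin (2 * y + ?p) = - (2 * sin y * cos y)" by (simp add: sin_add sin_double)
    moreover have "sin (- (2 * (x + y))) = - (2 * sin (x + y) * cos (x + y))"
      by (simp only: sin_minus sin_double)
    moreover have "sin (2 * x) = 2 * sin x * cos x" by (rule sin_double)
    moreover have "- (2 * sin y * cos y) + - (2 * (sin x * cos y + cos x * sin y) * (cos x * cos y - sin x * sin y))
         + 2 * sin x * cos x = - 4 * (cos x * cos y - sin x * sin y) * cos x * sin y"
      using sx sy by algebra
    ultimately show ?thesis unfolding e by (simp add: sin_add cos_add)
  qed
  then have "Gamma w * Gamma (- z - w) * Gamma (z + 1) / (2 * ?p) * (sin (?p * (z + 1)) + sin (?p * (- z - w)) + sin (?p * w))
     = Gamma w * Gamma (- z - w) * Gamma (z + 1) / (2 * ?p) * (- 4 * cos (?p * (w + z) / 2) * cos (?p * w / 2) * sin (?p * z / 2))"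
    by (simp only:)
  moreover have "(Beta w (- z - w) + Beta w (z + 1) + Beta (z + 1) (- z - w)) / 2
     = Gamma w * Gamma (- z - w) * Gamma (z + 1) / (2 * ?p) * (sin (?p * (z + 1)) + sin (?p * (- z - w)) + sin (?p * w))"
    unfolding a b c by (simp add: field_simps)
  ultimately show ?thesis by (simp add: mult_ac)
qed

text \<open>By reflection at \<open>(1 - w) / 2\<close> the zeros of the cosine cancel the poles of
  the moment. The right-hand side is entire in \<open>w\<close> and can be evaluated at odd
  integers, where the left-hand factors cannot be treated separately.\<close>

lemma cos_moment_minus_mult_cos:
  assumes "0 < w" "w < 1"
  shows "cos_moment (- w) * cos (pi * w / 2) = sqrt pi * rGamma ((1 + w) / 2) * rGamma (1 - w / 2)"
proof -
  let ?y = "(1 - w) / 2"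
  have y: "1 - ?y = (1 + w) / 2" by (simp add: field_simps)
  have "rGamma (complex_of_real ?y) * rGamma (1 - complex_of_real ?y) = sin (of_real pi * of_real ?y) / of_real pi"
    by (rule rGamma_reflection_complex)
  also have "1 - complex_of_real ?y = of_real ((1 + w) / 2)"
    unfolding y[symmetric] by simp
  also have "sin (of_real pi * complex_of_real ?y) = of_real (sin (pi * ?y))"
    unfolding of_real_mult[symmetric] sin_of_real ..
  also have "sin (pi * ?y) = cos (pi * w / 2)"
    by (simp add: cos_sin_eq right_diff_distrib diff_divide_distrib)
  finally have "complex_of_real (rGamma ?y * rGamma ((1 + w) / 2)) = of_real (cos (pi * w / 2) / pi)"
    unfolding rGamma_complex_of_real by (simp only: of_real_mult of_real_divide)
  then have R: "rGamma ?y * rGamma ((1 + w) / 2) = cos (pi * w / 2) / pi" by (simp only: of_real_eq_iff)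
  have "?y \<notin> \<int>\<^sub>\<le>\<^sub>0" using assms by (auto elim!: nonpos_Ints_cases')
  then have "Gamma ?y * (rGamma ?y * rGamma ((1 + w) / 2)) = rGamma ((1 + w) / 2)"
    using Gamma_mult_rGamma[of ?y] by (simp flip: mult.assoc)
  then have G: "Gamma ?y * cos (pi * w / 2) = pi * rGamma ((1 + w) / 2)"
    unfolding R by (simp add: field_simps)
  have "cos_moment (- w) * cos (pi * w / 2) = (Gamma ?y * cos (pi * w / 2)) * rGamma (1 - w / 2) / sqrt pi"
    by (simp add: cos_moment_def rGamma_inverse_Gamma inverse_eq_divide)
  also have "\<dots> = (pi / sqrt pi) * rGamma ((1 + w) / 2) * rGamma (1 - w / 2)"
    unfolding G by simp
  finally show ?thesis by (simp only: real_div_sqrt[OF less_imp_le[OF pi_gt_zero]])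
qed

text \<open>The product form of the Mellin transform of the kernel, with \<open>z\<close> in the
  role of \<open>s\<close>.\<close>

definition Mellin_binomial :: "complex \<Rightarrow> complex \<Rightarrow> complex" where
  "Mellin_binomial z w = - (2 / of_real pi) * Gamma w * Gamma (- z - w) * Gamma (z + 1)
        * cos (of_real pi * (w + z) / 2) * cos (of_real pi * w / 2) * sin (of_real pi * z / 2)"

text \<open>\<open>Mellin_binomial\<close> times the moment of order \<open>-w\<close>, with the
  moment and \<open>cos (pi * w / 2)\<close> merged into reciprocal Gammas so that it is regular at
  odd \<open>w\<close>. By Laplace's integral the first average is, for \<open>x < 1\<close>, a
  Legendre function up to a power factor.\<close>

definition Mellin_Legendre :: "complex \<Rightarrow> complex \<Rightarrow> complex" where
  "Mellin_Legendre z w = - (2 / of_real (sqrt pi)) * Gamma w * Gamma (- z - w) * Gamma (z + 1)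
        * cos (of_real pi * (w + z) / 2) * sin (of_real pi * z / 2) * rGamma ((1 + w) / 2) * rGamma (1 - w / 2)"

lemma (in two_sided_expansion) Mellin_domain_Gamma_args:
  assumes "w \<in> Mellin_domain"
  shows "w \<notin> \<int>\<^sub>\<le>\<^sub>0" "- of_real s - w \<notin> \<int>\<^sub>\<le>\<^sub>0"
proof -
  show "w \<notin> \<int>\<^sub>\<le>\<^sub>0" using assms by (auto simp: Mellin_domain_def elim!: nonpos_Ints_cases)
  show "- of_real s - w \<notin> \<int>\<^sub>\<le>\<^sub>0"
  proof
    assume "- of_real s - w \<in> \<int>\<^sub>\<le>\<^sub>0"
    then obtain n where "- of_real s - w = - of_nat n" by (auto elim!: nonpos_Ints_cases')
    then have "w = of_real (real n - s)" by (simp add: algebra_simps)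
    then have "w \<in> range (\<lambda>n::nat. of_real (real n - s))" by blast
    then show False using assms by (simp only: Mellin_domain_def) blast
  qed
qed

lemma (in two_sided_expansion) holomorphic_Mellin_binomial:
  "Mellin_binomial (of_real s) holomorphic_on Mellin_domain"
  unfolding Mellin_binomial_def[abs_def]
  by (intro holomorphic_intros) (use Mellin_domain_Gamma_args in auto)

lemma (in two_sided_expansion) holomorphic_Mellin_Legendre:
  "Mellin_Legendre (of_real s) holomorphic_on Mellin_domain"
  unfolding Mellin_Legendre_def[abs_def]
  by (intro holomorphic_intros) (use Mellin_domain_Gamma_args in auto)

lemma Mellin_diff_binomial_mean:
  assumes s: "-1 < s" "s < 0" and w: "0 < w" "w < - s"
  defines "c \<equiv> \<lambda>n. s gchoose (2 * n)"
  shows "of_real (two_sided_expansion.Mellin_diff s c c w) = Mellin_binomial (of_real s) (of_real w)"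
proof -
  interpret two_sided_expansion s "binomial_mean s" c c
    unfolding c_def by (rule two_sided_expansion_binomial_mean[OF s])
  let ?B = "(Beta w (- s - w) + Beta w (s + 1) + Beta (s + 1) (- s - w)) / 2"
  have "Beta x y > 0" if "x > 0" "y > 0" for x y :: real
    using that unfolding Beta_def by (intro divide_pos_pos mult_pos_pos Gamma_real_pos) auto
  then have pos: "Beta w (- s - w) > 0" "Beta w (s + 1) > 0" "Beta (s + 1) (- s - w) > 0" using s w by auto
  have "ennreal (Mellin_diff w) = ennreal ?B"
    using nn_integral_Mellin_diff(1)[OF w] nn_integral_Mellin_binomial_mean[OF s w] by simp
  then have "Mellin_diff w = ?B"
    using nn_integral_Mellin_diff(2)[OF w] pos by (subst (asm) ennreal_inj) auto
  then have "complex_of_real (Mellin_diff w) = of_real ?B" by (simp only:)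
  also have "\<dots> = (Beta (of_real w) (- of_real s - of_real w) + Beta (of_real w) (of_real s + 1) + Beta (of_real s + 1) (- of_real s - of_real w)) / 2"
    by (simp flip: Beta_complex_of_real)
  also have "\<dots> = Mellin_binomial (of_real s) (of_real w)"
    unfolding Mellin_binomial_def
  proof (rule sum_of_three_Betas)
    have "of_real x \<notin> (\<int>\<^sub>\<le>\<^sub>0 :: complex set)" if "x > 0" for x :: real
      using that by (auto elim!: nonpos_Ints_cases' simp: complex_eq_iff)
    from this[of w] this[of "-s-w"] this[of "s+1"]
    show "complex_of_real w \<notin> \<int>\<^sub>\<le>\<^sub>0" "- complex_of_real s - of_real w \<notin> \<int>\<^sub>\<le>\<^sub>0" "complex_of_real s + 1 \<notin> \<int>\<^sub>\<le>\<^sub>0"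
      using s w by auto
  qed
  finally show ?thesis .
qed

lemma Mellin_binomial_odd: "Mellin_binomial z (of_real (1 + 2 * real j)) = 0"
proof -
  have "cos (pi * (1 + 2 * real j) / 2) = 0"
    by (rule cos_zero_iff[THEN iffD2]) (rule disjI1, rule exI[of _ "2 * j + 1"], simp)
  moreover have "cos (of_real pi * of_real (1 + 2 * real j) / 2) = complex_of_real (cos (pi * (1 + 2 * real j) / 2))"
    by (simp flip: cos_of_real)
  ultimately have "cos (of_real pi * of_real (1 + 2 * real j) / 2) = (0::complex)" by (simp only: of_real_0)
  then show ?thesis unfolding Mellin_binomial_def by (simp only: mult_zero_right mult_zero_left)
qed

text \<open>The closed form of the kernel's transform vanishes at odd integers, and by continuation
  so do the partial fractions; hence the first average has no odd series.\<close>

lemma two_sided_expansion_Legendre: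
  assumes s: "-1 < s" "s < 0"
  shows "two_sided_expansion s (arcsine_mean (binomial_mean s))
    (\<lambda>n. (s gchoose (2 * n)) * cos_moment (s - 2 * real n)) (\<lambda>n. (s gchoose (2 * n)) * cos_moment (2 * real n))"
proof -
  interpret two_sided_expansion s "binomial_mean s" "\<lambda>n. s gchoose (2 * n)" "\<lambda>n. s gchoose (2 * n)"
    by (rule two_sided_expansion_binomial_mean[OF s])
  have "complex_of_real (Mellin_diff (1 + 2 * real j)) = 0" for j
    using Mellin_diff_odd_eqI[OF holomorphic_Mellin_binomial, of j] Mellin_diff_binomial_mean[OF s]
    by (simp only: Mellin_binomial_odd)
  then have "Mellin_diff (1 + 2 * real j) = 0" for j by (simp only: of_real_eq_0_iff)
  then show ?thesis by (rule two_sided_expansion_arcsine_mean)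
qed

text \<open>The first average multiplies the transform by the moment of order \<open>-w\<close>,
  which is convergent in the strip because \<open>w < 1\<close> there.\<close>

lemma Mellin_diff_Legendre:
  assumes s: "-1 < s" "s < 0" and w: "0 < w" "w < - s"
  defines "a \<equiv> \<lambda>n. (s gchoose (2 * n)) * cos_moment (s - 2 * real n)"
    and "b \<equiv> \<lambda>n. (s gchoose (2 * n)) * cos_moment (2 * real n)"
  shows "of_real (two_sided_expansion.Mellin_diff s a b w) = Mellin_Legendre (of_real s) (of_real w)"
proof -
  interpret G0: two_sided_expansion s "binomial_mean s" "\<lambda>n. s gchoose (2 * n)" "\<lambda>n. s gchoose (2 * n)"
    by (rule two_sided_expansion_binomial_mean[OF s])
  interpret two_sided_expansion s "arcsine_mean (binomial_mean s)" a b
    unfolding a_def b_def by (rule two_sided_expansion_Legendre[OF s])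
  have cm: "cos_moment (- w) > 0" using s w by (intro cos_moment_pos) auto
  have "ennreal (Mellin_diff w) = ennreal (cos_moment (- w)) * ennreal (G0.Mellin_diff w)"
    using nn_integral_Mellin_diff(1)[OF w] G0.nn_integral_Mellin_diff(1)[OF w] s w
    by (subst (asm) nn_integral_Mellin_arcsine_mean) auto
  also have "\<dots> = ennreal (cos_moment (- w) * G0.Mellin_diff w)"
    using cm G0.nn_integral_Mellin_diff(2)[OF w] by (simp add: ennreal_mult)
  finally have "Mellin_diff w = cos_moment (- w) * G0.Mellin_diff w"
    using nn_integral_Mellin_diff(2)[OF w] cm G0.nn_integral_Mellin_diff(2)[OF w] by (subst (asm) ennreal_inj) auto
  then have "complex_of_real (Mellin_diff w) = of_real (cos_moment (- w)) * Mellin_binomial (of_real s) (of_real w)"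
    using Mellin_diff_binomial_mean[OF s w] by (simp only: of_real_mult)
  also have "\<dots> = - (2 / of_real pi) * Gamma (of_real w) * Gamma (- of_real s - of_real w) * Gamma (of_real s + 1)
        * cos (of_real pi * (of_real w + of_real s) / 2) * sin (of_real pi * of_real s / 2)
        * (of_real (cos_moment (- w)) * cos (of_real pi * of_real w / 2))"
    unfolding Mellin_binomial_def by (simp only: mult_ac)
  also have "of_real (cos_moment (- w)) * cos (of_real pi * of_real w / 2) = complex_of_real (cos_moment (- w) * cos (pi * w / 2))"
    by (simp flip: cos_of_real)
  also have "cos_moment (- w) * cos (pi * w / 2) = sqrt pi * rGamma ((1 + w) / 2) * rGamma (1 - w / 2)"
    using s w by (intro cos_moment_minus_mult_cos) auto
  also have "complex_of_real (sqrt pi * rGamma ((1 + w) / 2) * rGamma (1 - w / 2))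
     = of_real (sqrt pi) * (rGamma ((1 + of_real w) / 2) * rGamma (1 - of_real w / 2))"
    by (simp flip: rGamma_complex_of_real)
  finally have "complex_of_real (Mellin_diff w) = - (2 / of_real pi * of_real (sqrt pi)) * Gamma (of_real w) * Gamma (- of_real s - of_real w) * Gamma (of_real s + 1)
        * cos (of_real pi * (of_real w + of_real s) / 2) * sin (of_real pi * of_real s / 2)
        * (rGamma ((1 + of_real w) / 2) * rGamma (1 - of_real w / 2))"
    by (simp add: mult_ac)
  moreover have "2 / complex_of_real pi * of_real (sqrt pi) = 2 / of_real (sqrt pi)"
  proof -
    have "complex_of_real pi = of_real (sqrt pi) * of_real (sqrt pi)" by (simp flip: of_real_mult)
    then show ?thesis by simp
  qed
  ultimately show ?thesis by (simp only: Mellin_Legendre_def mult.assoc)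
qed

lemma sin_add_pi_of_nat: "sin (of_real pi * (z + of_nat n)) = (-1) ^ n * sin (of_real pi * z :: complex)"
  and cos_add_pi_of_nat: "cos (of_real pi * (z + of_nat n)) = (-1) ^ n * cos (of_real pi * z :: complex)"
proof -
  have e: "of_real pi * (z + of_nat n) = of_real pi * z + complex_of_real (real n * pi)"
    by (simp add: algebra_simps)
  have s: "sin (complex_of_real (real n * pi)) = 0" and c: "cos (complex_of_real (real n * pi)) = (-1) ^ n"
    unfolding sin_of_real cos_of_real sin_npi cos_npi by simp_all
  show "sin (of_real pi * (z + of_nat n)) = (-1) ^ n * sin (of_real pi * z)"
    "cos (of_real pi * (z + of_nat n)) = (-1) ^ n * cos (of_real pi * z)"
    unfolding e sin_add cos_add s c by simp_all
qed

text \<open>Every factor is reduced to factorials, Pochhammer symbols and trigonometric functions of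
  \<open>x = pi * z / 2\<close>. Two sines stand against the \<open>sin x * cos x\<close> from
  reflection, which leaves the tangent; a non-integral \<open>z\<close> makes the denominators
  nonzero.\<close>

lemma Mellin_Legendre_odd:
  assumes z: "z \<notin> \<int>"
  shows "Mellin_Legendre z (of_real (1 + 2 * real j))
    = tan (of_real pi * z / 2) * 4 ^ j * (pochhammer (1/2) j)\<^sup>2 / pochhammer (z + 1) (2 * j + 1)"
proof -
  let ?p = "of_real pi :: complex"
  define x where "x = ?p * z / 2"
  have z1: "z + 1 \<notin> \<int>\<^sub>\<le>\<^sub>0"
  proof
    assume "z + 1 \<in> \<int>\<^sub>\<le>\<^sub>0"
    then have "z + 1 - 1 \<in> \<int>" by (intro Ints_diff) (auto dest: nonpos_Ints_subset_Ints[THEN subsetD])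
    with z show False by simp
  qed
  have sz: "sin (?p * z) \<noteq> 0"
  proof
    assume "sin (?p * z) = 0"
    then obtain n :: int where "?p * z = of_real (of_int n * pi)" by (auto simp: sin_eq_0 mult_ac)
    then have "?p * z = ?p * of_int n" by (simp add: mult.commute)
    then have "z = of_int n" by simp
    with z show False by simp
  qed
  have sz2: "sin (?p * z) = 2 * sin x * cos x"
    using sin_double[of x] by (simp add: x_def)
  have nz: "sin x \<noteq> 0" "cos x \<noteq> 0" using sz sz2 by auto
  let ?P = "pochhammer (z + 1) (2 * j + 1)"
  let ?H = "pochhammer (1/2) j :: complex"
  have e1: "Gamma (of_real (1 + 2 * real j)) = (4 ^ j * ?H * fact j :: complex)"
  proof -
    have "Gamma (of_real (1 + 2 * real j)) = (fact (2 * j) :: complex)"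
      using Gamma_fact[of "2 * j", where 'a = complex] by simp
    then show ?thesis by (simp add: fact_double power_mult)
  qed
  have e2: "rGamma ((1 + of_real (1 + 2 * real j)) / 2) = (1 / fact j :: complex)"
  proof -
    have "(1 + of_real (1 + 2 * real j)) / 2 = (1 + of_nat j :: complex)" by (simp add: field_simps)
    then have "rGamma ((1 + of_real (1 + 2 * real j)) / 2) = rGamma (1 + of_nat j :: complex)" by (simp only:)
    then show ?thesis by (simp only: rGamma_inverse_Gamma Gamma_fact inverse_eq_divide)
  qed
  have e3: "Gamma (- z - of_real (1 + 2 * real j)) * Gamma (z + 1) = ?p / (2 * sin x * cos x) / ?P"
  proof -
    \<comment> \<open>Chosen so that \<open>1 - u\<close> is the argument of the other Gamma factor;
      the shift by an even integer leaves \<open>sin (pi * z)\<close> unchanged.\<close>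
    define u where "u = z + of_nat (2 * j + 2)"
    have u1: "1 - u = - z - of_real (1 + 2 * real j)" by (simp add: u_def)
    have u2: "sin (?p * u) = 2 * sin x * cos x"
      unfolding u_def sin_add_pi_of_nat sz2 by simp
    have "z + 1 + of_nat (2 * j + 1) = u" by (simp add: u_def)
    then have "Gamma u = ?P * Gamma (z + 1)"
      using pochhammer_Gamma[OF z1, of "2 * j + 1"] z1 by (simp add: Gamma_eq_zero_iff)
    moreover have "?P \<noteq> 0"
    proof
      assume "?P = 0"
      then obtain k where "z + 1 = - of_nat k" by (auto simp: pochhammer_eq_0_iff)
      with z1 show False by simp
    qed
    ultimately have "Gamma (z + 1) = Gamma u / ?P" by simp
    then have "Gamma (1 - u) * Gamma (z + 1) = Gamma u * Gamma (1 - u) / ?P" by simp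
    also have "Gamma u * Gamma (1 - u) = ?p / (2 * sin x * cos x)"
      unfolding Gamma_reflection_complex u2 ..
    finally show ?thesis unfolding u1 .
  qed
  have e4: "cos (?p * (of_real (1 + 2 * real j) + z) / 2) = - ((-1) ^ j * sin x)"
  proof -
    have "?p * (of_real (1 + 2 * real j) + z) / 2 = ?p * ((z / 2 + 1 / 2) + of_nat j)" by (simp add: field_simps)
    then have "cos (?p * (of_real (1 + 2 * real j) + z) / 2) = (-1) ^ j * cos (?p * (z / 2 + 1 / 2))"
      by (simp only: cos_add_pi_of_nat)
    also have "?p * (z / 2 + 1 / 2) = x + of_real (pi / 2)" by (simp add: x_def field_simps)
    also have "cos (x + of_real (pi / 2)) = - sin x" unfolding cos_add cos_of_real sin_of_real by simp
    finally show ?thesis by simp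
  qed
  have e5: "rGamma (1 - of_real (1 + 2 * real j) / 2) = (-1) ^ j * ?H * of_real (sqrt pi) / ?p"
  proof -
    have h: "(1/2 :: complex) \<notin> \<int>\<^sub>\<le>\<^sub>0" "(1/2 + of_nat j :: complex) \<notin> \<int>\<^sub>\<le>\<^sub>0"
      by (auto elim!: nonpos_Ints_cases' simp: complex_eq_iff)
    have G: "Gamma (1/2 + of_nat j) = ?H * complex_of_real (sqrt pi)"
      using pochhammer_Gamma[OF h(1), of j] h by (simp add: Gamma_eq_zero_iff Gamma_one_half_complex)
    have e: "1 - of_real (1 + 2 * real j) / 2 = 1 - (1/2 + of_nat j :: complex)" by (simp add: field_simps)
    have sh: "sin (?p * (1/2 + of_nat j)) = (-1) ^ j"
    proof -
      have "?p * (1/2) = of_real (pi / 2)" by simp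
      then have "sin (?p * (1/2)) = 1" by (simp only: sin_of_real sin_pi_half of_real_1)
      then show ?thesis unfolding sin_add_pi_of_nat by simp
    qed
    have "rGamma (1/2 + of_nat j) * rGamma (1 - (1/2 + of_nat j)) = (-1) ^ j / ?p"
      unfolding rGamma_reflection_complex sh ..
    then have "Gamma (1/2 + of_nat j) * rGamma (1/2 + of_nat j) * rGamma (1 - (1/2 + of_nat j)) = Gamma (1/2 + of_nat j) * ((-1) ^ j / ?p)"
      by (simp only: mult.assoc)
    then show ?thesis unfolding e Gamma_mult_rGamma[OF h(2)] unfolding G by (simp add: mult_ac)
  qed
  have "Mellin_Legendre z (of_real (1 + 2 * real j))
     = - (2 / of_real (sqrt pi)) * (4 ^ j * ?H * fact j) * (?p / (2 * sin x * cos x) / ?P)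
        * (- ((-1) ^ j * sin x)) * sin x * (1 / fact j) * ((-1) ^ j * ?H * of_real (sqrt pi) / ?p)"
    unfolding Mellin_Legendre_def e1 e2 e4 e5 e3[symmetric] x_def[symmetric] by (simp only: mult.assoc)
  \<comment> \<open>The powers of pi cancel completely, and the sign from the cosine shift meets the
    one from the half-integer reciprocal Gamma.\<close>
  also have "\<dots> = ((-1) ^ j * (-1) ^ j) * (sin x / cos x) * 4 ^ j * ?H\<^sup>2 / ?P"
    using nz by (simp add: power2_eq_square)
  also have "(-1) ^ j * (-1) ^ j = (1::complex)" by (simp flip: power_mult_distrib)
  finally show ?thesis by (simp add: x_def tan_def)
qed

section \<open>From integrals over the circle to the arcsine density\<close>

lemma nn_integral_sin_quarter:
  fixes H :: "real \<Rightarrow> ennreal"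
  assumes [measurable]: "H \<in> borel_measurable borel"
  shows "(\<integral>\<^sup>+t. H (sin t) * indicator {0..pi/2} t \<partial>lborel)
    = ennreal (pi / 2) * (\<integral>\<^sup>+c. ennreal (indicator {0<..<1} c * (2 / pi / sqrt (1 - c\<^sup>2))) * H c \<partial>lborel)"
proof -
  let ?f = "\<lambda>c. ennreal (indicator {0<..<1} c * (1 / sqrt (1 - c\<^sup>2))) * H c"
  \<comment> \<open>Substitution \<open>c = sin t\<close>; the sine is used because it increases on
    the first quarter circle.\<close>
  have "(\<integral>\<^sup>+c. ?f c * indicator {sin 0..sin (pi/2)} c \<partial>lborel)
     = (\<integral>\<^sup>+t. ?f (sin t) * ennreal (cos t) * indicator {0..pi/2} t \<partial>lborel)"
    by (rule nn_integral_substitution_aux)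
       (auto intro!: derivative_eq_intros continuous_intros cos_ge_zero)
  also have "\<dots> = (\<integral>\<^sup>+t. H (sin t) * indicator {0..pi/2} t \<partial>lborel)"
  proof (rule nn_integral_cong_AE)
    have "AE t in lborel. t \<noteq> (0::real) \<and> t \<noteq> pi/2"
      using AE_lborel_singleton[of "0::real"] AE_lborel_singleton[of "pi/2"] by eventually_elim auto
    then show "AE t in lborel. ?f (sin t) * ennreal (cos t) * indicator {0..pi/2} t = H (sin t) * indicator {0..pi/2} t"
    proof eventually_elim
      case (elim t)
      show ?case
      proof (cases "t \<in> {0..pi/2}")
        case True
        then have t: "0 < t" "t < pi/2" using elim by auto
        have c: "cos t > 0" using t by (intro cos_gt_zero) auto
        have "0 < sin t" using t by (intro sin_gt_zero) auto
        moreover have "sin t < 1"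
        proof -
          have "sin t < sin (pi/2)" using t by (intro sin_monotone_2pi) auto
          then show ?thesis by simp
        qed
        moreover have "sqrt (1 - (sin t)\<^sup>2) = cos t" using c by (simp add: cos_squared_eq[symmetric])
        ultimately have "?f (sin t) = ennreal (1 / cos t) * H (sin t)" by simp
        moreover have "ennreal (1 / cos t) * ennreal (cos t) = 1"
          using c by (simp flip: ennreal_mult'')
        ultimately show ?thesis by (metis mult.assoc mult.commute mult.left_neutral)
      qed simp
    qed
  qed
  finally have "(\<integral>\<^sup>+t. H (sin t) * indicator {0..pi/2} t \<partial>lborel) = (\<integral>\<^sup>+c. ?f c * indicator {sin 0..sin (pi/2)} c \<partial>lborel)" ..
  also have "\<dots> = (\<integral>\<^sup>+c. ennreal (pi / 2) * (ennreal (indicator {0<..<1} c * (2 / pi / sqrt (1 - c\<^sup>2))) * H c) \<partial>lborel)"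
  proof (rule nn_integral_cong)
    fix c :: real
    have "1 / sqrt (1 - c\<^sup>2) = pi / 2 * (2 / pi / sqrt (1 - c\<^sup>2))" by simp
    then have "ennreal (1 / sqrt (1 - c\<^sup>2)) = ennreal (pi / 2) * ennreal (2 / pi / sqrt (1 - c\<^sup>2))"
      by (simp only: ennreal_mult' pi_half_ge_zero)
    then show "?f c * indicator {sin 0..sin (pi/2)} c = ennreal (pi / 2) * (ennreal (indicator {0<..<1} c * (2 / pi / sqrt (1 - c\<^sup>2))) * H c)"
      by (cases "c \<in> {0<..<1}") (simp_all add: mult.assoc)
  qed
  also have "\<dots> = ennreal (pi / 2) * (\<integral>\<^sup>+c. ennreal (indicator {0<..<1} c * (2 / pi / sqrt (1 - c\<^sup>2))) * H c \<partial>lborel)"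
    by (rule nn_integral_cmult) simp
  finally show ?thesis .
qed

text \<open>Affine changes of variable carry the four quarters of the circle to
  \<open>[0, pi/2]\<close>: two of them give \<open>H (sin t)\<close> and two give
  \<open>H (- sin t)\<close>.\<close>

lemma nn_integral_cos_circle:
  fixes H :: "real \<Rightarrow> ennreal"
  assumes [measurable]: "H \<in> borel_measurable borel"
  shows "(\<integral>\<^sup>+t. H (cos t) * indicator {0..2*pi} t \<partial>lborel)
    = ennreal (2 * pi) * (\<integral>\<^sup>+c. ennreal (indicator {0<..<1} c * (2 / pi / sqrt (1 - c\<^sup>2))) * ((H c + H (- c)) * ennreal (1 / 2)) \<partial>lborel)"
proof -
  let ?I = "\<lambda>a b. \<integral>\<^sup>+t. H (cos t) * indicator {a..b} t \<partial>lborel"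
  let ?d = "\<lambda>c. ennreal (indicator {0<..<1} c * (2 / pi / sqrt (1 - c\<^sup>2)))"
  let ?P = "\<integral>\<^sup>+t. H (sin t) * indicator {0..pi/2} t \<partial>lborel" and ?N = "\<integral>\<^sup>+t. H (- sin t) * indicator {0..pi/2} t \<partial>lborel"
  have c3: "cos (3 * pi / 2) = 0" and s3: "sin (3 * pi / 2) = - 1"
    using cos_3over2_pi sin_3over2_pi by (simp_all add: field_simps)
  have "(\<integral>\<^sup>+t. H (cos t) * indicator {0..2*pi} t \<partial>lborel)
     = (\<integral>\<^sup>+t. H (cos t) * indicator {0..pi/2} t + (H (cos t) * indicator {pi/2..pi} t
         + (H (cos t) * indicator {pi..3*pi/2} t + H (cos t) * indicator {3*pi/2..2*pi} t)) \<partial>lborel)"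
  proof (rule nn_integral_cong_AE)
    have "AE t in lborel. t \<noteq> pi/2 \<and> t \<noteq> pi \<and> t \<noteq> 3*pi/2"
      using AE_lborel_singleton[of "pi"] AE_lborel_singleton[of "pi/2"] AE_lborel_singleton[of "3*pi/2"] by eventually_elim auto
    then show "AE t in lborel. H (cos t) * indicator {0..2*pi} t =
        H (cos t) * indicator {0..pi/2} t + (H (cos t) * indicator {pi/2..pi} t
         + (H (cos t) * indicator {pi..3*pi/2} t + H (cos t) * indicator {3*pi/2..2*pi} t))"
      by eventually_elim (auto simp: indicator_def)
  qed
  also have "\<dots> = ?I 0 (pi/2) + (?I (pi/2) pi + (?I pi (3*pi/2) + ?I (3*pi/2) (2*pi)))"
    by (simp add: nn_integral_add)
  also have "?I 0 (pi/2) = ?P"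
    by (subst nn_integral_real_affine[where c = "-1" and t = "pi/2"])
       (auto intro!: nn_integral_cong simp: indicator_def cos_diff)
  also have "?I (pi/2) pi = ?N"
    by (subst nn_integral_real_affine[where c = 1 and t = "pi/2"])
       (auto intro!: nn_integral_cong simp: indicator_def cos_add)
  also have "?I pi (3*pi/2) = ?N"
    by (subst nn_integral_real_affine[where c = "-1" and t = "3*pi/2"])
       (auto intro!: nn_integral_cong simp: indicator_def cos_diff c3 s3)
  also have "?I (3*pi/2) (2*pi) = ?P"
    by (subst nn_integral_real_affine[where c = 1 and t = "3*pi/2"])
       (auto intro!: nn_integral_cong simp: indicator_def cos_add c3 s3)
  also have "?P + (?N + (?N + ?P)) = 2 * (?P + ?N)"
    by (simp add: algebra_simps flip: mult_2)
  also have "?P = ennreal (pi / 2) * (\<integral>\<^sup>+c. ?d c * H c \<partial>lborel)"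
    by (rule nn_integral_sin_quarter) simp
  also have "?N = ennreal (pi / 2) * (\<integral>\<^sup>+c. ?d c * H (- c) \<partial>lborel)"
    by (rule nn_integral_sin_quarter) simp
  also have "2 * (ennreal (pi / 2) * (\<integral>\<^sup>+c. ?d c * H c \<partial>lborel) + ennreal (pi / 2) * (\<integral>\<^sup>+c. ?d c * H (- c) \<partial>lborel))
     = ennreal pi * (\<integral>\<^sup>+c. ?d c * (H c + H (- c)) \<partial>lborel)"
  proof -
    have "(\<integral>\<^sup>+c. ?d c * (H c + H (- c)) \<partial>lborel) = (\<integral>\<^sup>+c. ?d c * H c \<partial>lborel) + (\<integral>\<^sup>+c. ?d c * H (- c) \<partial>lborel)"
      unfolding distrib_left by (rule nn_integral_add) simp_all
    moreover have "ennreal pi = 2 * ennreal (pi / 2)"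
      using ennreal_mult'[of 2 "pi / 2"] by simp
    ultimately show ?thesis by (simp add: distrib_left mult.assoc)
  qed
  also have "\<dots> = ennreal (2 * pi) * (\<integral>\<^sup>+c. ?d c * ((H c + H (- c)) * ennreal (1 / 2)) \<partial>lborel)"
  proof -
    have "(\<integral>\<^sup>+c. ?d c * ((H c + H (- c)) * ennreal (1 / 2)) \<partial>lborel) = (\<integral>\<^sup>+c. ?d c * (H c + H (- c)) \<partial>lborel) * ennreal (1 / 2)"
      unfolding mult.assoc[symmetric] by (rule nn_integral_multc) simp
    moreover have "ennreal pi = ennreal (2 * pi) * ennreal (1 / 2)"
      using ennreal_mult'[of "2 * pi" "1 / 2"] by simp
    ultimately show ?thesis by (simp add: mult_ac)
  qed
  finally show ?thesis .
qed

section \<open>The torus integral at real parameters\<close>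

definition torus_form :: "real \<Rightarrow> real \<times> real \<Rightarrow> real" where
  "torus_form k t = \<bar>k + 4 * cos (fst t) * cos (snd t)\<bar>"

lemma measurable_torus_form [measurable]: "torus_form k \<in> borel_measurable borel"
  unfolding torus_form_def by (intro borel_measurable_continuous_onI continuous_intros)

abbreviation torus_square :: "(real \<times> real) set" where
  "torus_square \<equiv> {0..2*pi} \<times> {0..2*pi}"

lemma measurable_torus_square [measurable]: "torus_square \<in> sets borel"
  by (intro borel_closed closed_Times) auto

text \<open>The factors \<open>\<i> * cis t\<close> cancel the divisions by \<open>x1\<close> and
  \<open>x2\<close> up to \<open>\<i>\<^sup>2 = -1\<close>, and this sign is absorbed by the one in
  \<open>(2 * pi * \<i>)\<^sup>2\<close>.\<close>

lemma W2_altdef: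
  "W2 k s = 1 / (2 * of_real pi)\<^sup>2 * (LINT t : torus_square | lborel. of_real (torus_form k t) powr s)"
proof -
  have n: "cmod (of_real k + (cis a + inverse (cis a)) * (cis b + inverse (cis b))) = torus_form k (a, b)" for a b
  proof -
    have "cis a + inverse (cis a) = of_real (2 * cos a)" for a by (simp add: complex_eq_iff)
    then have "of_real k + (cis a + inverse (cis a)) * (cis b + inverse (cis b)) = complex_of_real (k + 4 * cos a * cos b)"
      by simp
    then show ?thesis by (simp only: norm_of_real torus_form_def fst_conv snd_conv)
  qed
  have e: "X / cis a / cis b * (\<i> * cis a) * (\<i> * cis b) = - X" for X a b
    by (simp add: field_simps)
  have "torus_integral (\<lambda>x1 x2. of_real (cmod (of_real k + (x1 + inverse x1) * (x2 + inverse x2))) powr s / x1 / x2)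
    = (LINT t : torus_square | lborel. - (of_real (torus_form k t) powr s))"
    unfolding torus_integral_def set_lebesgue_integral_def
    by (intro Bochner_Integration.integral_cong refl) (simp only: n e prod.collapse)
  also have "\<dots> = - (LINT t : torus_square | lborel. of_real (torus_form k t) powr s)"
    unfolding set_lebesgue_integral_def by simp
  finally show ?thesis by (simp add: W2_def power_mult_distrib)
qed

text \<open>The circle formula is used once in each variable. The inner use symmetrises the kernel
  in the sign of \<open>d\<close>, which makes \<open>J\<close> even, so that the outer
  symmetrisation changes nothing.\<close>

lemma nn_integral_torus:
  "(\<integral>\<^sup>+t. ennreal (torus_form k t powr s) * indicator torus_square t \<partial>lborel)
    = ennreal ((2 * pi)\<^sup>2) * (\<integral>\<^sup>+c. ennreal (indicator {0<..<1} c * (2 / pi / sqrt (1 - c\<^sup>2)))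
        * (\<integral>\<^sup>+d. ennreal (indicator {0<..<1} d * (2 / pi / sqrt (1 - d\<^sup>2)))
          * ennreal ((\<bar>k + 4 * c * d\<bar> powr s + \<bar>k - 4 * c * d\<bar> powr s) / 2) \<partial>lborel) \<partial>lborel)"
proof -
  let ?d = "\<lambda>c. ennreal (indicator {0<..<1} c * (2 / pi / sqrt (1 - c\<^sup>2)))"
  define J where "J c = (\<integral>\<^sup>+d. ?d d * ennreal ((\<bar>k + 4 * c * d\<bar> powr s + \<bar>k - 4 * c * d\<bar> powr s) / 2) \<partial>lborel)" for c
  have [measurable]: "J \<in> borel_measurable borel" unfolding J_def by measurable
  have J_even: "J (- c) = J c" for c unfolding J_def by (simp add: add.commute)
  have half: "(ennreal p + ennreal q) * ennreal (1 / 2) = ennreal ((p + q) / 2)" if "p \<ge> 0" "q \<ge> 0" for p q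
  proof -
    have "ennreal ((p + q) * (1 / 2)) = ennreal (p + q) * ennreal (1 / 2)"
      by (rule ennreal_mult) (use that in auto)
    then show ?thesis using that by (simp add: ennreal_plus)
  qed
  have inner: "(\<integral>\<^sup>+b. ennreal (\<bar>k + 4 * c * cos b\<bar> powr s) * indicator {0..2*pi} b \<partial>lborel) = ennreal (2 * pi) * J c" for c
    unfolding J_def by (subst nn_integral_cos_circle[of "\<lambda>v. ennreal (\<bar>k + 4 * c * v\<bar> powr s)"], simp)
      (simp only: half powr_ge_zero mult_minus_right add_uminus_conv_diff)
  have "(\<integral>\<^sup>+t. ennreal (torus_form k t powr s) * indicator torus_square t \<partial>lborel)
     = (\<integral>\<^sup>+t. ennreal (torus_form k t powr s) * indicator torus_square t \<partial>(lborel \<Otimes>\<^sub>M lborel))"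
    by (simp only: lborel_prod)
  also have "\<dots> = (\<integral>\<^sup>+a. \<integral>\<^sup>+b. ennreal (torus_form k (a, b) powr s) * indicator torus_square (a, b) \<partial>lborel \<partial>lborel)"
    by (rule lborel.nn_integral_fst[symmetric]) (simp add: lborel_prod)
  also have "\<dots> = (\<integral>\<^sup>+a. ennreal (2 * pi) * J (cos a) * indicator {0..2*pi} a \<partial>lborel)"
  proof (rule nn_integral_cong)
    fix a :: real
    have "(\<integral>\<^sup>+b. ennreal (torus_form k (a, b) powr s) * indicator torus_square (a, b) \<partial>lborel)
       = (\<integral>\<^sup>+b. ennreal (\<bar>k + 4 * cos a * cos b\<bar> powr s) * indicator {0..2*pi} b * indicator {0..2*pi} a \<partial>lborel)"
      by (intro nn_integral_cong) (simp add: torus_form_def indicator_times mult_ac)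
    also have "\<dots> = (\<integral>\<^sup>+b. ennreal (\<bar>k + 4 * cos a * cos b\<bar> powr s) * indicator {0..2*pi} b \<partial>lborel) * indicator {0..2*pi} a"
      by (rule nn_integral_multc) simp
    finally show "(\<integral>\<^sup>+b. ennreal (torus_form k (a, b) powr s) * indicator torus_square (a, b) \<partial>lborel)
       = ennreal (2 * pi) * J (cos a) * indicator {0..2*pi} a"
      unfolding inner .
  qed
  also have "\<dots> = ennreal (2 * pi) * (\<integral>\<^sup>+a. J (cos a) * indicator {0..2*pi} a \<partial>lborel)"
    by (subst nn_integral_cmult[symmetric]) (simp_all add: mult.assoc)
  also have "(\<integral>\<^sup>+a. J (cos a) * indicator {0..2*pi} a \<partial>lborel)
     = ennreal (2 * pi) * (\<integral>\<^sup>+c. ?d c * ((J c + J (- c)) * ennreal (1 / 2)) \<partial>lborel)"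
    by (rule nn_integral_cos_circle) simp
  also have "(\<lambda>c. (J c + J (- c)) * ennreal (1 / 2)) = J"
  proof
    fix c
    have "(2::ennreal) * ennreal (1 / 2) = 1"
      using ennreal_mult'[of 2 "1 / 2"] by simp
    then have "J c * (2 * ennreal (1 / 2)) = J c" by simp
    then show "(J c + J (- c)) * ennreal (1 / 2) = J c"
      unfolding J_even mult_2_right[symmetric] by (simp only: mult.assoc)
  qed
  also have "ennreal (2 * pi) * (ennreal (2 * pi) * (\<integral>\<^sup>+c. ?d c * J c \<partial>lborel)) = ennreal ((2 * pi)\<^sup>2) * (\<integral>\<^sup>+c. ?d c * J c \<partial>lborel)"
    by (simp only: power2_eq_square ennreal_mult' mult.assoc[symmetric] mult_nonneg_nonneg pi_ge_zero zero_le_numeral)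
  finally show ?thesis unfolding J_def .
qed

text \<open>Taking \<open>\<bar>k\<bar>\<close> out of the absolute value leaves the even kernel at
  \<open>4 / \<bar>k\<bar> * c * d\<close>; the two remaining integrals are exactly two arcsine
  means.\<close>

lemma nn_integral_torus_nonzero:
  assumes "k \<noteq> 0"
  shows "(\<integral>\<^sup>+t. ennreal (torus_form k t powr s) * indicator torus_square t \<partial>lborel)
    = ennreal ((2 * pi)\<^sup>2 * \<bar>k\<bar> powr s) * arcsine_mean (arcsine_mean (binomial_mean s)) (4 / \<bar>k\<bar>)"
proof -
  let ?d = "\<lambda>c. ennreal (indicator {0<..<1} c * (2 / pi / sqrt (1 - c\<^sup>2)))"
  have [measurable]: "binomial_mean s \<in> borel_measurable borel" unfolding binomial_mean_def by measurable
  have *: "ennreal ((\<bar>k + 4 * c * d\<bar> powr s + \<bar>k - 4 * c * d\<bar> powr s) / 2)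
      = ennreal (\<bar>k\<bar> powr s) * binomial_mean s (4 / \<bar>k\<bar> * c * d)" for c d
  proof -
    let ?y = "4 / \<bar>k\<bar> * c * d"
    have "\<bar>k\<bar> * \<bar>1 + ?y\<bar> = \<bar>\<bar>k\<bar> + 4 * c * d\<bar>" "\<bar>k\<bar> * \<bar>1 - ?y\<bar> = \<bar>\<bar>k\<bar> - 4 * c * d\<bar>"
    proof -
      have "\<bar>k\<bar> * (1 + ?y) = \<bar>k\<bar> + 4 * c * d" "\<bar>k\<bar> * (1 - ?y) = \<bar>k\<bar> - 4 * c * d"
        using assms by (simp_all add: distrib_left right_diff_distrib)
      then show "\<bar>k\<bar> * \<bar>1 + ?y\<bar> = \<bar>\<bar>k\<bar> + 4 * c * d\<bar>" "\<bar>k\<bar> * \<bar>1 - ?y\<bar> = \<bar>\<bar>k\<bar> - 4 * c * d\<bar>"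
        by (metis abs_mult abs_abs)+
    qed
    then have "\<bar>k\<bar> powr s * \<bar>1 + ?y\<bar> powr s = \<bar>\<bar>k\<bar> + 4 * c * d\<bar> powr s"
      "\<bar>k\<bar> powr s * \<bar>1 - ?y\<bar> powr s = \<bar>\<bar>k\<bar> - 4 * c * d\<bar> powr s"
      by (simp_all flip: powr_mult)
    then have "\<bar>k\<bar> powr s * ((\<bar>1 + ?y\<bar> powr s + \<bar>1 - ?y\<bar> powr s) / 2)
      = (\<bar>\<bar>k\<bar> + 4 * c * d\<bar> powr s + \<bar>\<bar>k\<bar> - 4 * c * d\<bar> powr s) / 2"
      by (simp only: times_divide_eq_right distrib_left)
    \<comment> \<open>A negative \<open>k\<close> merely interchanges the two summands.\<close>
    also have "\<dots> = (\<bar>k + 4 * c * d\<bar> powr s + \<bar>k - 4 * c * d\<bar> powr s) / 2"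
    proof (cases "k \<ge> 0")
      case False
      then have "\<bar>\<bar>k\<bar> + 4 * c * d\<bar> = \<bar>k - 4 * c * d\<bar>" "\<bar>\<bar>k\<bar> - 4 * c * d\<bar> = \<bar>k + 4 * c * d\<bar>" by auto
      then show ?thesis by simp
    qed simp
    finally show ?thesis
      unfolding binomial_mean_def by (simp only: ennreal_mult'[symmetric] powr_ge_zero)
  qed
  have "(\<integral>\<^sup>+d. ?d d * ennreal ((\<bar>k + 4 * c * d\<bar> powr s + \<bar>k - 4 * c * d\<bar> powr s) / 2) \<partial>lborel)
      = ennreal (\<bar>k\<bar> powr s) * arcsine_mean (binomial_mean s) (4 / \<bar>k\<bar> * c)" for c
    unfolding * arcsine_mean_def by (subst nn_integral_cmult[symmetric]) (simp_all add: mult_ac)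
  then have "(\<integral>\<^sup>+c. ?d c * (\<integral>\<^sup>+d. ?d d * ennreal ((\<bar>k + 4 * c * d\<bar> powr s + \<bar>k - 4 * c * d\<bar> powr s) / 2) \<partial>lborel) \<partial>lborel)
     = (\<integral>\<^sup>+c. ennreal (\<bar>k\<bar> powr s) * (?d c * arcsine_mean (binomial_mean s) (4 / \<bar>k\<bar> * c)) \<partial>lborel)"
    by (simp add: mult_ac)
  also have "\<dots> = ennreal (\<bar>k\<bar> powr s) * arcsine_mean (arcsine_mean (binomial_mean s)) (4 / \<bar>k\<bar>)"
    unfolding arcsine_mean_def[of "arcsine_mean _"] by (rule nn_integral_cmult) measurable
  finally show ?thesis
    unfolding nn_integral_torus by (simp add: ennreal_mult mult.assoc)
qed

text \<open>The scaling \<open>4 / \<bar>k\<bar>\<close> degenerates at \<open>k = 0\<close>, but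
  there the integrand is a product of powers of the two cosines, so the mean factorises.\<close>

lemma nn_integral_torus_zero:
  assumes "s > -1"
  shows "(\<integral>\<^sup>+t. ennreal (torus_form 0 t powr s) * indicator torus_square t \<partial>lborel)
    = ennreal ((2 * pi)\<^sup>2 * (4 powr s * (cos_moment s)\<^sup>2))"
proof -
  let ?d = "\<lambda>c. ennreal (indicator {0<..<1} c * (2 / pi / sqrt (1 - c\<^sup>2)))"
  have cm: "cos_moment s > 0" by (rule cos_moment_pos[OF assms])
  have inner: "?d c * (\<integral>\<^sup>+d. ?d d * ennreal ((\<bar>0 + 4 * c * d\<bar> powr s + \<bar>0 - 4 * c * d\<bar> powr s) / 2) \<partial>lborel)
     = ennreal (4 powr s * cos_moment s) * (?d c * ennreal (c powr s))" for c
  proof (cases "c \<in> {0<..<1}")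
    case True
    have "(\<integral>\<^sup>+d. ?d d * ennreal ((\<bar>0 + 4 * c * d\<bar> powr s + \<bar>0 - 4 * c * d\<bar> powr s) / 2) \<partial>lborel)
      = (\<integral>\<^sup>+d. ennreal (4 powr s * c powr s) * (?d d * ennreal (d powr s)) \<partial>lborel)"
    proof (rule nn_integral_cong)
      fix d :: real
      show "?d d * ennreal ((\<bar>0 + 4 * c * d\<bar> powr s + \<bar>0 - 4 * c * d\<bar> powr s) / 2)
        = ennreal (4 powr s * c powr s) * (?d d * ennreal (d powr s))"
      proof (cases "d \<in> {0<..<1}")
        case d: True
        have "(\<bar>0 + 4 * c * d\<bar> powr s + \<bar>0 - 4 * c * d\<bar> powr s) / 2 = 4 powr s * c powr s * d powr s"
          using True d by (simp add: abs_mult powr_mult)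
        then show ?thesis by (simp only: ennreal_mult powr_ge_zero mult_nonneg_nonneg mult_ac)
      qed simp
    qed
    also have "\<dots> = ennreal (4 powr s * c powr s) * ennreal (cos_moment s)"
      by (subst nn_integral_cmult, simp, subst nn_integral_arcsine_density_powr[OF assms], rule refl)
    finally show ?thesis using cm by (simp add: ennreal_mult mult_ac)
  qed simp
  have "(\<integral>\<^sup>+c. ?d c * (\<integral>\<^sup>+d. ?d d * ennreal ((\<bar>0 + 4 * c * d\<bar> powr s + \<bar>0 - 4 * c * d\<bar> powr s) / 2) \<partial>lborel) \<partial>lborel)
     = ennreal (4 powr s * cos_moment s) * ennreal (cos_moment s)"
    unfolding inner by (subst nn_integral_cmult, simp, subst nn_integral_arcsine_density_powr[OF assms], rule refl)
  then show ?thesis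
    unfolding nn_integral_torus using cm by (simp add: power2_eq_square mult_ac flip: ennreal_mult)
qed

lemma W2_of_real:
  assumes "(\<integral>\<^sup>+t. ennreal (torus_form k t powr s) * indicator torus_square t \<partial>lborel) = ennreal ((2 * pi)\<^sup>2 * v)" "v \<ge> 0"
  shows "W2 k (of_real s) = of_real v"
proof -
  have "(LINT t : torus_square | lborel. of_real (torus_form k t) powr complex_of_real s)
     = (LINT t | lborel. complex_of_real (indicator torus_square t * torus_form k t powr s))"
    unfolding set_lebesgue_integral_def
    by (intro Bochner_Integration.integral_cong refl) (simp add: torus_form_def powr_of_real scaleR_conv_of_real)
  also have "\<dots> = complex_of_real (LINT t | lborel. indicator torus_square t * torus_form k t powr s)"
    by (rule integral_complex_of_real)
  also have "(LINT t | lborel. indicator torus_square t * torus_form k t powr s)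
     = enn2real (\<integral>\<^sup>+t. ennreal (indicator torus_square t * torus_form k t powr s) \<partial>lborel)"
    by (rule integral_eq_nn_integral) (auto simp: indicator_def)
  also have "(\<integral>\<^sup>+t. ennreal (indicator torus_square t * torus_form k t powr s) \<partial>lborel)
     = (\<integral>\<^sup>+t. ennreal (torus_form k t powr s) * indicator torus_square t \<partial>lborel)"
    by (intro nn_integral_cong) (auto simp: indicator_def)
  also have "enn2real \<dots> = (2 * pi)\<^sup>2 * v"
    unfolding assms(1) using assms(2) by simp
  finally show ?thesis unfolding W2_altdef by (simp add: power2_eq_square)
qed

section \<open>Holomorphy in the parameter\<close>

definition hypergeom_term :: "complex \<Rightarrow> complex \<Rightarrow> complex \<Rightarrow> complex \<Rightarrow> complex \<Rightarrow> complex \<Rightarrow> nat \<Rightarrow> complex" where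
  "hypergeom_term a1 a2 a3 b1 b2 z n =
     (pochhammer a1 n * pochhammer a2 n * pochhammer a3 n) /
           (pochhammer b1 n * pochhammer b2 n) * (z ^ n / fact n)"

lemma hypergeom_3F2_altdef: "hypergeom_3F2 a1 a2 a3 b1 b2 z = (\<Sum>n. hypergeom_term a1 a2 a3 b1 b2 z n)"
  by (simp add: hypergeom_3F2_def hypergeom_term_def)

lemma hypergeom_term_Suc:
  "hypergeom_term a1 a2 a3 b1 b2 z (Suc n) = hypergeom_term a1 a2 a3 b1 b2 z n *
     ((a1 + of_nat n) * (a2 + of_nat n) * (a3 + of_nat n) * z / ((b1 + of_nat n) * (b2 + of_nat n) * of_nat (Suc n)))"
  by (simp add: hypergeom_term_def pochhammer_rec' mult_ac del: of_nat_Suc)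

lemma summable_half_geometric:
  assumes "cmod z < 1"
  shows "summable (\<lambda>n. ((1 + cmod z) / 2) ^ n)"
proof (rule summable_geometric)
  show "norm ((1 + cmod z) / 2) < 1"
    using assms by (simp add: abs_of_nonneg add_nonneg_nonneg)
qed

lemma pochhammer_nonzero: "b \<notin> \<int>\<^sub>\<le>\<^sub>0 \<Longrightarrow> pochhammer b n \<noteq> (0::complex)"
  by (auto dest: pochhammer_eq_0_imp_nonpos_Int)

text \<open>Numerator and denominator are cubic in \<open>n\<close> with equal leading coefficients,
  so the quotient tends to \<open>q\<close>, and \<open>(1 + q) / 2\<close> lies strictly between
  \<open>q\<close> and 1.\<close>

lemma hypergeom_ratio_eventually_le:
  assumes "0 \<le> q" "q < (1::real)"
  shows "\<exists>N. real N > R \<and> (\<forall>n\<ge>N. (real n + R) ^ 3 * q / ((real n - R)\<^sup>2 * (real n + 1)) \<le> (1 + q) / 2)"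
proof -
  have "((\<lambda>n. (real n + R) ^ 3 / ((real n - R)\<^sup>2 * (real n + 1))) \<longlongrightarrow> 1) sequentially"
    by real_asymp
  then have "((\<lambda>n. (real n + R) ^ 3 / ((real n - R)\<^sup>2 * (real n + 1)) * q) \<longlongrightarrow> 1 * q) sequentially"
    by (intro tendsto_mult tendsto_const)
  then have "\<forall>\<^sub>F n in sequentially. (real n + R) ^ 3 / ((real n - R)\<^sup>2 * (real n + 1)) * q < (1 + q) / 2"
    by (rule order_tendstoD) (use assms in auto)
  moreover have "\<forall>\<^sub>F n in sequentially. real n > R"
    using eventually_gt_at_top[of "nat \<lceil>R\<rceil>"] by eventually_elim linarith
  ultimately have "\<forall>\<^sub>F n in sequentially. real n > R \<and> (real n + R) ^ 3 / ((real n - R)\<^sup>2 * (real n + 1)) * q < (1 + q) / 2"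
    by eventually_elim simp
  then obtain N where N: "\<And>n. n \<ge> N \<Longrightarrow> real n > R \<and> (real n + R) ^ 3 / ((real n - R)\<^sup>2 * (real n + 1)) * q < (1 + q) / 2"
    unfolding eventually_sequentially by blast
  have "(real n + R) ^ 3 * q / ((real n - R)\<^sup>2 * (real n + 1)) \<le> (1 + q) / 2" if "n \<ge> N" for n
    using N[OF that] by (simp only: times_divide_eq_left less_imp_le)
  then show ?thesis using N[of N] by blast
qed

text \<open>On a compact neighbourhood the ratio of consecutive terms is eventually below \<open>(1 + |z|) / 2\<close>,
  uniformly in the parameters.\<close>

lemma hypergeom_term_uniform_bound:
  assumes K: "compact K" and q: "cmod z < 1"
    and cont: "continuous_on K a1" "continuous_on K a2" "continuous_on K a3" "continuous_on K b1" "continuous_on K b2"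
    and nonpole: "\<And>s. s \<in> K \<Longrightarrow> b1 s \<notin> \<int>\<^sub>\<le>\<^sub>0" "\<And>s. s \<in> K \<Longrightarrow> b2 s \<notin> \<int>\<^sub>\<le>\<^sub>0"
  shows "\<exists>N C. \<forall>n\<ge>N. \<forall>s\<in>K. cmod (hypergeom_term (a1 s) (a2 s) (a3 s) (b1 s) (b2 s) z n) \<le> C * ((1 + cmod z) / 2) ^ n"
proof -
  let ?t = "\<lambda>n s. hypergeom_term (a1 s) (a2 s) (a3 s) (b1 s) (b2 s) z n"
  define r where "r = (1 + cmod z) / 2"
  have r: "0 < r" using norm_ge_zero[of z] by (simp add: r_def add_pos_nonneg)
  have bd: "\<exists>R. \<forall>s\<in>K. cmod (f s) \<le> R" if "continuous_on K f" for f
    using compact_imp_bounded[OF compact_continuous_image[OF that K]] by (auto simp: bounded_iff)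
  obtain R1 R2 R3 R4 R5 where R': "\<forall>s\<in>K. cmod (a1 s) \<le> R1" "\<forall>s\<in>K. cmod (a2 s) \<le> R2" "\<forall>s\<in>K. cmod (a3 s) \<le> R3"
      "\<forall>s\<in>K. cmod (b1 s) \<le> R4" "\<forall>s\<in>K. cmod (b2 s) \<le> R5"
    using bd[OF cont(1)] bd[OF cont(2)] bd[OF cont(3)] bd[OF cont(4)] bd[OF cont(5)] by blast
  define R where "R = max 0 (max R1 (max R2 (max R3 (max R4 R5))))"
  have R: "cmod (a1 s) \<le> R" "cmod (a2 s) \<le> R" "cmod (a3 s) \<le> R" "cmod (b1 s) \<le> R" "cmod (b2 s) \<le> R" "R \<ge> 0" if "s \<in> K" for s
    using R' that by (force simp: R_def le_max_iff_disj)+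
  obtain N :: nat where N: "real N > R" "\<And>n. n \<ge> N \<Longrightarrow> (real n + R) ^ 3 * cmod z / ((real n - R)\<^sup>2 * (real n + 1)) \<le> r"
    using hypergeom_ratio_eventually_le[of "cmod z" R] q unfolding r_def by auto
  have step: "cmod (?t (Suc n) s) \<le> cmod (?t n s) * r" if n: "n \<ge> N" and s: "s \<in> K" for n s
  proof -
    have up: "cmod (x + of_nat n) \<le> real n + R" if "cmod x \<le> R" for x
      using norm_triangle_ineq[of x "of_nat n"] that by simp
    have lo: "real n - R \<le> cmod (x + of_nat n)" if "cmod x \<le> R" for x
      using norm_diff_ineq[of "of_nat n" x] that by (simp add: add.commute)
    have nR: "real n - R > 0" using N(1) n by linarith
    have "cmod ((a1 s + of_nat n) * (a2 s + of_nat n) * (a3 s + of_nat n) * z / ((b1 s + of_nat n) * (b2 s + of_nat n) * of_nat (Suc n)))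
      = cmod (a1 s + of_nat n) * cmod (a2 s + of_nat n) * cmod (a3 s + of_nat n) * cmod z
         / (cmod (b1 s + of_nat n) * cmod (b2 s + of_nat n) * real (Suc n))"
      by (simp only: norm_mult norm_divide norm_of_nat)
    also have "\<dots> \<le> (real n + R) * (real n + R) * (real n + R) * cmod z / ((real n - R) * (real n - R) * real (Suc n))"
      using R[OF s] nR by (intro frac_le mult_mono mult_nonneg_nonneg mult_pos_pos up lo) auto
    also have "\<dots> = (real n + R) ^ 3 * cmod z / ((real n - R)\<^sup>2 * (real n + 1))"
      by (simp add: power2_eq_square power3_eq_cube)
    also have "\<dots> \<le> r" by (rule N(2)[OF n])
    finally show ?thesis
      unfolding hypergeom_term_Suc norm_mult[of "?t n s"] by (intro mult_left_mono) auto
  qed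
  \<comment> \<open>Only the term at the starting index \<open>N\<close> needs a bound, which
    compactness supplies; the ratio estimate carries it to all later terms.\<close>
  have "continuous_on K (?t N)"
    unfolding hypergeom_term_def
    by (intro continuous_intros cont) (auto simp: pochhammer_nonzero nonpole)
  then obtain C where C: "\<And>s. s \<in> K \<Longrightarrow> cmod (?t N s) \<le> C"
    using bd by blast
  have tail: "cmod (?t (N + i) s) \<le> C * r ^ i" if s: "s \<in> K" for i s
  proof (induction i)
    case (Suc i)
    have "cmod (?t (N + Suc i) s) \<le> cmod (?t (N + i) s) * r" using step[of "N + i" s] s by simp
    also have "\<dots> \<le> C * r ^ i * r" using Suc r by (intro mult_right_mono) auto
    finally show ?case by (simp add: mult_ac)
  qed (use C s in simp)
  have "cmod (?t n s) \<le> C / r ^ N * r ^ n" if "n \<ge> N" "s \<in> K" for n s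
  proof -
    define i where "i = n - N"
    have i: "n = N + i" using that(1) by (simp add: i_def)
    have "cmod (?t n s) \<le> C * r ^ i" unfolding i by (rule tail[OF that(2)])
    also have "\<dots> = C / r ^ N * r ^ n" unfolding i power_add using r by simp
    finally show ?thesis .
  qed
  then show ?thesis unfolding r_def by blast
qed

lemma summable_hypergeom_term:
  assumes "cmod z < 1" "b1 \<notin> \<int>\<^sub>\<le>\<^sub>0" "b2 \<notin> \<int>\<^sub>\<le>\<^sub>0"
  shows "summable (hypergeom_term a1 a2 a3 b1 b2 z)"
proof -
  obtain N C where *: "\<forall>n\<ge>N. cmod (hypergeom_term a1 a2 a3 b1 b2 z n) \<le> C * ((1 + cmod z) / 2) ^ n"
    using hypergeom_term_uniform_bound[of "{0}" z "\<lambda>_. a1" "\<lambda>_. a2" "\<lambda>_. a3" "\<lambda>_. b1" "\<lambda>_. b2"] assms by auto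
  have "summable (\<lambda>n. C * ((1 + cmod z) / 2) ^ n)"
    using assms by (intro summable_mult summable_half_geometric)
  then show ?thesis by (rule summable_comparison_test') (use * in auto)
qed

text \<open>Weierstrass: each term is holomorphic since the lower parameters avoid the poles, and on
  a closed disc inside \<open>S\<close> the terms have a common geometric majorant.\<close>

lemma holomorphic_hypergeom_3F2:
  assumes S: "open S" and q: "cmod z < 1"
    and hol: "a1 holomorphic_on S" "a2 holomorphic_on S" "a3 holomorphic_on S" "b1 holomorphic_on S" "b2 holomorphic_on S"
    and nonpole: "\<And>s. s \<in> S \<Longrightarrow> b1 s \<notin> \<int>\<^sub>\<le>\<^sub>0" "\<And>s. s \<in> S \<Longrightarrow> b2 s \<notin> \<int>\<^sub>\<le>\<^sub>0"
  shows "(\<lambda>s. hypergeom_3F2 (a1 s) (a2 s) (a3 s) (b1 s) (b2 s) z) holomorphic_on S"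
proof -
  let ?t = "\<lambda>n s. hypergeom_term (a1 s) (a2 s) (a3 s) (b1 s) (b2 s) z n"
  have hol_p: "(\<lambda>s. pochhammer (f s) n) holomorphic_on S" if "f holomorphic_on S" for f :: "complex \<Rightarrow> complex" and n
    unfolding pochhammer_prod by (intro holomorphic_intros that)
  have hol_t: "?t n holomorphic_on S" for n
    unfolding hypergeom_term_def
    by (intro holomorphic_intros hol_p hol) (auto simp: pochhammer_nonzero nonpole)
  obtain g where g: "\<forall>x \<in> S. ((\<lambda>n. ?t n x) sums g x) \<and> g field_differentiable (at x)"
  proof (rule series_differentiable_comparison_complex[OF S, of ?t])
    show "?t n field_differentiable at x" if "x \<in> S" for n x
      using hol_t[of n] that S by (auto simp: holomorphic_on_open field_differentiable_def)
    show "\<exists>d h. 0 < d \<and> summable h \<and> range h \<subseteq> \<real>\<^sub>\<ge>\<^sub>0 \<and>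
        (\<forall>\<^sub>F n in sequentially. \<forall>y\<in>ball x d \<inter> S. cmod (?t n y) \<le> cmod (h n))" if "x \<in> S" for x
    proof -
      obtain d where d: "d > 0" "cball x d \<subseteq> S" using S \<open>x \<in> S\<close> by (metis open_contains_cball)
      have cont: "continuous_on (cball x d) f" if "f holomorphic_on S" for f :: "complex \<Rightarrow> complex"
        using that d by (meson holomorphic_on_imp_continuous_on holomorphic_on_subset)
      obtain N C where *: "\<forall>n\<ge>N. \<forall>s\<in>cball x d. cmod (?t n s) \<le> C * ((1 + cmod z) / 2) ^ n"
        using hypergeom_term_uniform_bound[OF compact_cball q cont[OF hol(1)] cont[OF hol(2)] cont[OF hol(3)]
            cont[OF hol(4)] cont[OF hol(5)]] nonpole d(2) by (metis subsetD)
      show ?thesis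
      proof (intro exI conjI)
        let ?h = "\<lambda>n. complex_of_real (\<bar>C\<bar> * ((1 + cmod z) / 2) ^ n)"
        have "summable (\<lambda>n. \<bar>C\<bar> * ((1 + cmod z) / 2) ^ n)"
          using q by (intro summable_mult summable_half_geometric)
        then show "summable ?h" by (simp only: summable_of_real)
        show "range ?h \<subseteq> \<real>\<^sub>\<ge>\<^sub>0"
          by (auto simp del: of_real_mult of_real_power intro!: mult_nonneg_nonneg zero_le_power add_nonneg_nonneg)
        have "\<forall>y\<in>ball x d \<inter> S. cmod (?t n y) \<le> cmod (?h n)" if "n \<ge> N" for n
        proof
          fix y assume "y \<in> ball x d \<inter> S"
          then have "cmod (?t n y) \<le> C * ((1 + cmod z) / 2) ^ n" using * that by auto
          also have "\<dots> \<le> \<bar>C\<bar> * ((1 + cmod z) / 2) ^ n"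
            by (intro mult_right_mono zero_le_power) auto
          also have "\<dots> \<le> cmod (?h n)" unfolding norm_of_real by (rule abs_ge_self)
          finally show "cmod (?t n y) \<le> cmod (?h n)" .
        qed
        then show "\<forall>\<^sub>F n in sequentially. \<forall>y\<in>ball x d \<inter> S. cmod (?t n y) \<le> cmod (?h n)"
          unfolding eventually_sequentially by blast
      qed (use d in auto)
    qed
  qed auto
  have "g holomorphic_on S"
    using g by (auto simp: holomorphic_on_def intro: field_differentiable_at_within)
  then show ?thesis
    by (rule holomorphic_transform) (use g in \<open>auto simp: hypergeom_3F2_altdef sums_iff\<close>)
qed

section \<open>Coefficients in hypergeometric form\<close>

lemma cos_moment_shift:
  assumes "s \<notin> \<int>"
  shows "cos_moment (s - 2 * real n) = cos_moment s * pochhammer (- s / 2) n / pochhammer ((1 - s) / 2) n"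
proof (induction n)
  case (Suc n)
  let ?p = "s - 2 * real n"
  have ni: "?p \<notin> \<int>"
  proof
    assume "?p \<in> \<int>"
    then have "?p + 2 * real n \<in> \<int>" by (intro Ints_add Ints_mult) auto
    with assms show False by simp
  qed
  then have "?p - 1 \<noteq> 0" by (metis Ints_1 eq_iff_diff_eq_0)
  then have c: "cos_moment (?p - 2) = ?p / (?p - 1) * cos_moment ?p"
    using cos_moment_rec[OF ni] by (simp add: field_simps)
  \<comment> \<open>Dividing the recursion factor by -2 above and below exhibits the next factors of
    the two Pochhammer symbols.\<close>
  have "?p / (?p - 1) = (-2 * (- s / 2 + real n)) / (-2 * ((1 - s) / 2 + real n))"
    by (rule arg_cong2[where f = "(/)"]) (simp_all add: field_simps)
  also have "\<dots> = (- s / 2 + real n) / ((1 - s) / 2 + real n)"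
    by (rule mult_divide_mult_cancel_left) simp
  finally have r: "?p / (?p - 1) = (- s / 2 + real n) / ((1 - s) / 2 + real n)" .
  have "cos_moment (s - 2 * real (Suc n)) = cos_moment (?p - 2)" by (simp add: algebra_simps)
  then show ?case unfolding c r Suc pochhammer_rec' by (simp add: mult_ac)
qed simp

text \<open>Duplication of \<open>pochhammer (- s) (2 * n)\<close> and of
  \<open>fact (2 * n)\<close>; the powers of 4 cancel. Against two shifted moments one factor
  \<open>pochhammer ((1 - s) / 2) n\<close> drops out, leaving the coefficient of the second
  hypergeometric series.\<close>

lemma gbinomial_even_pochhammer:
  "(s gchoose (2 * n)) = pochhammer (- s / 2) n * pochhammer ((1 - s) / 2) n / (pochhammer (1 / 2) n * fact n :: real)"
proof -
  have e: "- s / 2 + 1 / 2 = (1 - s) / 2" "2 * (- s / 2) = - s" by (simp_all add: field_simps)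
  have "pochhammer (- s) (2 * n) = 4 ^ n * pochhammer (- s / 2) n * pochhammer ((1 - s) / 2) n"
    using pochhammer_double[of "- s / 2" n] unfolding e by (simp add: power_mult)
  moreover have "fact (2 * n) = (4 ^ n * pochhammer (1 / 2) n * fact n :: real)"
    by (simp add: fact_double power_mult)
  ultimately show ?thesis by (simp add: gbinomial_pochhammer)
qed

text \<open>Legendre duplication at \<open>(s + 1) / 2\<close> gives
  \<open>Gamma ((s + 1) / 2) * Gamma (s / 2 + 1)\<close>; the resulting power of 2, squared, cancels
  \<open>4 powr s\<close>.\<close>

lemma four_powr_mult_cos_moment_squared:
  assumes "s > -1"
  shows "4 powr s * (cos_moment s)\<^sup>2 = Gamma (s + 1) ^ 2 / Gamma (s / 2 + 1) ^ 4"
proof -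
  let ?z = "(s + 1) / 2"
  have np: "of_real x \<notin> (\<int>\<^sub>\<le>\<^sub>0 :: complex set)" if "x > 0" for x :: real
    using that by (auto elim!: nonpos_Ints_cases' simp: complex_eq_iff)
  have h: "?z + 1 / 2 = s / 2 + 1" "2 * ?z = s + 1" "1 - 2 * ?z = - s" by (simp_all add: field_simps)
  have "complex_of_real ?z + 1 / 2 = of_real (?z + 1 / 2)" "2 * complex_of_real ?z = of_real (2 * ?z)"
      "1 - 2 * complex_of_real ?z = of_real (1 - 2 * ?z)"
    by (simp_all only: of_real_add of_real_diff of_real_mult of_real_divide of_real_numeral of_real_1)
  note c = this[unfolded h]
  have "Gamma (complex_of_real ?z) * Gamma (complex_of_real ?z + 1 / 2)
     = exp ((1 - 2 * complex_of_real ?z) * of_real (ln 2)) * of_real (sqrt pi) * Gamma (2 * complex_of_real ?z)"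
    by (rule Gamma_legendre_duplication) (use np[of ?z] np[of "s / 2 + 1"] assms c(1) in auto)
  then have "complex_of_real (Gamma ?z * Gamma (s / 2 + 1)) = of_real (exp (- s * ln 2) * sqrt pi * Gamma (s + 1))"
    unfolding c Gamma_complex_of_real of_real_mult[symmetric] exp_of_real by (simp flip: exp_of_real)
  then have D: "Gamma ?z * Gamma (s / 2 + 1) = exp (- s * ln 2) * sqrt pi * Gamma (s + 1)"
    by (simp only: of_real_eq_iff)
  have pos: "Gamma (s / 2 + 1) > 0" using assms by (intro Gamma_real_pos) auto
  have "cos_moment s = (Gamma ?z * Gamma (s / 2 + 1)) / (sqrt pi * Gamma (s / 2 + 1) ^ 2)"
    using pos by (simp add: cos_moment_def power2_eq_square)
  also have "\<dots> = exp (- s * ln 2) * Gamma (s + 1) / Gamma (s / 2 + 1) ^ 2"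
    unfolding D by simp
  finally have "(cos_moment s)\<^sup>2 = (exp (- s * ln 2))\<^sup>2 * Gamma (s + 1) ^ 2 / Gamma (s / 2 + 1) ^ 4"
    by (simp add: power_divide power_mult_distrib flip: power_mult)
  moreover have "4 powr s * (exp (- s * ln 2))\<^sup>2 = 1"
  proof -
    have "ln (4::real) = 2 * ln 2" using ln_realpow[of 2 2] by simp
    then have "4 powr s = exp (2 * (s * ln 2))" by (simp add: powr_def mult_ac)
    moreover have "(exp (- s * ln 2))\<^sup>2 = exp (- (2 * (s * ln 2)))" by (simp flip: exp_of_nat_mult)
    ultimately show ?thesis by (simp flip: exp_add)
  qed
  ultimately show ?thesis by (simp add: mult.assoc[symmetric])
qed

definition W2_closed_form :: "real \<Rightarrow> complex \<Rightarrow> complex" where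
  "W2_closed_form k s =
      1 / (2 * of_real pi) * (tan (of_real pi * s / 2) / (s + 1)) *
        of_real \<bar>k\<bar> powr (1 + s) *
        hypergeom_3F2 (1/2) (1/2) (1/2) (1 + s/2) (3/2 + s/2) (of_real (k\<^sup>2 / 16))
    + Gamma (s + 1) ^ 2 / Gamma (s/2 + 1) ^ 4 *
        hypergeom_3F2 (-s/2) (-s/2) (-s/2) ((1 - s)/2) (1/2) (of_real (k\<^sup>2 / 16))"

lemma hypergeom_3F2_0: "hypergeom_3F2 a1 a2 a3 b1 b2 0 = 1"
proof -
  have "(\<Sum>n. hypergeom_term a1 a2 a3 b1 b2 0 n) = (\<Sum>n\<in>{0}. hypergeom_term a1 a2 a3 b1 b2 0 n)"
    by (rule suminf_finite) (auto simp: hypergeom_term_def)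
  then show ?thesis by (simp add: hypergeom_3F2_altdef hypergeom_term_def)
qed

lemma Gamma_quotient_of_real:
  "complex_of_real (Gamma (s + 1) ^ 2 / Gamma (s / 2 + 1) ^ 4) = Gamma (of_real s + 1) ^ 2 / Gamma (of_real s / 2 + 1) ^ 4"
  by (simp flip: Gamma_complex_of_real)

text \<open>The excluded odd integers are what \<open>(1 - z) / 2\<close> and the cosine under the
  tangent require; the other arguments have positive real part.\<close>

lemma nonpole_parameters:
  fixes z :: complex
  assumes "Re z > -1" "\<not> (\<exists>n::int. odd n \<and> z = of_int n)"
  shows "1 + z / 2 \<notin> \<int>\<^sub>\<le>\<^sub>0" "3 / 2 + z / 2 \<notin> \<int>\<^sub>\<le>\<^sub>0" "(1 - z) / 2 \<notin> \<int>\<^sub>\<le>\<^sub>0" "(1 / 2 :: complex) \<notin> \<int>\<^sub>\<le>\<^sub>0"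
    "z + 1 \<notin> \<int>\<^sub>\<le>\<^sub>0" "z / 2 + 1 \<notin> \<int>\<^sub>\<le>\<^sub>0" "cos (of_real pi * z / 2) \<noteq> 0"
proof -
  have *: "w \<notin> \<int>\<^sub>\<le>\<^sub>0" if "Re w > 0" for w :: complex
    using that by (auto elim!: nonpos_Ints_cases')
  show "1 + z / 2 \<notin> \<int>\<^sub>\<le>\<^sub>0" "3 / 2 + z / 2 \<notin> \<int>\<^sub>\<le>\<^sub>0" "(1 / 2 :: complex) \<notin> \<int>\<^sub>\<le>\<^sub>0"
    "z + 1 \<notin> \<int>\<^sub>\<le>\<^sub>0" "z / 2 + 1 \<notin> \<int>\<^sub>\<le>\<^sub>0"
    using assms(1) by (auto intro!: *)
  show "(1 - z) / 2 \<notin> \<int>\<^sub>\<le>\<^sub>0"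
  proof
    assume "(1 - z) / 2 \<in> \<int>\<^sub>\<le>\<^sub>0"
    then obtain n where "(1 - z) / 2 = - of_nat n" by (auto elim!: nonpos_Ints_cases')
    then have "z = of_int (2 * int n + 1)" by (simp add: field_simps)
    then show False using assms(2) by (metis even_plus_one_iff dvd_triv_left)
  qed
  show "cos (of_real pi * z / 2) \<noteq> 0"
  proof
    assume "cos (of_real pi * z / 2) = 0"
    then obtain n :: int where "of_real pi * z / 2 = of_real (of_int n * pi) + of_real pi / 2"
      by (auto simp: cos_eq_0)
    then have "of_real pi * z = of_real pi * (2 * of_int n + 1)" by (simp add: field_simps)
    then have "z = of_int (2 * n + 1)" by (simp del: distrib_left_numeral)
    then show False using assms(2) by (metis even_plus_one_iff dvd_triv_left)
  qed
qed

section \<open>The closed form on the real interval \<open>-1 < s < 0\<close>\<close>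

lemma W2_eq_closed_form_real_zero:
  assumes s: "-1 < s" "s < 0"
  shows "W2 0 (of_real s) = W2_closed_form 0 (of_real s)"
proof -
  have "W2 0 (of_real s) = of_real (4 powr s * (cos_moment s)\<^sup>2)"
    using nn_integral_torus_zero[OF s(1)] by (rule W2_of_real) simp
  then show ?thesis
    unfolding four_powr_mult_cos_moment_squared[OF s(1)] Gamma_quotient_of_real
    \<comment> \<open>The first summand vanishes through \<open>0 powr (1 + s) = 0\<close>, and both
      series reduce to 1 at argument 0.\<close>
    by (simp add: W2_closed_form_def hypergeom_3F2_0)
qed

text \<open>The outer expansion of the second average yields the summand with Gamma factors, its odd
  series the one with the tangent. Finiteness of the integral is recorded as well, since
  integrability on the torus is derived from it.\<close>

lemma W2_eq_closed_form_real_nonzero: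
  assumes s: "-1 < s" "s < 0" and k: "\<bar>k\<bar> < 4" "k \<noteq> 0"
  shows "W2 k (of_real s) = W2_closed_form k (of_real s)"
    and "(\<integral>\<^sup>+t. ennreal (torus_form k t powr s) * indicator torus_square t \<partial>lborel) < \<infinity>"
proof -
  define a b where "a n = (s gchoose (2 * n)) * cos_moment (s - 2 * real n)"
    and "b n = (s gchoose (2 * n)) * cos_moment (2 * real n)" for n
  interpret two_sided_expansion s "arcsine_mean (binomial_mean s)" a b
    unfolding a_def b_def by (rule two_sided_expansion_Legendre[OF s])
  define x where "x = 4 / \<bar>k\<bar>"
  define q where "q = k\<^sup>2 / 16"
  have x: "x > 1" "1 / x = \<bar>k\<bar> / 4" using k by (simp_all add: x_def)
  have q: "(1 / x)\<^sup>2 = q" "(\<bar>k\<bar> / 4)\<^sup>2 = q" unfolding x(2) by (simp_all add: q_def power_divide)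
  have q1: "0 \<le> q" "q < 1"
  proof -
    show "q < 1" using abs_square_less_1[of "\<bar>k\<bar> / 4"] k q(2) by simp
  qed (simp add: q_def)
  let ?S1 = "\<Sum>n. a n * cos_moment (s - 2 * real n) * x powr (s - 2 * real n)"
  let ?S2 = "\<Sum>j. arcsine_coeff j * (1 / x) ^ (1 + 2 * j) * Mellin_diff (1 + 2 * real j)"
  define V where "V = ?S1 + 2 / pi * ?S2"
  have V: "arcsine_mean (arcsine_mean (binomial_mean s)) x = ennreal V" "V \<ge> 0"
    using arcsine_mean_outside(1,3)[OF x(1)] unfolding V_def .
  have I: "(\<integral>\<^sup>+t. ennreal (torus_form k t powr s) * indicator torus_square t \<partial>lborel)
     = ennreal ((2 * pi)\<^sup>2 * (\<bar>k\<bar> powr s * V))"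
    using nn_integral_torus_nonzero[OF k(2), of s] V unfolding x_def by (simp add: ennreal_mult mult.assoc)
  then show "(\<integral>\<^sup>+t. ennreal (torus_form k t powr s) * indicator torus_square t \<partial>lborel) < \<infinity>" by simp
  have W: "W2 k (of_real s) = of_real (\<bar>k\<bar> powr s * V)"
    using I by (rule W2_of_real) (use V in simp)

  let ?z = "complex_of_real s" and ?q = "complex_of_real q"
  have z: "Re ?z > -1" "\<not> (\<exists>n::int. odd n \<and> ?z = of_int n)"
    using s s_notin_Ints by (auto simp: complex_eq_iff)
  note params = nonpole_parameters[OF z]
  have cq: "cmod ?q < 1" using q1 by simp
  let ?F1 = "hypergeom_term (-?z/2) (-?z/2) (-?z/2) ((1 - ?z)/2) (1/2) ?q"
  let ?F2 = "hypergeom_term (1/2) (1/2) (1/2) (1 + ?z/2) (3/2 + ?z/2) ?q"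

  let ?G = "Gamma (s + 1) ^ 2 / Gamma (s / 2 + 1) ^ 4"
  have t1: "complex_of_real (\<bar>k\<bar> powr s * (a n * cos_moment (s - 2 * real n) * x powr (s - 2 * real n))) = of_real ?G * ?F1 n" for n
  proof -
    have "x powr (s - 2 * real n) = x powr s * q ^ n"
      using powr_shift[of x s n] x by (simp only: q)
    moreover have "\<bar>k\<bar> powr s * x powr s = 4 powr s"
      using k by (simp add: x_def flip: powr_mult)
    ultimately have "\<bar>k\<bar> powr s * (a n * cos_moment (s - 2 * real n) * x powr (s - 2 * real n))
       = 4 powr s * (a n * cos_moment (s - 2 * real n) * q ^ n)"
      by (simp add: mult_ac)
    also have "\<dots> = (4 powr s * (cos_moment s)\<^sup>2) * (pochhammer (- s / 2) n * pochhammer (- s / 2) n * pochhammer (- s / 2) n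
        / (pochhammer ((1 - s) / 2) n * pochhammer (1 / 2) n) * (q ^ n / fact n))"
      unfolding a_def cos_moment_shift[OF s_notin_Ints] gbinomial_even_pochhammer
      using pochhammer_pos[of "(1 - s) / 2" n] s by (simp add: power2_eq_square mult_ac)
    also have "4 powr s * (cos_moment s)\<^sup>2 = ?G" by (rule four_powr_mult_cos_moment_squared[OF s(1)])
    finally show ?thesis
      by (simp add: hypergeom_term_def flip: pochhammer_of_real)
  qed
  have S1: "complex_of_real (\<bar>k\<bar> powr s * ?S1) = of_real ?G * (\<Sum>n. ?F1 n)"
  proof -
    \<comment> \<open>Convergence is known on the hypergeometric side and carried back to the real
      series, using that \<open>\<bar>k\<bar> powr s\<close> is nonzero.\<close>
    have sF: "summable ?F1" by (rule summable_hypergeom_term[OF cq params(3,4)])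
    have "(\<lambda>n. complex_of_real (\<bar>k\<bar> powr s * (a n * cos_moment (s - 2 * real n) * x powr (s - 2 * real n)))) sums (of_real ?G * (\<Sum>n. ?F1 n))"
      unfolding t1 by (intro sums_mult summable_sums sF)
    moreover from sums_summable[OF this]
    have "summable (\<lambda>n. \<bar>k\<bar> powr s * (a n * cos_moment (s - 2 * real n) * x powr (s - 2 * real n)))"
      by (simp only: summable_of_real_iff)
    then have "summable (\<lambda>n. a n * cos_moment (s - 2 * real n) * x powr (s - 2 * real n))"
      using k by (simp add: summable_cmult_iff)
    then have "(\<lambda>n. complex_of_real (\<bar>k\<bar> powr s * (a n * cos_moment (s - 2 * real n) * x powr (s - 2 * real n)))) sums complex_of_real (\<bar>k\<bar> powr s * ?S1)"
      by (intro sums_of_real sums_mult summable_sums)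
    ultimately show ?thesis by (rule sums_unique2[rotated])
  qed

  let ?C = "1 / (2 * of_real pi) * (tan (of_real pi * ?z / 2) / (?z + 1)) * of_real \<bar>k\<bar> powr (1 + ?z)"
  have t2: "complex_of_real (\<bar>k\<bar> powr s * (2 / pi) * (arcsine_coeff j * (1 / x) ^ (1 + 2 * j) * Mellin_diff (1 + 2 * real j))) = ?C * ?F2 j" for j
  proof -
    have z0: "?z \<notin> \<int>" using s_notin_Ints by (auto elim!: Ints_cases simp: complex_eq_iff)
    have M: "complex_of_real (Mellin_diff (1 + 2 * real j)) =
       tan (of_real pi * ?z / 2) * 4 ^ j * (pochhammer (1/2) j)\<^sup>2 / pochhammer (?z + 1) (2 * j + 1)"
      using Mellin_diff_odd_eqI[OF holomorphic_Mellin_Legendre, of j] Mellin_diff_Legendre[OF s]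
      by (simp only: Mellin_Legendre_odd[OF z0] a_def[abs_def] b_def[abs_def])
    \<comment> \<open>Splitting off the first factor gives \<open>1 / (s + 1)\<close>; duplication
      of the rest gives the two lower parameters and a \<open>4 ^ j\<close> that cancels the one in
      \<open>M\<close>.\<close>
    have P: "pochhammer (?z + 1) (2 * j + 1) = (?z + 1) * (4 ^ j * pochhammer (1 + ?z/2) j * pochhammer (3/2 + ?z/2) j)"
    proof -
      have e: "?z + 1 + 1 = 2 * (1 + ?z/2)" "1 + ?z/2 + 1/2 = 3/2 + ?z/2" by (simp_all add: field_simps)
      have "pochhammer (?z + 1) (2 * j + 1) = (?z + 1) * pochhammer (2 * (1 + ?z/2)) (2 * j)"
        using pochhammer_rec[of "?z + 1" "2 * j"] by (simp only: e Suc_eq_plus1)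
      then show ?thesis unfolding pochhammer_double e by (simp add: power_mult)
    qed
    \<comment> \<open>The single odd power \<open>1 / x = \<bar>k\<bar> / 4\<close> raises the
      exponent of \<open>\<bar>k\<bar>\<close> to \<open>1 + s\<close> and turns
      \<open>2 / pi\<close> into \<open>1 / (2 * pi)\<close>.\<close>
    have "\<bar>k\<bar> powr s * (2 / pi) * (1 / x) ^ (1 + 2 * j) = 1 / (2 * pi) * \<bar>k\<bar> powr (1 + s) * q ^ j"
      unfolding power_add power_mult q using k by (simp add: x powr_add)
    then have "complex_of_real (\<bar>k\<bar> powr s * (2 / pi) * (1 / x) ^ (1 + 2 * j)) = of_real (1 / (2 * pi) * \<bar>k\<bar> powr (1 + s) * q ^ j)"
      by (simp only:)
    also have "\<dots> = 1 / (2 * of_real pi) * of_real \<bar>k\<bar> powr (1 + ?z) * ?q ^ j"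
      using powr_of_real[of "\<bar>k\<bar>" "1 + s"] by simp
    finally have A: "complex_of_real (\<bar>k\<bar> powr s * (2 / pi) * (1 / x) ^ (1 + 2 * j)) = 1 / (2 * of_real pi) * of_real \<bar>k\<bar> powr (1 + ?z) * ?q ^ j" .
    have B: "complex_of_real (arcsine_coeff j) = pochhammer (1/2) j / fact j"
      by (simp add: arcsine_coeff_def flip: pochhammer_of_real)
    have "complex_of_real (\<bar>k\<bar> powr s * (2 / pi) * (arcsine_coeff j * (1 / x) ^ (1 + 2 * j) * Mellin_diff (1 + 2 * real j)))
      = complex_of_real (\<bar>k\<bar> powr s * (2 / pi) * (1 / x) ^ (1 + 2 * j)) * (complex_of_real (arcsine_coeff j) * complex_of_real (Mellin_diff (1 + 2 * real j)))"
      by (simp only: of_real_mult mult_ac)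
    also have "\<dots> = ?C * ?F2 j"
      unfolding A B M P hypergeom_term_def by (simp add: power2_eq_square mult_ac)
    finally show ?thesis .
  qed
  have S2: "complex_of_real (\<bar>k\<bar> powr s * (2 / pi) * ?S2) = ?C * (\<Sum>j. ?F2 j)"
  proof -
    have sF: "summable ?F2" by (rule summable_hypergeom_term[OF cq params(1,2)])
    have "(\<lambda>j. complex_of_real (\<bar>k\<bar> powr s * (2 / pi) * (arcsine_coeff j * (1 / x) ^ (1 + 2 * j) * Mellin_diff (1 + 2 * real j)))) sums (?C * (\<Sum>n. ?F2 n))"
      unfolding t2 by (intro sums_mult summable_sums sF)
    moreover have "(\<lambda>j. complex_of_real (\<bar>k\<bar> powr s * (2 / pi) * (arcsine_coeff j * (1 / x) ^ (1 + 2 * j) * Mellin_diff (1 + 2 * real j)))) sums complex_of_real (\<bar>k\<bar> powr s * (2 / pi) * ?S2)"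
      by (intro sums_of_real sums_mult summable_sums arcsine_mean_outside(2)[OF x(1)])
    ultimately show ?thesis by (rule sums_unique2[rotated])
  qed
  have "\<bar>k\<bar> powr s * V = \<bar>k\<bar> powr s * (2 / pi) * ?S2 + \<bar>k\<bar> powr s * ?S1"
    by (simp add: V_def algebra_simps)
  then have "W2 k ?z = complex_of_real (\<bar>k\<bar> powr s * (2 / pi) * ?S2) + of_real (\<bar>k\<bar> powr s * ?S1)"
    unfolding W by (simp only: of_real_add)
  then show "W2 k ?z = W2_closed_form k ?z"
    unfolding S1 S2 Gamma_quotient_of_real W2_closed_form_def hypergeom_3F2_altdef q_def[symmetric] .
qed

section \<open>Integrability and holomorphic dependence of the torus integral on
  \<open>s\<close>\<close>

lemma sum_exp_times_powr_le:
  fixes y r \<rho> :: real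
  assumes "y \<ge> 0" "\<rho> \<ge> 0"
  shows "(\<Sum>i<n. y powr r * (\<rho> * \<bar>ln y\<bar>) ^ i / fact i) \<le> y powr (r + \<rho>) + y powr (r - \<rho>)"
proof (cases "y = 0")
  case False
  then have y: "y > 0" using assms by simp
  let ?e = "\<lambda>i. (\<rho> * \<bar>ln y\<bar>) ^ i /\<^sub>R fact i"
  have "(\<Sum>i<n. (\<rho> * \<bar>ln y\<bar>) ^ i / fact i) = sum ?e {..<n}"
    by (intro sum.cong refl) (simp add: field_simps)
  also have "\<dots> \<le> suminf ?e"
    by (rule sum_le_suminf[OF summable_exp_generic]) (use assms in auto)
  also have "\<dots> = exp (\<rho> * \<bar>ln y\<bar>)" unfolding exp_def ..
  \<comment> \<open>The exponential equals one of the two powers, according to the sign of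
    \<open>ln y\<close>; keeping both avoids a case distinction in the majorant.\<close>
  also have "\<dots> \<le> y powr \<rho> + y powr (- \<rho>)"
    using y by (cases "ln y \<ge> 0") (auto simp: powr_def add_increasing add_increasing2)
  finally have "y powr r * (\<Sum>i<n. (\<rho> * \<bar>ln y\<bar>) ^ i / fact i) \<le> y powr r * (y powr \<rho> + y powr (- \<rho>))"
    by (intro mult_left_mono) auto
  then show ?thesis by (simp add: sum_distrib_left distrib_left flip: powr_add)
qed simp

text \<open>Expanding \<open>f powr s = f powr s0 * exp ((s - s0) * ln f)\<close> in powers of \<open>s - s0\<close> under the integral.\<close>

lemma holomorphic_integral_powr:
  fixes f :: "'a \<Rightarrow> real"
  assumes [measurable]: "f \<in> borel_measurable M"
    and nonneg: "\<And>x. f x \<ge> 0" and int: "\<And>r. r > c \<Longrightarrow> integrable M (\<lambda>x. f x powr r)"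
  shows "(\<lambda>s. LINT x|M. complex_of_real (f x) powr s) holomorphic_on {s. Re s > c}"
proof -
  have "(\<lambda>s. LINT x|M. complex_of_real (f x) powr s) field_differentiable (at s0)" if s0: "Re s0 > c" for s0
  proof -
    \<comment> \<open>Half the distance to the boundary, so that both exponents
      \<open>Re s0 - \<rho>\<close> and \<open>Re s0 + \<rho>\<close> of the majorant remain above
      \<open>c\<close>.\<close>
    define \<rho> where "\<rho> = (Re s0 - c) / 2"
    have \<rho>: "\<rho> > 0" "Re s0 - \<rho> > c" "Re s0 + \<rho> > c" using s0 by (auto simp: \<rho>_def field_simps)
    let ?g = "\<lambda>i x. complex_of_real (f x) powr s0 * of_real (ln (f x)) ^ i / fact i"
    have g_norm: "norm (?g i x * w ^ i) \<le> f x powr Re s0 * (\<rho> * \<bar>ln (f x)\<bar>) ^ i / fact i" if "norm w \<le> \<rho>" for i x w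
    proof -
      have "norm (?g i x * w ^ i) = f x powr Re s0 * \<bar>ln (f x)\<bar> ^ i * norm w ^ i / fact i"
        using nonneg[of x] by (simp add: norm_mult norm_divide norm_power norm_powr_real_powr)
      also have "\<dots> \<le> f x powr Re s0 * \<bar>ln (f x)\<bar> ^ i * \<rho> ^ i / fact i"
        using that by (intro divide_right_mono mult_left_mono power_mono) auto
      finally show ?thesis by (simp add: power_mult_distrib mult_ac)
    qed
    let ?B = "\<lambda>x. f x powr (Re s0 + \<rho>) + f x powr (Re s0 - \<rho>)"
    have int_B: "integrable M ?B" using \<rho> by (intro Bochner_Integration.integrable_add int)
    have B: "(\<Sum>i<n. norm (?g i x * w ^ i)) \<le> ?B x" if "norm w \<le> \<rho>" for n x w
    proof -
      have "(\<Sum>i<n. norm (?g i x * w ^ i)) \<le> (\<Sum>i<n. f x powr Re s0 * (\<rho> * \<bar>ln (f x)\<bar>) ^ i / fact i)"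
        by (intro sum_mono g_norm that)
      also have "\<dots> \<le> ?B x" using \<rho> by (intro sum_exp_times_powr_le nonneg) auto
      finally show ?thesis .
    qed
    have B1: "norm (?g i x * w ^ i) \<le> ?B x" if "norm w \<le> \<rho>" for i x w
    proof -
      have "norm (?g i x * w ^ i) \<le> (\<Sum>i<Suc i. norm (?g i x * w ^ i))"
        by (rule member_le_sum) auto
      also have "\<dots> \<le> ?B x" by (rule B[OF that])
      finally show ?thesis .
    qed
    have int_g: "integrable M (\<lambda>x. ?g i x * w ^ i)" if "norm w \<le> \<rho>" for i w
      by (rule Bochner_Integration.integrable_bound[OF int_B])
         (use B1[OF that] in \<open>auto intro!: AE_I2 order.trans[OF B1[OF that]]\<close>)
    have sums: "(\<lambda>i. (LINT x|M. ?g i x) * w ^ i) sums (LINT x|M. complex_of_real (f x) powr (s0 + w))" if w: "norm w \<le> \<rho>" for w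
    proof -
      have "(\<lambda>i. LINT x|M. ?g i x * w ^ i) sums (LINT x|M. (\<Sum>i. ?g i x * w ^ i))"
      proof (rule sums_integral)
        show "integrable M (\<lambda>x. ?g i x * w ^ i)" for i by (rule int_g[OF w])
        show "AE x in M. summable (\<lambda>i. norm (?g i x * w ^ i))"
          by (rule AE_I2, rule summableI_nonneg_bounded[OF _ B[OF w]]) auto
        show "summable (\<lambda>i. LINT x|M. norm (?g i x * w ^ i))"
        proof (rule summableI_nonneg_bounded)
          fix n
          have "(\<Sum>i<n. LINT x|M. norm (?g i x * w ^ i)) = (LINT x|M. (\<Sum>i<n. norm (?g i x * w ^ i)))"
            by (rule Bochner_Integration.integral_sum[symmetric]) (intro integrable_norm int_g w)
          also have "\<dots> \<le> (LINT x|M. ?B x)"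
            by (intro integral_mono Bochner_Integration.integrable_sum integrable_norm int_g int_B w B)
          finally show "(\<Sum>i<n. LINT x|M. norm (?g i x * w ^ i)) \<le> (LINT x|M. ?B x)" .
        qed auto
      qed
      also have "(\<lambda>i. LINT x|M. ?g i x * w ^ i) = (\<lambda>i. (LINT x|M. ?g i x) * w ^ i)" by simp
      also have "(LINT x|M. (\<Sum>i. ?g i x * w ^ i)) = (LINT x|M. complex_of_real (f x) powr (s0 + w))"
      proof (rule Bochner_Integration.integral_cong[OF refl])
        fix x
        show "(\<Sum>i. ?g i x * w ^ i) = complex_of_real (f x) powr (s0 + w)"
        \<comment> \<open>Where \<open>f x = 0\<close>, all terms and the value vanish by the
          convention \<open>0 powr w = 0\<close>.\<close>
        proof (cases "f x = 0")
          case False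
          then have fx: "f x > 0" using nonneg[of x] by simp
          have "(\<lambda>i. complex_of_real (f x) powr s0 * ((w * of_real (ln (f x))) ^ i /\<^sub>R fact i))
             sums (complex_of_real (f x) powr s0 * exp (w * of_real (ln (f x))))"
            by (intro sums_mult exp_converges)
          also have "(\<lambda>i. complex_of_real (f x) powr s0 * ((w * of_real (ln (f x))) ^ i /\<^sub>R fact i)) = (\<lambda>i. ?g i x * w ^ i)"
            by (auto simp: scaleR_conv_of_real power_mult_distrib field_simps)
          also have "complex_of_real (f x) powr s0 * exp (w * of_real (ln (f x))) = complex_of_real (f x) powr (s0 + w)"
            using fx by (simp add: powr_add powr_def[of _ w] Ln_of_real)
          finally show ?thesis by (simp add: sums_iff)
        qed simp
      qed
      finally show ?thesis .
    qed
    have "(\<lambda>s. LINT x|M. complex_of_real (f x) powr s) holomorphic_on ball s0 \<rho>"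
    proof (rule power_series_holomorphic)
      fix s assume "s \<in> ball s0 \<rho>"
      then have "norm (s - s0) \<le> \<rho>" by (simp add: dist_norm norm_minus_commute)
      from sums[OF this] show "(\<lambda>i. (LINT x|M. ?g i x) * (s - s0) ^ i) sums (LINT x|M. complex_of_real (f x) powr s)"
        by simp
    qed
    then show ?thesis
      using \<rho> by (auto simp: holomorphic_on_open field_differentiable_def)
  qed
  then show ?thesis
    by (auto simp: holomorphic_on_def intro: field_differentiable_at_within)
qed

lemma nn_integral_torus_finite:
  assumes "-1 < s" "s < 0" "\<bar>k\<bar> < 4"
  shows "(\<integral>\<^sup>+t. ennreal (torus_form k t powr s) * indicator torus_square t \<partial>lborel) < \<infinity>"
  using W2_eq_closed_form_real_nonzero(2)[OF assms] nn_integral_torus_zero[OF assms(1)]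
  by (cases "k = 0") auto

text \<open>Negative exponents are covered by the finite values already computed. For the others,
  boundedness of the form by 8 reduces the claim to the exponent \<open>-1/2\<close>.\<close>

lemma integrable_torus_form_powr:
  assumes k: "\<bar>k\<bar> < 4" and r: "r > -1"
  shows "integrable (restrict_space lborel torus_square) (\<lambda>t. torus_form k t powr r)"
proof -
  have neg: "integrable (restrict_space lborel torus_square) (\<lambda>t. torus_form k t powr r)" if "-1 < r" "r < 0" for r
  proof (rule integrableI_bounded)
    have "(\<integral>\<^sup>+t. ennreal (norm (torus_form k t powr r)) \<partial>restrict_space lborel torus_square)
       = (\<integral>\<^sup>+t. ennreal (torus_form k t powr r) * indicator torus_square t \<partial>lborel)"
      by (subst nn_integral_restrict_space) auto
    then show "(\<integral>\<^sup>+t. ennreal (norm (torus_form k t powr r)) \<partial>restrict_space lborel torus_square) < \<infinity>"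
      using nn_integral_torus_finite[OF that k] by simp
  qed (auto intro: measurable_restrict_space1)
  show ?thesis
  proof (cases "r < 0")
    case False
    have le: "torus_form k t \<le> 8" for t
    proof -
      have "\<bar>cos (fst t) * cos (snd t)\<bar> \<le> 1 * 1"
        unfolding abs_mult by (intro mult_mono) auto
      then show ?thesis using k unfolding torus_form_def mult.assoc by linarith
    qed
    show ?thesis
    proof (rule Bochner_Integration.integrable_bound)
      show "integrable (restrict_space lborel torus_square) (\<lambda>t. torus_form k t powr (- 1/2) * 8 powr (r + 1/2))"
        by (intro integrable_mult_left neg) auto
      show "AE t in restrict_space lborel torus_square. norm (torus_form k t powr r) \<le> norm (torus_form k t powr (- 1/2) * 8 powr (r + 1/2))"
      proof (rule AE_I2)
        fix t
        have "torus_form k t powr r = torus_form k t powr (- 1/2) * torus_form k t powr (r + 1/2)"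
          by (simp flip: powr_add)
        also have "\<dots> \<le> torus_form k t powr (- 1/2) * 8 powr (r + 1/2)"
          using False le[of t] by (intro mult_left_mono powr_mono2) (auto simp: torus_form_def)
        finally show "norm (torus_form k t powr r) \<le> norm (torus_form k t powr (- 1/2) * 8 powr (r + 1/2))" by simp
      qed
    qed (auto intro: measurable_restrict_space1)
  qed (use neg r in auto)
qed

lemma holomorphic_W2:
  assumes "\<bar>k\<bar> < 4"
  shows "W2 k holomorphic_on {s. Re s > -1}"
proof -
  have "W2 k s = 1 / (2 * of_real pi)\<^sup>2 * (LINT t | restrict_space lborel torus_square. of_real (torus_form k t) powr s)" for s
    unfolding W2_altdef set_lebesgue_integral_def by (subst integral_restrict_space) auto
  then have "W2 k = (\<lambda>s. 1 / (2 * of_real pi)\<^sup>2 * (LINT t | restrict_space lborel torus_square. of_real (torus_form k t) powr s))"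
    by auto
  moreover have "(\<lambda>s. LINT t | restrict_space lborel torus_square. complex_of_real (torus_form k t) powr s) holomorphic_on {s. Re s > -1}"
  proof (rule holomorphic_integral_powr)
    show "torus_form k \<in> borel_measurable (restrict_space lborel torus_square)"
      by (rule measurable_restrict_space1) simp
  qed (use integrable_torus_form_powr[OF assms] in \<open>auto simp: torus_form_def\<close>)
  ultimately show ?thesis by (simp only:) (intro holomorphic_intros)
qed

section \<open>Analytic continuation in \<open>s\<close>\<close>

definition parameter_domain :: "complex set" where
  "parameter_domain = {s. Re s > -1} - of_int ` {n. odd n}"

lemma open_parameter_domain: "open parameter_domain"
  unfolding parameter_domain_def by (intro open_Diff open_halfspace_Re_gt closed_of_int_image)

lemma connected_parameter_domain: "connected parameter_domain"
  unfolding parameter_domain_def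
  by (intro connected_open_diff_countable open_halfspace_Re_gt convex_connected convex_halfspace_Re_gt) auto

lemma holomorphic_W2_closed_form:
  assumes "\<bar>k\<bar> < 4"
  shows "W2_closed_form k holomorphic_on parameter_domain"
proof -
  have q: "cmod (of_real (k\<^sup>2 / 16)) < 1"
    unfolding norm_of_real using abs_square_less_1[of "k / 4"] assms by (simp add: power_divide)
  have D: "Re s > -1" "\<not> (\<exists>n::int. odd n \<and> s = of_int n)" if "s \<in> parameter_domain" for s
    using that by (auto simp: parameter_domain_def)
  note params = nonpole_parameters[OF D]
  have h1: "(\<lambda>s. hypergeom_3F2 (1/2) (1/2) (1/2) (1 + s/2) (3/2 + s/2) (of_real (k\<^sup>2 / 16))) holomorphic_on parameter_domain"
    by (rule holomorphic_hypergeom_3F2[OF open_parameter_domain q]) (use params in \<open>auto intro!: holomorphic_intros\<close>)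
  have h2: "(\<lambda>s. hypergeom_3F2 (-s/2) (-s/2) (-s/2) ((1 - s)/2) (1/2) (of_real (k\<^sup>2 / 16))) holomorphic_on parameter_domain"
    by (rule holomorphic_hypergeom_3F2[OF open_parameter_domain q]) (use params in \<open>auto intro!: holomorphic_intros\<close>)
  have nz: "s + 1 \<noteq> 0" "Gamma (s / 2 + 1) \<noteq> 0" if "s \<in> parameter_domain" for s
    using params(5,6)[OF that that] by (auto simp: Gamma_eq_zero_iff)
  show ?thesis
    unfolding W2_closed_form_def tan_def
    by (intro holomorphic_intros h1 h2) (use params nz in auto)
qed

theorem theorem1p6:
  fixes k :: real and s :: complex
  assumes "\<bar>k\<bar> < 4"
    and "Re s > -1"
    and "\<not> (\<exists>n::int. odd n \<and> s = of_int n)"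
  shows "W2 k s =
      1 / (2 * of_real pi) * (tan (of_real pi * s / 2) / (s + 1)) *
        of_real \<bar>k\<bar> powr (1 + s) *
        hypergeom_3F2 (1/2) (1/2) (1/2) (1 + s/2) (3/2 + s/2) (of_real (k\<^sup>2 / 16))
    + Gamma (s + 1) ^ 2 / Gamma (s/2 + 1) ^ 4 *
        hypergeom_3F2 (-s/2) (-s/2) (-s/2) ((1 - s)/2) (1/2) (of_real (k\<^sup>2 / 16))"
proof -
  \<comment> \<open>The interval where the identity is known contains no integer, so it lies in the
    domain and accumulates at its midpoint.\<close>
  let ?U = "complex_of_real ` {-1<..<0}" and ?z = "complex_of_real (-1/2)"
  have mem: "complex_of_real r \<in> parameter_domain" if "-1 < r" "r < 0" for r
  proof -
    have "complex_of_real r \<noteq> of_int n" for n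
    proof
      assume "complex_of_real r = of_int n"
      then have "complex_of_real r = of_real (of_int n)" by simp
      then have "r = of_int n" by (simp only: of_real_eq_iff)
      then show False using that by auto
    qed
    then show ?thesis using that by (auto simp: parameter_domain_def)
  qed
  have "W2 k s - W2_closed_form k s = 0"
  proof (rule analytic_continuation[of "\<lambda>s. W2 k s - W2_closed_form k s" parameter_domain ?U ?z])
    have "W2 k holomorphic_on parameter_domain"
      by (rule holomorphic_on_subset[OF holomorphic_W2[OF assms(1)]]) (auto simp: parameter_domain_def)
    then show "(\<lambda>s. W2 k s - W2_closed_form k s) holomorphic_on parameter_domain"
      by (intro holomorphic_intros holomorphic_W2_closed_form assms)
    show "?U \<subseteq> parameter_domain" using mem by auto
    show "?z \<in> parameter_domain" by (rule mem) auto
    show "?z islimpt ?U"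
      unfolding islimpt_approachable
    proof (intro allI impI)
      fix e :: real assume "e > 0"
      define t where "t = min (e / 2) (1 / 4)"
      have t: "t > 0" "t < e" "t \<le> 1 / 4" using \<open>e > 0\<close> by (auto simp: t_def min_def)
      show "\<exists>x'\<in>?U. x' \<noteq> ?z \<and> dist x' ?z < e"
      proof (intro bexI conjI)
        show "complex_of_real (- 1 / 2 + t) \<in> ?U" using t by (intro imageI) auto
        show "complex_of_real (- 1 / 2 + t) \<noteq> ?z" using t by (simp only: of_real_eq_iff)
        show "dist (complex_of_real (- 1 / 2 + t)) ?z < e" using t by (simp add: dist_norm)
      qed
    qed
    show "W2 k z - W2_closed_form k z = 0" if "z \<in> ?U" for z
      using that W2_eq_closed_form_real_zero W2_eq_closed_form_real_nonzero(1)[OF _ _ assms(1)]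
      by (cases "k = 0") auto
    show "s \<in> parameter_domain" using assms by (auto simp: parameter_domain_def)
  qed (use open_parameter_domain connected_parameter_domain in auto)
  then show ?thesis by (simp add: W2_closed_form_def)
qed

end
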